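(* Let $\mathscr{A}$ be a unital C*-algebra, $\mathcal{H}$ a Hilbert space, and let $\phi = (\phi_k)_{k=1}^{m}$ be an ordered $m$-tuple of bounded unital *-maps $\phi_k : \mathscr{A}\to\mathscr{A}$. A bounded linear map $\varphi : \mathscr{A}\to B(\mathcal{H})$ is finitely decomposable with respect to $\phi$ if and only if for every $n\in\mathbb{N}$ and every $[a_{ij}]_{i,j}\in \mathbb{M}_n(\mathscr{A})$, $$[a_{ij}]_{i,j} \in \Gamma_{n}^{+}(\phi) \ \Longrightarrow\ [\varphi(a_{ij})]_{i,j} \in \mathbb{M}_n(B(\mathcal{H}))^+ .$$
   Context: For a C*-algebra $\mathscr{M}$, $\mathscr{M}^+$ denotes its convex cone of positive elements and $\mathbb{M}_n(\mathscr{M})\simeq \mathbb{M}_n(\mathbb{C})\otimes\mathscr{M}$ the C*-algebra of $n\times n$ matrices over $\mathscr{M}$. A *-map is a linear map $f$ with $f(a^* )=f(a)^*$ for all $a$; it is unital if it maps the unit to the unit. A map $\psi:\mathscr{A}\to B(\mathcal{H})$ is completely positive (c.p.) if it is a bounded *-map and $\mathrm{id}_n\otimes\psi:\mathbb{M}_n(\mathscr{A})\to\mathbb{M}_n(B(\mathcal{H}))$, $[a_{ij}]\mapsto[\psi(a_{ij})]$, maps positive elements to positive elements for all $n\in\mathbb{N}$. $B(\mathscr{A},B(\mathcal{H}))$ denotes the bounded linear maps from $\mathscr{A}$ to $B(\mathcal{H})$. A map $\varphi\in B(\mathscr{A},B(\mathcal{H}))$ is finitely decomposable with respect to $\phi=(\phi_k)_{k=1}^m$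 if there are c.p. maps $\psi_1,\dots,\psi_m:\mathscr{A}\to B(\mathcal{H})$ with $\varphi=\sum_{k=1}^m\psi_k\circ\phi_k$. For $n\in\mathbb{N}$, $\Gamma_n^+(\phi)=\{[a_{ij}]_{i,j}\in\mathbb{M}_n(\mathscr{A}) : [\phi_k(a_{ij})]_{i,j}\in\mathbb{M}_n(\mathscr{A})^+ \text{ for all } k\}$. *)

theory Defs
  imports "HOL-Analysis.Analysis" "Jordan_Normal_Form.Matrix"
begin

section \<open>Complex normed spaces and Hilbert spaces\<close>

class scaleC = scaleR +
  fixes scaleC :: "complex \<Rightarrow> 'a \<Rightarrow> 'a" (infixr "*\<^sub>C" 75)
  assumes scaleR_scaleC: "r *\<^sub>R x = complex_of_real r *\<^sub>C x"

class complex_vector = scaleC + ab_group_add +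
  assumes scaleC_add_right: "c *\<^sub>C (x + y) = c *\<^sub>C x + c *\<^sub>C y"
    and scaleC_add_left: "(c + d) *\<^sub>C x = c *\<^sub>C x + d *\<^sub>C x"
    and scaleC_scaleC: "c *\<^sub>C d *\<^sub>C x = (c * d) *\<^sub>C x"
    and scaleC_one: "1 *\<^sub>C x = x"

subclass (in complex_vector) real_vector
  by standard (simp_all add: scaleR_scaleC scaleC_add_right scaleC_add_left scaleC_scaleC scaleC_one)

class complex_normed_vector = complex_vector + real_normed_vector +
  assumes norm_scaleC: "norm (c *\<^sub>C x) = cmod c * norm x"

text \<open>The inner product is linear in the first argument.  The last axiom makes it positive
  definite and says that it induces the norm.\<close>

class complex_inner = complex_normed_vector +
  fixes cinner :: "'a \<Rightarrow> 'a \<Rightarrow> complex"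
  assumes cinner_commute: "cinner x y = cnj (cinner y x)"
    and cinner_add_left: "cinner (x + y) z = cinner x z + cinner y z"
    and cinner_scaleC_left: "cinner (c *\<^sub>C x) y = c * cinner x y"
    and cinner_self: "cinner x x = complex_of_real ((norm x)\<^sup>2)"

class chilbert_space = complex_inner + banach

definition bounded_clinear :: "('a::complex_normed_vector \<Rightarrow> 'b::complex_normed_vector) \<Rightarrow> bool" where
  "bounded_clinear f \<longleftrightarrow> bounded_linear f \<and> (\<forall>c x. f (c *\<^sub>C x) = c *\<^sub>C f x)"

lemma scaleC_zero_right [simp]: "c *\<^sub>C (0::'a::complex_vector) = 0"
  by (metis add_cancel_right_right scaleC_add_right)

lemma scaleC_minus_right: "c *\<^sub>C (- x) = - (c *\<^sub>C (x::'a::complex_vector))"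
  by (metis add.right_inverse add_eq_0_iff scaleC_add_right scaleC_zero_right)

lemma scaleC_diff_right: "c *\<^sub>C (x - y) = c *\<^sub>C x - c *\<^sub>C (y::'a::complex_vector)"
  by (metis diff_conv_add_uminus scaleC_add_right scaleC_minus_right)

lemma bounded_linear_scaleC: "bounded_linear (\<lambda>x::'a::complex_normed_vector. c *\<^sub>C x)"
  by (rule bounded_linear_intro[where K = "cmod c"])
    (simp_all add: scaleC_add_right scaleR_scaleC scaleC_scaleC mult.commute norm_scaleC)

lemma cinner_add_right: "cinner x (y + z) = cinner x y + cinner x (z::'a::complex_inner)"
  by (metis cinner_add_left cinner_commute complex_cnj_add)

lemma cinner_scaleC_right: "cinner x (c *\<^sub>C y) = cnj c * cinner x (y::'a::complex_inner)"
  by (metis cinner_commute cinner_scaleC_left complex_cnj_mult)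

lemma cinner_zero_left [simp]: "cinner 0 (y::'a::complex_inner) = 0"
  by (metis add_cancel_right_right cinner_add_left)

lemma cinner_minus_left: "cinner (- x) y = - cinner x (y::'a::complex_inner)"
  by (metis add.right_inverse add_eq_0_iff cinner_add_left cinner_zero_left)

lemma cinner_diff_left: "cinner (x - y) z = cinner x z - cinner y (z::'a::complex_inner)"
  by (metis diff_conv_add_uminus cinner_add_left cinner_minus_left)

lemma cinner_diff_right: "cinner x (y - z) = cinner x y - cinner x (z::'a::complex_inner)"
  by (metis cinner_diff_left cinner_commute complex_cnj_diff)

lemma norm_add_sq: "(norm (x + y))\<^sup>2 = (norm x)\<^sup>2 + (norm y)\<^sup>2 + 2 * Re (cinner x (y::'a::complex_inner))"
proof -
  have "complex_of_real ((norm (x + y))\<^sup>2)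
      = complex_of_real ((norm x)\<^sup>2) + complex_of_real ((norm y)\<^sup>2) + (cinner x y + cinner y x)"
    by (simp add: cinner_self[symmetric] cinner_add_left cinner_add_right del: of_real_power)
  also have "cinner x y + cinner y x = complex_of_real (2 * Re (cinner x y))"
    by (subst (2) cinner_commute) (simp add: complex_add_cnj)
  finally show ?thesis
    by (metis of_real_add of_real_eq_iff)
qed

lemma cinner_Cauchy_Schwarz: "cmod (cinner x y) \<le> norm x * norm (y::'a::complex_inner)"
proof (cases "y = 0")
  case True
  have "cinner x 0 = 0" by (subst cinner_commute) simp
  then show ?thesis using True by simp
next
  case False
  define c where "c = - cinner x y / complex_of_real ((norm y)\<^sup>2)"
  have ny: "(norm y)\<^sup>2 > 0" using False by simp
  have cc: "c * cnj (cinner x y) = - complex_of_real ((cmod (cinner x y))\<^sup>2 / (norm y)\<^sup>2)"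
    unfolding c_def by (simp add: complex_norm_square[symmetric] del: of_real_power)
  have "cnj c * cinner x y = cnj (c * cnj (cinner x y))" by simp
  also have "\<dots> = - complex_of_real ((cmod (cinner x y))\<^sup>2 / (norm y)\<^sup>2)" unfolding cc by simp
  finally have re: "Re (cinner x (c *\<^sub>C y)) = - ((cmod (cinner x y))\<^sup>2 / (norm y)\<^sup>2)"
    by (simp add: cinner_scaleC_right del: of_real_divide of_real_power)
  have nc: "(norm (c *\<^sub>C y))\<^sup>2 = (cmod (cinner x y))\<^sup>2 / (norm y)\<^sup>2"
    using ny unfolding c_def
    by (simp add: norm_scaleC norm_divide power_mult_distrib power_divide power2_eq_square norm_power norm_mult)
  have "0 \<le> (norm (x + c *\<^sub>C y))\<^sup>2" by simp
  also have "\<dots> = (norm x)\<^sup>2 - (cmod (cinner x y))\<^sup>2 / (norm y)\<^sup>2"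
    unfolding norm_add_sq re nc by simp
  finally have "(cmod (cinner x y))\<^sup>2 \<le> (norm x * norm y)\<^sup>2"
    using ny by (simp add: field_simps power_mult_distrib)
  then show ?thesis by (rule power2_le_imp_le) simp
qed

lemma cinner_right_eqI: "y = z" if "\<And>x. cinner x y = cinner x (z::'a::complex_inner)"
proof -
  have "cinner (y - z) (y - z) = 0" using that[of "y - z"] by (simp add: cinner_diff_right)
  then show ?thesis by (simp add: cinner_self)
qed

lemma riesz_representation:
  fixes f :: "'a::chilbert_space \<Rightarrow> complex"
  assumes add: "\<And>x y. f (x + y) = f x + f y" and hom: "\<And>c x. f (c *\<^sub>C x) = c * f x"
    and bd: "\<And>x. cmod (f x) \<le> K * norm x"
  shows "\<exists>z. \<forall>x. f x = cinner x z"
proof -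
  define J where "J x = (norm x)\<^sup>2 - 2 * Re (f x)" for x
  define m where "m = Inf (range J)"
  have lin: "bounded_linear f"
    by (rule bounded_linear_intro[where K = K])
      (use add hom bd in \<open>auto simp: scaleR_scaleC scaleR_conv_of_real mult.commute\<close>)
  have Jbd: "- K\<^sup>2 \<le> J x" for x
  proof -
    have "Re (f x) \<le> K * norm x" using bd[of x] complex_Re_le_cmod[of "f x"] by linarith
    moreover have "0 \<le> (norm x - K)\<^sup>2" by simp
    ultimately show ?thesis unfolding J_def by (simp add: power2_diff algebra_simps)
  qed
  have bdd: "bdd_below (range J)" using Jbd by (auto intro!: bdd_belowI[of _ "- K\<^sup>2"])
  have m_le: "m \<le> J x" for x unfolding m_def by (rule cInf_lower) (use bdd in auto)
  have "\<exists>x. J x < m + 1 / real (Suc n)" for n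
    using cInf_lessD[of "range J" "m + 1 / real (Suc n)"] by (auto simp: m_def)
  then obtain X where X: "\<And>n. J (X n) < m + 1 / real (Suc n)" by metis
  have par: "J x + J y - 2 * J ((1/2) *\<^sub>R (x + y)) = (norm (x - y))\<^sup>2 / 2" for x y
  proof -
    have n1: "(norm (x - y))\<^sup>2 = (norm x)\<^sup>2 + (norm y)\<^sup>2 - 2 * Re (cinner x y)"
    proof -
      have "cinner x (- y) = - cinner x y"
        by (metis add.right_inverse add_eq_0_iff cinner_add_right cinner_commute cinner_zero_left complex_cnj_zero)
      then show ?thesis using norm_add_sq[of x "- y"] by simp
    qed
    have n2: "(norm ((1/2) *\<^sub>R (x + y)))\<^sup>2 = ((norm x)\<^sup>2 + (norm y)\<^sup>2 + 2 * Re (cinner x y)) / 4"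
      by (simp add: power_divide norm_add_sq power2_eq_square[of "2::real"])
    have "f ((1/2) *\<^sub>R (x + y)) = (1/2) *\<^sub>R (f x + f y)"
      using bounded_linear.linear[OF lin] by (simp add: linear_scale add scaleR_right_distrib linear_add)
    then show ?thesis unfolding J_def n1 n2 by (simp add: field_simps)
  qed
  have dist2: "(norm (X i - X j))\<^sup>2 < 2 / real (Suc i) + 2 / real (Suc j)" for i j
    using par[of "X i" "X j"] X[of i] X[of j] m_le[of "(1/2) *\<^sub>R (X i + X j)"]
    by (smt (verit) field_sum_of_halves add_divide_distrib)
  have "Cauchy X"
  proof (rule metric_CauchyI)
    fix e :: real assume e: "0 < e"
    obtain N where N: "4 / e\<^sup>2 < real N" using reals_Archimedean2 by blast
    have "dist (X i) (X j) < e" if "N \<le> i" "N \<le> j" for i j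
    proof -
      have pos: "4 / e\<^sup>2 > 0" using e by simp
      have "2 / real (Suc k) < e\<^sup>2 / 2" if "N \<le> k" for k
      proof -
        have "4 / e\<^sup>2 < real (Suc k)" using N that by linarith
        then have "4 < real (Suc k) * e\<^sup>2" using e by (simp add: field_simps)
        then show ?thesis by (simp add: field_simps)
      qed
      then have "(norm (X i - X j))\<^sup>2 < e\<^sup>2" using dist2[of i j] that by (smt (verit) field_sum_of_halves)
      then show ?thesis unfolding dist_norm using e by (meson power2_less_imp_less less_imp_le)
    qed
    then show "\<exists>M. \<forall>i\<ge>M. \<forall>j\<ge>M. dist (X i) (X j) < e" by blast
  qed
  then obtain z where z: "X \<longlonglongrightarrow> z" by (metis Cauchy_convergent convergent_def)
  have Jz: "J z \<le> m"
  proof (rule LIMSEQ_le)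
    show "(\<lambda>n. J (X n)) \<longlonglongrightarrow> J z"
      unfolding J_def by (intro tendsto_intros z bounded_linear.tendsto[OF lin])
    show "(\<lambda>n. m + 1 / real (Suc n)) \<longlonglongrightarrow> m"
      using tendsto_add[OF tendsto_const LIMSEQ_inverse_real_of_nat, of m] by (simp add: inverse_eq_divide)
    show "\<exists>N. \<forall>n\<ge>N. J (X n) \<le> m + 1 / real (Suc n)" using X less_imp_le by blast
  qed
  have real_part: "Re (f h) = Re (cinner h z)" for h
  proof -
    define d where "d = Re (cinner z h) - Re (f h)"
    have ineq: "0 \<le> t\<^sup>2 * (norm h)\<^sup>2 + 2 * t * d" for t
    proof -
      have a: "(norm (z + t *\<^sub>R h))\<^sup>2 = (norm z)\<^sup>2 + t\<^sup>2 * (norm h)\<^sup>2 + 2 * t * Re (cinner z h)"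
        by (subst norm_add_sq) (simp add: scaleR_scaleC cinner_scaleC_right norm_scaleC power_mult_distrib)
      have b: "Re (f (z + t *\<^sub>R h)) = Re (f z) + t * Re (f h)"
        by (simp add: add scaleR_scaleC hom)
      show ?thesis using Jz m_le[of "z + t *\<^sub>R h"] unfolding J_def a b d_def by (simp add: algebra_simps)
    qed
    have "d = 0"
    proof (rule ccontr)
      assume "d \<noteq> 0"
      define s where "s = (norm h)\<^sup>2 + 1"
      have s: "s > 0" "(norm h)\<^sup>2 < 2 * s" unfolding s_def by (auto simp: add_nonneg_pos)
      have "(- d / s)\<^sup>2 * (norm h)\<^sup>2 + 2 * (- d / s) * d = (d\<^sup>2 / s\<^sup>2) * ((norm h)\<^sup>2 - 2 * s)"
        using s(1) by (simp add: field_simps power2_eq_square)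
      also have "\<dots> < 0" using s \<open>d \<noteq> 0\<close> by (intro mult_pos_neg) auto
      finally show False using ineq[of "- d / s"] by linarith
    qed
    moreover have "Re (cinner h z) = Re (cinner z h)" by (subst cinner_commute) simp
    ultimately show ?thesis unfolding d_def by simp
  qed
  have "f h = cinner h z" for h
  proof (rule complex_eqI[OF real_part])
    show "Im (f h) = Im (cinner h z)"
      using real_part[of "\<i> *\<^sub>C h"] by (simp add: hom cinner_scaleC_left)
  qed
  then show ?thesis by blast
qed

section \<open>Unital C*-algebras\<close>

text \<open>The class does not require \<open>0 \<noteq> 1\<close>, so the zero algebra, and hence the operators on the
  zero Hilbert space, are included.\<close>

class unital_cstar_algebra = complex_normed_vector + real_normed_algebra + monoid_mult + banach +
  fixes star :: "'a \<Rightarrow> 'a"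
  assumes mult_scaleC_left: "(c *\<^sub>C a) * b = c *\<^sub>C (a * b)"
    and mult_scaleC_right: "a * (c *\<^sub>C b) = c *\<^sub>C (a * b)"
    and star_star: "star (star a) = a"
    and star_add: "star (a + b) = star a + star b"
    and star_scaleC: "star (c *\<^sub>C a) = cnj c *\<^sub>C star a"
    and star_mult: "star (a * b) = star b * star a"
    and cstar_identity: "norm (star a * a) = (norm a)\<^sup>2"

section \<open>The C*-algebra of bounded operators on a Hilbert space\<close>

text \<open>The norm is the operator norm, multiplication is composition, and \<open>star\<close> is the
  Hilbert space adjoint.\<close>

typedef (overloaded) 'h bop =
  "{T :: 'h::chilbert_space \<Rightarrow>\<^sub>L 'h. \<forall>c x. blinfun_apply T (c *\<^sub>C x) = c *\<^sub>C blinfun_apply T x}"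
  morphisms blinfun_of_bop Bop
  by (rule exI[of _ 0]) simp

setup_lifting type_definition_bop

abbreviation bop_apply :: "'h::chilbert_space bop \<Rightarrow> 'h \<Rightarrow> 'h" where
  "bop_apply T \<equiv> blinfun_apply (blinfun_of_bop T)"

lemma bop_eqI: "S = T" if "\<And>x. bop_apply S x = bop_apply T x"
  using that by (metis blinfun_eqI blinfun_of_bop_inject)

lemma bop_apply_scaleC: "bop_apply T (c *\<^sub>C x) = c *\<^sub>C bop_apply T x"
  using blinfun_of_bop[of T] by blast

instantiation bop :: (chilbert_space) "{zero, one, plus, minus, uminus, times, scaleR}"
begin

lift_definition zero_bop :: "'a bop" is 0 by simp
lift_definition one_bop :: "'a bop" is id_blinfun by simp
lift_definition plus_bop :: "'a bop \<Rightarrow> 'a bop \<Rightarrow> 'a bop" is "(+)"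
  by (simp add: blinfun.add_left scaleC_add_right)
lift_definition minus_bop :: "'a bop \<Rightarrow> 'a bop \<Rightarrow> 'a bop" is "(-)"
  by (simp add: blinfun.diff_left scaleC_diff_right)
lift_definition uminus_bop :: "'a bop \<Rightarrow> 'a bop" is uminus
  by (simp add: blinfun.minus_left scaleC_minus_right)
lift_definition times_bop :: "'a bop \<Rightarrow> 'a bop \<Rightarrow> 'a bop" is "(o\<^sub>L)" by simp
lift_definition scaleR_bop :: "real \<Rightarrow> 'a bop \<Rightarrow> 'a bop" is scaleR
  by (simp add: blinfun.scaleR_left scaleR_scaleC scaleC_scaleC mult.commute)

instance ..

end

instantiation bop :: (chilbert_space) scaleC
begin

lift_definition scaleC_bop :: "complex \<Rightarrow> 'a bop \<Rightarrow> 'a bop"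
  is "\<lambda>c T. Blinfun (\<lambda>x. c *\<^sub>C blinfun_apply T x)"
  by (subst (1 2) bounded_linear_Blinfun_apply)
    (simp_all add: bounded_linear_compose[OF bounded_linear_scaleC] blinfun.bounded_linear_right
      scaleC_scaleC mult.commute)

lemma bop_apply_simps:
  "bop_apply (S + T) x = bop_apply S x + bop_apply T (x::'a)"
  "bop_apply (S * T) x = bop_apply S (bop_apply T x)"
  "bop_apply (S - T) x = bop_apply S x - bop_apply T x"
  "bop_apply (- T) x = - bop_apply T x"
  "bop_apply (r *\<^sub>R T) x = r *\<^sub>R bop_apply T x"
  "bop_apply (c *\<^sub>C T) x = c *\<^sub>C bop_apply T x"
  "bop_apply 0 x = 0"
  "bop_apply 1 x = x"
  by (simp_all add: plus_bop.rep_eq times_bop.rep_eq minus_bop.rep_eq uminus_bop.rep_eq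
      scaleR_bop.rep_eq scaleC_bop.rep_eq zero_bop.rep_eq one_bop.rep_eq blinfun.bilinear_simps
      bounded_linear_Blinfun_apply bounded_linear_compose[OF bounded_linear_scaleC]
      blinfun.bounded_linear_right)

instance
  by standard (rule bop_eqI, simp add: bop_apply_simps scaleR_scaleC)

end

instantiation bop :: (chilbert_space) "{complex_normed_vector, real_normed_algebra, monoid_mult}"
begin

lift_definition norm_bop :: "'a bop \<Rightarrow> real" is norm .

definition dist_bop :: "'a bop \<Rightarrow> 'a bop \<Rightarrow> real" where "dist_bop S T = norm (S - T)"
definition sgn_bop :: "'a bop \<Rightarrow> 'a bop" where "sgn_bop T = inverse (norm T) *\<^sub>R T"
definition uniformity_bop :: "('a bop \<times> 'a bop) filter" where
  "uniformity_bop = (INF e\<in>{0 <..}. principal {(S, T). dist S T < e})"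
definition open_bop :: "'a bop set \<Rightarrow> bool" where
  "open_bop U = (\<forall>S\<in>U. \<forall>\<^sub>F (S', T) in uniformity. S' = S \<longrightarrow> T \<in> U)"

lemma norm_bop_apply: "norm (bop_apply T x) \<le> norm T * norm (x::'a)"
  by (simp add: norm_bop.rep_eq norm_blinfun)

lemma norm_bop_bound: "0 \<le> b \<Longrightarrow> (\<And>x. norm (bop_apply T x) \<le> b * norm (x::'a)) \<Longrightarrow> norm T \<le> b"
  by (simp add: norm_bop.rep_eq norm_blinfun_bound)

instance
proof
  fix S T U :: "'a bop" and r s :: real and c d :: complex
  show "S + T + U = S + (T + U)" "S + T = T + S" "0 + S = S" "- S + S = 0" "S - T = S + - T"
    by (rule bop_eqI; simp add: bop_apply_simps)+
  show "c *\<^sub>C (S + T) = c *\<^sub>C S + c *\<^sub>C T" "(c + d) *\<^sub>C T = c *\<^sub>C T + d *\<^sub>C T"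
    "c *\<^sub>C d *\<^sub>C T = (c * d) *\<^sub>C T" "1 *\<^sub>C T = T"
    by (rule bop_eqI; simp add: bop_apply_simps scaleC_add_right scaleC_add_left scaleC_scaleC scaleC_one)+
  show "r *\<^sub>R (S + T) = r *\<^sub>R S + r *\<^sub>R T" "(r + s) *\<^sub>R T = r *\<^sub>R T + s *\<^sub>R T"
    "r *\<^sub>R s *\<^sub>R T = (r * s) *\<^sub>R T" "1 *\<^sub>R T = T"
    by (rule bop_eqI; simp add: bop_apply_simps scaleR_add_right scaleR_add_left)+
  show "S * T * U = S * (T * U)" "1 * T = T" "T * 1 = T"
    "(S + T) * U = S * U + T * U" "S * (T + U) = S * T + S * U"
    "r *\<^sub>R S * T = r *\<^sub>R (S * T)" "S * r *\<^sub>R T = r *\<^sub>R (S * T)"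
    by (rule bop_eqI; simp add: bop_apply_simps blinfun.bilinear_simps)+
  show "dist S T = norm (S - T)" "sgn T = T /\<^sub>R norm T"
    by (simp_all add: dist_bop_def sgn_bop_def)
  show "(uniformity :: ('a bop \<times> 'a bop) filter) = (INF e\<in>{0 <..}. principal {(x, y). dist x y < e})"
    by (rule uniformity_bop_def)
  show "open V = (\<forall>x\<in>V. \<forall>\<^sub>F (x', y) in uniformity. x' = x \<longrightarrow> y \<in> V)" for V :: "'a bop set"
    by (rule open_bop_def)
  show "(norm T = 0) = (T = 0)"
    by (transfer) simp
  show "norm (S + T) \<le> norm S + norm T" by transfer (rule norm_triangle_ineq)
  show "norm (r *\<^sub>R T) = \<bar>r\<bar> * norm T" by transfer simp
  show "norm (S * T) \<le> norm S * norm T" by transfer (rule norm_blinfun_compose)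
  show "norm (c *\<^sub>C T) = cmod c * norm T"
  proof -
    have le: "norm (c *\<^sub>C T) \<le> cmod c * norm T" for c and T :: "'a bop"
    proof (rule norm_bop_bound)
      fix x
      have "cmod c * norm (bop_apply T x) \<le> cmod c * (norm T * norm x)"
        by (intro mult_left_mono norm_bop_apply) simp
      then show "norm (bop_apply (c *\<^sub>C T) x) \<le> cmod c * norm T * norm x"
        by (simp add: bop_apply_simps norm_scaleC mult.assoc)
    qed (simp add: norm_bop.rep_eq)
    show ?thesis
    proof (cases "c = 0")
      case True
      then show ?thesis using le[of c T] by (simp add: norm_bop.rep_eq antisym)
    next
      case False
      have "inverse c *\<^sub>C c *\<^sub>C T = T"
        by (rule bop_eqI) (simp add: bop_apply_simps scaleC_scaleC False scaleC_one)
      then have "norm T \<le> inverse (cmod c) * norm (c *\<^sub>C T)"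
        using le[of "inverse c" "c *\<^sub>C T"] by (simp add: norm_inverse)
      then show ?thesis using le[of c T] False by (simp add: field_simps)
    qed
  qed
qed

end

lemma bop_adjoint_exists: "\<exists>S. \<forall>x y. cinner (bop_apply T x) y = cinner x (bop_apply S y)"
proof -
  have "\<exists>z. \<forall>x. cinner (bop_apply T x) y = cinner x z" for y
  proof (rule riesz_representation[where K = "norm T * norm y"])
    show "cmod (cinner (bop_apply T x) y) \<le> norm T * norm y * norm x" for x
    proof -
      have "cmod (cinner (bop_apply T x) y) \<le> norm (bop_apply T x) * norm y" by (rule cinner_Cauchy_Schwarz)
      also have "\<dots> \<le> (norm T * norm x) * norm y" by (intro mult_right_mono norm_bop_apply) simp
      finally show ?thesis by (simp add: ac_simps)
    qed
  qed (simp_all add: blinfun.add_right cinner_add_left bop_apply_scaleC cinner_scaleC_left)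
  then obtain s where s: "\<And>x y. cinner (bop_apply T x) y = cinner x (s y)" by metis
  have s_add: "s (x + y) = s x + s y" for x y
    by (rule cinner_right_eqI) (simp add: s[symmetric] cinner_add_right)
  have s_hom: "s (c *\<^sub>C x) = c *\<^sub>C s x" for c x
    by (rule cinner_right_eqI) (simp add: s[symmetric] cinner_scaleC_right)
  have s_bd: "norm (s y) \<le> norm y * norm T" for y
  proof (cases "s y = 0")
    case False
    have "(norm (s y))\<^sup>2 = cmod (cinner (s y) (s y))" by (simp add: cinner_self norm_power)
    also have "\<dots> = cmod (cinner (bop_apply T (s y)) y)" by (simp add: s)
    also have "\<dots> \<le> norm (bop_apply T (s y)) * norm y" by (rule cinner_Cauchy_Schwarz)
    also have "\<dots> \<le> (norm T * norm (s y)) * norm y" by (intro mult_right_mono norm_bop_apply) simp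
    finally show ?thesis using False by (simp add: power2_eq_square mult.commute)
  qed simp
  have "bounded_linear s"
    by (rule bounded_linear_intro[where K = "norm T"]) (simp_all add: s_add scaleR_scaleC s_hom s_bd)
  then have "bop_apply (Bop (Blinfun s)) = s"
    using s_hom by (subst Bop_inverse) (simp_all add: bounded_linear_Blinfun_apply)
  then show ?thesis using s by metis
qed

instantiation bop :: (chilbert_space) unital_cstar_algebra
begin

definition star_bop :: "'a bop \<Rightarrow> 'a bop" where
  "star_bop T = (THE S. \<forall>x y. cinner (bop_apply T x) y = cinner x (bop_apply S y))"

lemma star_bop: "cinner (bop_apply T x) y = cinner (x::'a) (bop_apply (star T) y)"
proof -
  have "\<exists>!S. \<forall>x y. cinner (bop_apply T x) y = cinner x (bop_apply S y)"
  proof (rule ex_ex1I[OF bop_adjoint_exists])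
    fix S U
    assume "\<forall>x y. cinner (bop_apply T x) y = cinner x (bop_apply S y)"
      and "\<forall>x y. cinner (bop_apply T x) y = cinner x (bop_apply U y)"
    then show "S = U" by (metis bop_eqI cinner_right_eqI)
  qed
  from theI'[OF this] show ?thesis unfolding star_bop_def by blast
qed

lemma star_bop_right: "cinner x (bop_apply T y) = cinner (bop_apply (star T) x) (y::'a)"
  by (metis cinner_commute star_bop)

lemma star_bop_eqI: "star T = S"
  if "\<And>x y. cinner (bop_apply T x) y = cinner (x::'a) (bop_apply S y)"
  by (rule bop_eqI, rule cinner_right_eqI) (simp add: star_bop[symmetric] that)

instance
proof
  fix S T :: "'a bop" and c :: complex
  show "c *\<^sub>C S * T = c *\<^sub>C (S * T)" "S * c *\<^sub>C T = c *\<^sub>C (S * T)"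
    by (rule bop_eqI; simp add: bop_apply_simps bop_apply_scaleC)+
  show ss: "star (star T) = T" for T :: "'a bop"
    by (rule star_bop_eqI) (simp add: star_bop_right)
  show "star (S + T) = star S + star T"
    by (rule star_bop_eqI) (simp add: bop_apply_simps cinner_add_left cinner_add_right star_bop)
  show "star (c *\<^sub>C T) = cnj c *\<^sub>C star T"
    by (rule star_bop_eqI) (simp add: bop_apply_simps cinner_scaleC_left cinner_scaleC_right star_bop)
  show "star (S * T) = star T * star S"
    by (rule star_bop_eqI) (simp add: bop_apply_simps star_bop)
  have sq: "(norm T)\<^sup>2 \<le> norm (star T * T)" for T :: "'a bop"
  proof -
    have "norm T \<le> sqrt (norm (star T * T))"
    proof (rule norm_bop_bound)
      fix x
      have "(norm (bop_apply T x))\<^sup>2 = cmod (cinner (bop_apply T x) (bop_apply T x))"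
        by (simp add: cinner_self norm_power)
      also have "\<dots> = cmod (cinner x (bop_apply (star T * T) x))"
        by (simp add: star_bop bop_apply_simps)
      also have "\<dots> \<le> norm x * norm (bop_apply (star T * T) x)" by (rule cinner_Cauchy_Schwarz)
      also have "\<dots> \<le> norm x * (norm (star T * T) * norm x)"
        by (intro mult_left_mono norm_bop_apply) simp
      finally have "(norm (bop_apply T x))\<^sup>2 \<le> (sqrt (norm (star T * T)) * norm x)\<^sup>2"
        by (simp add: power_mult_distrib power2_eq_square ac_simps)
      then show "norm (bop_apply T x) \<le> sqrt (norm (star T * T)) * norm x"
        by (rule power2_le_imp_le) simp
    qed simp
    then show ?thesis using power_mono[of "norm T" _ 2] by fastforce
  qed
  have le: "norm T \<le> norm (star T)" for T :: "'a bop"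
  proof (cases "T = 0")
    case False
    have "norm T * norm T \<le> norm (star T) * norm T"
      using sq[of T] norm_mult_ineq[of "star T" T] by (simp add: power2_eq_square)
    then show ?thesis using False by simp
  qed simp
  have "norm (star T) = norm T" using le[of T] le[of "star T"] by (simp add: ss)
  then show "norm (star T * T) = (norm T)\<^sup>2"
    using sq[of T] norm_mult_ineq[of "star T" T] by (simp add: power2_eq_square)
next
  fix X :: "nat \<Rightarrow> 'a bop"
  assume "Cauchy X"
  have d: "dist S T = dist (blinfun_of_bop S) (blinfun_of_bop T)" for S T :: "'a bop"
    by (simp add: dist_norm norm_bop.rep_eq minus_bop.rep_eq)
  have "Cauchy (\<lambda>n. blinfun_of_bop (X n))" using \<open>Cauchy X\<close> by (simp add: Cauchy_def d)
  then obtain L where L: "(\<lambda>n. blinfun_of_bop (X n)) \<longlonglongrightarrow> L"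
    by (metis Cauchy_convergent convergent_def)
  have "blinfun_apply L (c *\<^sub>C x) = c *\<^sub>C blinfun_apply L x" for c x
  proof (rule LIMSEQ_unique)
    have pt: "(\<lambda>n. bop_apply (X n) y) \<longlonglongrightarrow> blinfun_apply L y" for y
      by (intro tendsto_intros L)
    show "(\<lambda>n. bop_apply (X n) (c *\<^sub>C x)) \<longlonglongrightarrow> blinfun_apply L (c *\<^sub>C x)" by (rule pt)
    show "(\<lambda>n. bop_apply (X n) (c *\<^sub>C x)) \<longlonglongrightarrow> c *\<^sub>C blinfun_apply L x"
      unfolding bop_apply_scaleC by (rule bounded_linear.tendsto[OF bounded_linear_scaleC pt])
  qed
  then have "blinfun_of_bop (Bop L) = L" by (simp add: Bop_inverse)
  then have "X \<longlonglongrightarrow> Bop L" using L by (simp add: lim_sequentially d)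
  then show "convergent X" by (auto simp: convergent_def)
qed

end

section \<open>Positive matrices over a C*-algebra\<close>

text \<open>An element of the C*-algebra of matrices is positive if it is self-adjoint with nonnegative
  spectrum.  Both conditions involve only the unital *-algebra structure of the matrix algebra, so
  its C*-norm is not needed here.  Invertibility is spelled out because \<^const>\<open>invertible_mat\<close>
  requires \<open>0 \<noteq> 1\<close> in the entries, which fails for operators on the zero space.\<close>

definition mat_star :: "'a::unital_cstar_algebra mat \<Rightarrow> 'a mat" where
  "mat_star X = mat (dim_col X) (dim_row X) (\<lambda>(i, j). star (X $$ (j, i)))"

definition mat_spectrum :: "nat \<Rightarrow> 'a::unital_cstar_algebra mat \<Rightarrow> complex set" where
  "mat_spectrum n X = {l. \<not> (\<exists>Y \<in> carrier_mat n n.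
     (X - (l *\<^sub>C 1) \<cdot>\<^sub>m 1\<^sub>m n) * Y = 1\<^sub>m n \<and> Y * (X - (l *\<^sub>C 1) \<cdot>\<^sub>m 1\<^sub>m n) = 1\<^sub>m n)}"

definition mat_pos :: "nat \<Rightarrow> 'a::unital_cstar_algebra mat set" where
  "mat_pos n = {X \<in> carrier_mat n n. mat_star X = X \<and> mat_spectrum n X \<subseteq> complex_of_real ` {0..}}"

section \<open>Completely positive maps and finite decomposability\<close>

definition bounded_star_map :: "('a::unital_cstar_algebra \<Rightarrow> 'b::unital_cstar_algebra) \<Rightarrow> bool" where
  "bounded_star_map f \<longleftrightarrow> bounded_clinear f \<and> (\<forall>a. f (star a) = star (f a))"

definition completely_positive :: "('a::unital_cstar_algebra \<Rightarrow> 'h::chilbert_space bop) \<Rightarrow> bool" where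
  "completely_positive \<psi> \<longleftrightarrow>
     bounded_star_map \<psi> \<and> (\<forall>n. \<forall>X \<in> mat_pos n. map_mat \<psi> X \<in> mat_pos n)"

text \<open>A tuple of \<open>m\<close> maps is represented by a function on indices, of which only the values at
  \<open>1, \<dots>, m\<close> matter.\<close>

definition finitely_decomposable ::
  "nat \<Rightarrow> (nat \<Rightarrow> 'a \<Rightarrow> 'a) \<Rightarrow> ('a::unital_cstar_algebra \<Rightarrow> 'h::chilbert_space bop) \<Rightarrow> bool" where
  "finitely_decomposable m \<phi> \<theta> \<longleftrightarrow>
     (\<exists>\<psi>. (\<forall>k \<in> {1..m}. completely_positive (\<psi> k)) \<and> \<theta> = (\<lambda>a. \<Sum>k = 1..m. \<psi> k (\<phi> k a)))"

definition Gamma_pos :: "nat \<Rightarrow> nat \<Rightarrow> (nat \<Rightarrow> 'a \<Rightarrow> 'a) \<Rightarrow> 'a::unital_cstar_algebra mat set" where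
  "Gamma_pos n m \<phi> = {X \<in> carrier_mat n n. \<forall>k \<in> {1..m}. map_mat (\<phi> k) X \<in> mat_pos n}"

end

theory Submission
  imports Defs "HOL-Library.Function_Algebras"
begin

text \<open>
A map of the form \<open>\<theta> = \<Sum>\<^sub>k \<psi>\<^sub>k \<circ> \<phi>\<^sub>k\<close> is the composition of \<open>a \<mapsto> (\<phi>\<^sub>1 a, \<dots>, \<phi>\<^sub>m a)\<close> with a completely positive
map on the \<open>m\<close>-fold direct sum of the algebra.  The hypothesis on the cones \<open>\<Gamma>\<^sub>n\<close> says that \<open>\<theta>\<close> factors
through a map on the range of \<open>a \<mapsto> (\<phi>\<^sub>1 a, \<dots>, \<phi>\<^sub>m a)\<close> that is completely positive there.  As the \<open>\<phi>\<^sub>k\<close> are unital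
*-maps, this range is an operator system, and the theorem amounts to Arveson's extension theorem for it.

The extension is obtained from a single scalar functional.  A linear map \<open>\<Psi>\<close> into the operators on
\<open>H\<close> gives a functional on finite matrices \<open>X\<close> whose rows and columns are indexed by vectors of
\<open>H\<close>, namely \<open>X \<mapsto> \<Sum>\<^bsub>b,c\<^esub> \<langle>\<Psi> (X b c) c, b\<rangle>\<close>, and \<open>\<Psi>\<close> is completely positive if and only if this
functional is nonnegative on positive matrices.  For \<open>\<theta>\<close> it is defined on a
subspace (\<open>functional_graph\<close>), nonnegative on the positive matrices there (\<open>functional_graph_nonneg\<close>),
and the subspace is cofinal for the order (\<open>functional_graph_cofinal\<close>), so \<open>riesz_extension\<close> extends it
to all finite matrices.  Evaluating the extension on rank-one matrices in the \<open>k\<close>-th summand gives a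
bounded sesquilinear form for every \<open>a\<close>, hence the operator \<open>\<psi>\<^sub>k a\<close> (\<open>decomposable_if_positive\<close>).

All this needs positivity of matrices to be stable under sums and under congruence by rectangular
matrices, whereas positivity is defined by the spectrum.  The link is \<open>mat_pos_iff\<close>: a
matrix \<open>X\<close> is positive if and only if it is Hermitian and \<open>\<Sum>\<^bsub>i,j\<^esub> v\<^sub>i* X\<^bsub>ij\<^esub> v\<^sub>j\<close> is positive for all tuples
\<open>v\<close> in the algebra.  One direction inverts strictly positive matrices by Schur complements
(\<open>strictly_positive_surj\<close>); for the other one adds to \<open>X\<close> the least multiple of the unit that makes the
form positive and shows that this multiple is zero (\<open>pos_form_of_left_inverses\<close>).  Forms of this kind
rest on the cone \<open>cpos\<close> of the algebra itself, for which the same comparison with the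
spectrum (\<open>cpos_of_invertible\<close>) and the theorem of Kelley and Vaught that \<open>b* b\<close> is
positive (\<open>cpos_star_mult\<close>) are proved by means of square roots alone, without a functional calculus.
\<close>

section \<open>Invertible elements and square roots in a unital C*-algebra\<close>

lemma scaleC_zero_left [simp]: "0 *\<^sub>C (a::'a::complex_vector) = 0"
  by (metis of_real_0 scaleR_scaleC scaleR_zero_left)

lemma scaleC_minus_left: "(- c) *\<^sub>C (a::'a::complex_vector) = - (c *\<^sub>C a)"
  by (metis add.right_inverse add_eq_0_iff scaleC_add_left scaleC_zero_left)

lemma scaleC_diff_left: "(c - d) *\<^sub>C (a::'a::complex_vector) = c *\<^sub>C a - d *\<^sub>C a"
  by (metis diff_conv_add_uminus scaleC_add_left scaleC_minus_left)

lemma star_zero [simp]: "star (0::'a::unital_cstar_algebra) = 0"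
  by (metis add_cancel_right_right star_add)

lemma star_one [simp]: "star (1::'a::unital_cstar_algebra) = 1"
  by (metis mult_1_left mult_1_right star_mult star_star)

lemma star_minus: "star (- a) = - star (a::'a::unital_cstar_algebra)"
  by (metis add.right_inverse add_eq_0_iff star_add star_zero)

lemma star_diff: "star (a - b) = star a - star (b::'a::unital_cstar_algebra)"
  by (metis diff_conv_add_uminus star_add star_minus)

lemma star_scaleR: "star (r *\<^sub>R a) = r *\<^sub>R star (a::'a::unital_cstar_algebra)"
  by (simp add: scaleR_scaleC star_scaleC)

lemma star_sum: "star (sum f I) = (\<Sum>i\<in>I. star (f i :: 'a::unital_cstar_algebra))"
  by (induction I rule: infinite_finite_induct) (simp_all add: star_add)

lemmas star_simps = star_star star_add star_diff star_minus star_scaleR star_mult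

lemma norm_star [simp]: "norm (star a) = norm (a::'a::unital_cstar_algebra)"
proof -
  have le: "norm a \<le> norm (star a)" for a :: 'a
  proof (cases "a = 0")
    case False
    have "norm a * norm a \<le> norm (star a) * norm a"
      using norm_mult_ineq[of "star a" a] by (simp add: cstar_identity power2_eq_square)
    then show ?thesis using False by simp
  qed simp
  show ?thesis using le[of a] le[of "star a"] by (simp add: star_star)
qed

lemma bounded_linear_star: "bounded_linear (star :: 'a::unital_cstar_algebra \<Rightarrow> 'a)"
  by (rule bounded_linear_intro[where K = 1]) (simp_all add: star_add star_scaleR)

lemma continuous_on_star [continuous_intros]:
  "continuous_on S f \<Longrightarrow> continuous_on S (\<lambda>x. star (f x :: 'a::unital_cstar_algebra))"
  by (rule bounded_linear.continuous_on[OF bounded_linear_star])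

lemma norm_one_le: "norm (1::'a::unital_cstar_algebra) \<le> 1"
proof -
  have "norm (1::'a) * norm (1::'a) = norm (1::'a)"
    using cstar_identity[of "1::'a"] by (simp add: power2_eq_square)
  then show ?thesis by (metis le_numeral_extra(4) mult_cancel_right2 norm_eq_zero order.refl zero_le_one norm_zero)
qed

lemma norm_scaleR_one_le: "norm (r *\<^sub>R (1::'a::unital_cstar_algebra)) \<le> \<bar>r\<bar>"
  using mult_left_mono[OF norm_one_le[where 'a='a], of "\<bar>r\<bar>"] by simp

definition invertible_elem :: "'a::unital_cstar_algebra \<Rightarrow> bool" where
  "invertible_elem a \<longleftrightarrow> (\<exists>b. a * b = 1 \<and> b * a = 1)"

lemma invertible_elemI2: "a * b = 1 \<Longrightarrow> c * a = 1 \<Longrightarrow> invertible_elem a"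
  unfolding invertible_elem_def by (metis mult.assoc mult_1_left mult_1_right)

lemma invertible_elem_commuting_factor:
  assumes "invertible_elem (x * y)" and "x * y = y * x"
  shows "invertible_elem x"
proof -
  obtain b where "x * y * b = 1" "b * (x * y) = 1"
    using assms(1) by (auto simp: invertible_elem_def)
  moreover have "b * y * x = b * (x * y)" using assms(2) by (simp add: mult.assoc)
  ultimately show ?thesis
    by (intro invertible_elemI2[of x "y * b" "b * y"]) (simp_all only: mult.assoc)
qed

lemma invertible_elem_scaleR:
  assumes "r \<noteq> 0" shows "invertible_elem (r *\<^sub>R a) \<longleftrightarrow> invertible_elem a"
proof -
  have imp: "invertible_elem (r *\<^sub>R a)" if r: "r \<noteq> 0" and a: "invertible_elem a" for r a
  proof -
    obtain b where "a * b = 1" "b * a = 1" using a by (auto simp: invertible_elem_def)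
    then show ?thesis using r by (intro invertible_elemI2[of _ "inverse r *\<^sub>R b" "inverse r *\<^sub>R b"]) simp_all
  qed
  show ?thesis using imp[of r a] imp[of "inverse r" "r *\<^sub>R a"] assms by auto
qed

text \<open>The inverse of \<open>1 - x\<close> is the fixed point of the contraction \<open>y \<mapsto> 1 + x y\<close>.\<close>

lemma invertible_one_minus:
  assumes "norm (x::'a::unital_cstar_algebra) < 1"
  shows "invertible_elem (1 - x)"
proof -
  have "\<exists>!y. 1 + x * y = y"
  proof (rule banach_fix_type[of "norm x"])
    show "\<forall>y z. dist (1 + x * y) (1 + x * z) \<le> norm x * dist y z"
      by (simp add: dist_norm right_diff_distrib[symmetric] norm_mult_ineq)
  qed (use assms in auto)
  moreover have "\<exists>!y. 1 + y * x = y"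
  proof (rule banach_fix_type[of "norm x"])
    show "\<forall>y z. dist (1 + y * x) (1 + z * x) \<le> norm x * dist y z"
      by (simp add: dist_norm left_diff_distrib[symmetric] mult.commute[of "norm x"] norm_mult_ineq)
  qed (use assms in auto)
  ultimately obtain y z where "1 + x * y = y" "1 + z * x = z" by blast
  then have "(1 - x) * y = 1" "z * (1 - x) = 1"
    by (simp_all add: left_diff_distrib right_diff_distrib diff_eq_eq)
  then show ?thesis by (rule invertible_elemI2)
qed

lemma invertible_elem_near:
  assumes "norm (r *\<^sub>R 1 - a) < r"
  shows "invertible_elem (a::'a::unital_cstar_algebra)"
proof -
  have r: "r > 0" using assms by (smt (verit) norm_ge_zero)
  have "1 - (1 / r) *\<^sub>R (r *\<^sub>R 1 - a) = (1 / r) *\<^sub>R a"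
    using r by (simp add: scaleR_diff_right)
  moreover have "norm ((1 / r) *\<^sub>R (r *\<^sub>R 1 - a)) < 1"
    using r assms by (simp del: scaleR_diff_right)
  ultimately have "invertible_elem ((1 / r) *\<^sub>R a)" by (metis invertible_one_minus)
  then show ?thesis using r by (simp add: invertible_elem_scaleR)
qed

text \<open>The equation \<open>(1 - c)\<^sup>2 = 1 - x\<close> says that \<open>c = (x + c\<^sup>2) / 2\<close>.  For \<open>\<parallel>x\<parallel> < 1\<close> the right
  hand side is a contraction of the ball of radius \<open>\<parallel>x\<parallel>\<close>, and it maps the closed set of self-adjoint
  elements that commute with the commutant of \<open>x\<close> into itself.\<close>

lemma sqrt_one_minus:
  fixes x :: "'a::unital_cstar_algebra"
  assumes sa: "star x = x" and r: "norm x < 1"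
  obtains c where "star c = c" "norm c < 1" "(1 - c) * (1 - c) = 1 - x"
    "\<And>y. x * y = y * x \<Longrightarrow> c * y = y * c"
proof -
  let ?r = "norm x"
  define S where "S = cball 0 ?r \<inter> {c. star c = c} \<inter> (\<Inter>y\<in>{y. x * y = y * x}. {c. c * y = y * c})"
  define f where "f c = (1/2) *\<^sub>R (x + c * c)" for c
  have closed: "closed S"
    unfolding S_def
    by (intro closed_Int closed_INT ballI closed_cball closed_Collect_eq continuous_intros)
  have S0: "0 \<in> S" by (simp add: S_def)
  have S: "norm c \<le> ?r" "star c = c" "x * y = y * x \<Longrightarrow> c * y = y * c" if "c \<in> S" for c y
    using that unfolding S_def Int_iff INT_iff mem_Collect_eq mem_cball_0 by blast+
  have fS: "f ` S \<subseteq> S"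
  proof
    fix d assume "d \<in> f ` S"
    then obtain c where c: "c \<in> S" and d: "d = f c" by blast
    note nc = S(1)[OF c]
    have "norm (x + c * c) \<le> ?r + ?r * ?r"
      using mult_mono[OF nc nc] norm_mult_ineq[of c c] norm_triangle_ineq[of x "c * c"] by auto
    also have "\<dots> \<le> 2 * ?r" using r mult_left_le[of ?r ?r] by simp
    finally have "norm (f c) \<le> ?r" by (simp add: f_def)
    moreover have "f c * y = y * f c" if "x * y = y * x" for y
    proof -
      have "c * y = y * c" using S(3)[OF c that] .
      then have "c * c * y = y * (c * c)" by (metis mult.assoc)
      then show ?thesis using that by (simp add: f_def distrib_left distrib_right)
    qed
    moreover have "star (f c) = f c" using S(2)[OF c] sa by (simp add: f_def star_simps)
    ultimately show "d \<in> S" unfolding S_def Int_iff INT_iff mem_Collect_eq mem_cball_0 d by blast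
  qed
  have "dist (f c) (f d) \<le> ?r * dist c d" if cd: "c \<in> S" "d \<in> S" for c d
  proof -
    have "c * c - d * d = c * (c - d) + (c - d) * d" by (simp add: algebra_simps)
    then have "norm (c * c - d * d) \<le> norm (c * (c - d)) + norm ((c - d) * d)"
      by (simp only: norm_triangle_ineq)
    also have "\<dots> \<le> norm c * norm (c - d) + norm (c - d) * norm d"
      by (intro add_mono norm_mult_ineq)
    also have "\<dots> \<le> ?r * norm (c - d) + norm (c - d) * ?r"
      by (intro add_mono mult_right_mono mult_left_mono S cd) auto
    finally have "norm (c * c - d * d) \<le> 2 * (?r * norm (c - d))" by simp
    moreover have "f c - f d = (1/2) *\<^sub>R (c * c - d * d)"
      by (simp add: f_def algebra_simps)
    ultimately show ?thesis by (simp add: dist_norm)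
  qed
  then have "\<exists>!c\<in>S. f c = c"
    using r closed S0 fS by (intro Banach_fix[of S ?r f]) (auto simp: complete_eq_closed)
  then obtain c where c: "c \<in> S" "f c = c" by blast
  have "2 *\<^sub>R f c = x + c * c" by (simp add: f_def)
  then have "2 *\<^sub>R c = x + c * c" by (simp add: c(2))
  then have cc: "(1 - c) * (1 - c) = 1 - x"
    by (simp add: algebra_simps scaleR_2)
  have "norm c < 1" using S(1)[OF c(1)] r by linarith
  from that[OF S(2)[OF c(1)] this cc S(3)[OF c(1)]] show ?thesis .
qed

section \<open>The positive cone of a C*-algebra\<close>

text \<open>The norm of a self-adjoint element is its spectral radius, so \<open>\<parallel>t - a\<parallel> \<le> t\<close> says that the
  spectrum of \<open>a\<close> lies in \<open>[0, 2 t]\<close>.  In contrast to the spectrum, the norm controls sums at once.\<close>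

definition cpos :: "'a::unital_cstar_algebra \<Rightarrow> bool" where
  "cpos a \<longleftrightarrow> star a = a \<and> (\<exists>t\<ge>0. norm (t *\<^sub>R 1 - a) \<le> t)"

lemma cposI: "star a = a \<Longrightarrow> norm (t *\<^sub>R 1 - a) \<le> t \<Longrightarrow> cpos a"
  unfolding cpos_def by (metis norm_ge_zero order_trans)

lemma cpos_star: "cpos a \<Longrightarrow> star a = a"
  by (simp add: cpos_def)

lemma cpos_add: 
  assumes "cpos a" "cpos b" shows "cpos (a + b)"
proof -
  obtain s t where "norm (s *\<^sub>R 1 - a) \<le> s" "norm (t *\<^sub>R 1 - b) \<le> t" "star a = a" "star b = b"
    using assms by (auto simp: cpos_def)
  moreover have "(s + t) *\<^sub>R 1 - (a + b) = (s *\<^sub>R 1 - a) + (t *\<^sub>R 1 - b)"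
    by (simp add: algebra_simps)
  ultimately show ?thesis
    by (intro cposI[of _ "s + t"]) (simp_all only: star_add norm_triangle_mono)
qed

lemma cpos_scaleR: 
  assumes "cpos a" "r \<ge> 0" shows "cpos (r *\<^sub>R a)"
proof -
  obtain t where t: "norm (t *\<^sub>R 1 - a) \<le> t" "star a = a"
    using assms by (auto simp: cpos_def)
  have "(r * t) *\<^sub>R 1 - r *\<^sub>R a = r *\<^sub>R (t *\<^sub>R 1 - a)"
    by (simp add: algebra_simps)
  then show ?thesis using t assms(2)
    by (intro cposI[of _ "r * t"]) (auto simp: star_scaleR mult_left_mono)
qed

lemma cpos_scaleR_iff: "r > 0 \<Longrightarrow> cpos (r *\<^sub>R a) \<longleftrightarrow> cpos a"
  using cpos_scaleR[of a r] cpos_scaleR[of "r *\<^sub>R a" "inverse r"] by auto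

lemma cpos_shift_of_norm:
  assumes "star x = x" "norm x \<le> r" shows "cpos (r *\<^sub>R 1 - x)"
  using assms by (intro cposI[of _ r]) (auto simp: star_simps)

lemma cpos_norm_plus: "star a = a \<Longrightarrow> norm a \<le> r \<Longrightarrow> cpos (r *\<^sub>R 1 + a)"
  using cpos_shift_of_norm[of "- a" r] by (simp add: star_minus)

lemma cpos_const: "r \<ge> 0 \<Longrightarrow> cpos (r *\<^sub>R (1::'a::unital_cstar_algebra))"
  using cpos_shift_of_norm[of "0::'a" r] by simp

lemma cpos_zero [simp]: "cpos 0"
  using cpos_const[of 0] by simp

lemma cpos_sum: "(\<And>i. i \<in> I \<Longrightarrow> cpos (f i)) \<Longrightarrow> cpos (sum f I)"
  by (induction I rule: infinite_finite_induct) (simp_all add: cpos_add)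

lemma cpos_add_const: "cpos a \<Longrightarrow> r \<ge> 0 \<Longrightarrow> cpos (a + r *\<^sub>R 1)"
  by (intro cpos_add cpos_const)

lemma invertible_elem_cpos_plus:
  assumes "cpos a" "e > 0" shows "invertible_elem (a + e *\<^sub>R 1)"
proof -
  obtain t where "norm (t *\<^sub>R 1 - a) \<le> t" using assms by (auto simp: cpos_def)
  then have "norm ((t + e) *\<^sub>R 1 - (a + e *\<^sub>R 1)) < t + e"
    using assms(2) by (simp add: algebra_simps)
  then show ?thesis by (rule invertible_elem_near)
qed

text \<open>If \<open>\<parallel>a\<parallel> < 1\<close>, then \<open>u = a + i \<surd>(1 - a\<^sup>2)\<close> is unitary, so \<open>\<surd>(1 - a\<^sup>2)\<close>, the imaginary part of
  \<open>u\<close>, has norm at most one.\<close>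

lemma norm_const_minus_square:
  fixes c :: "'a::unital_cstar_algebra"
  assumes sa: "star c = c" and r: "(norm c)\<^sup>2 < r"
  shows "norm (r *\<^sub>R 1 - c * c) \<le> r"
proof -
  have r0: "r > 0" using r by (smt (verit) zero_le_power2)
  define a where "a = (1 / sqrt r) *\<^sub>R c"
  have aa: "a * a = (1 / r) *\<^sub>R (c * c)" using r0 by (simp add: a_def)
  have saa: "star a = a" using sa by (simp add: a_def star_scaleR)
  have "norm (a * a) = (norm c)\<^sup>2 / r" using r0 sa cstar_identity[of c] by (simp add: aa)
  then have naa: "norm (a * a) < 1" using r r0 by simp
  have saaa: "star (a * a) = a * a" by (simp add: star_mult saa)
  obtain d' where d': "star d' = d'" "norm d' < 1" "(1 - d') * (1 - d') = 1 - a * a"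
      "\<And>y. a * a * y = y * (a * a) \<Longrightarrow> d' * y = y * d'"
    by (rule sqrt_one_minus[OF saaa naa]) (rule that)
  have d'a: "d' * a = a * d'" by (rule d'(4)) (simp add: mult.assoc)
  define d where "d = 1 - d'"
  have d: "star d = d" "d * d = 1 - a * a" "d * a = a * d"
    unfolding d_def by (simp add: star_diff d'(1), rule d'(3), simp add: left_diff_distrib right_diff_distrib d'a)
  define u where "u = a + \<i> *\<^sub>C d"
  have su: "star u = a - \<i> *\<^sub>C d"
    by (simp add: u_def star_add saa star_scaleC d scaleC_minus_left)
  have "star u * u = a * a - (\<i> * \<i>) *\<^sub>C (d * d)"
    unfolding su by (simp add: u_def left_diff_distrib distrib_left mult_scaleC_left mult_scaleC_right
        scaleC_scaleC d(3) scaleC_diff_right scaleC_add_right)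
  also have "\<dots> = a * a + d * d"
    by (simp add: scaleC_minus_left scaleC_one)
  finally have "star u * u = 1" using d(2) by simp
  then have "(norm u)\<^sup>2 \<le> 1" using cstar_identity[of u] norm_one_le[where 'a='a] by simp
  then have nu: "norm u \<le> 1" using power2_le_imp_le[of "norm u" 1] by simp
  have "u - star u = (2 * \<i>) *\<^sub>C d"
    unfolding su by (simp add: u_def scaleC_add_left[symmetric])
  then have "2 * norm d = norm (u - star u)" by (simp add: norm_scaleC norm_mult)
  also have "\<dots> \<le> 2" using norm_triangle_ineq4[of u "star u"] nu by simp
  finally have "norm d \<le> 1" by simp
  then have "norm (d * d) \<le> 1" using cstar_identity[of d] d(1) by (simp add: power_le_one)
  then have "norm (r *\<^sub>R (1 - a * a)) \<le> r" using r0 by (simp add: d(2))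
  moreover have "r *\<^sub>R (1 - a * a) = r *\<^sub>R 1 - c * c" using r0 by (simp add: aa scaleR_diff_right)
  ultimately show ?thesis by simp
qed

lemma cpos_square: "star c = c \<Longrightarrow> cpos (c * c)"
  using norm_const_minus_square[of c "(norm c)\<^sup>2 + 1"]
  by (intro cposI[of _ "(norm c)\<^sup>2 + 1"]) (auto simp: star_mult)

lemma cpos_sqrt:
  fixes a :: "'a::unital_cstar_algebra"
  assumes a: "cpos a" and e: "e > 0"
  obtains c where "star c = c" "c * c = a + e *\<^sub>R 1" "cpos c"
    "\<And>y. a * y = y * a \<Longrightarrow> c * y = y * c"
proof -
  obtain t where t: "norm (t *\<^sub>R 1 - a) \<le> t" "t \<ge> 0" and sa: "star a = a" using a by (auto simp: cpos_def)
  define x where "x = (1 / (t + e)) *\<^sub>R (t *\<^sub>R 1 - a)"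
  have te: "t + e > 0" using t e by simp
  have nx: "norm x < 1" using t e te by (simp add: x_def)
  have sx: "star x = x" by (simp add: x_def star_simps sa)
  obtain d where d: "star d = d" "norm d < 1" "(1 - d) * (1 - d) = 1 - x"
      "\<And>y. x * y = y * x \<Longrightarrow> d * y = y * d" 
    by (rule sqrt_one_minus[OF sx nx]) (rule that)
  define c where "c = sqrt (t + e) *\<^sub>R (1 - d)"
  have "(t + e) *\<^sub>R x = t *\<^sub>R 1 - a" using te by (simp add: x_def del: scaleR_diff_right)
  then have "(t + e) *\<^sub>R (1 - x) = a + e *\<^sub>R 1" by (simp add: scaleR_diff_right scaleR_add_left)
  moreover have "c * c = (t + e) *\<^sub>R (1 - x)" using te by (simp add: c_def d(3))
  ultimately have cc: "c * c = a + e *\<^sub>R 1" by simp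
  have "cpos c"
    using cpos_shift_of_norm[of d 1] d(1,2) te by (simp add: c_def cpos_scaleR)
  moreover have "c * y = y * c" if "a * y = y * a" for y
  proof -
    have "x * y = y * x" using that by (simp add: x_def left_diff_distrib right_diff_distrib)
    from d(4)[OF this] show ?thesis by (simp add: c_def left_diff_distrib right_diff_distrib)
  qed
  ultimately show ?thesis using that[of c] cc cpos_star[of c] by blast
qed

text \<open>The constant \<open>t\<close> in the definition of the cone can be taken to be any upper bound of the norm:
  approximate \<open>a\<close> by squares.  With a fixed constant the cone is visibly closed.\<close>

lemma cpos_norm_le:
  fixes a :: "'a::unital_cstar_algebra"
  assumes a: "cpos a" and r: "norm a \<le> r"
  shows "norm (r *\<^sub>R 1 - a) \<le> r"
proof (rule field_le_epsilon)
  fix e :: real assume e: "e > 0"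
  then have "e/4 > 0" by simp
  then obtain c where c: "star c = c" "c * c = a + (e/4) *\<^sub>R 1" by (rule cpos_sqrt[OF a]) (rule that)
  have n1: "norm ((e/4) *\<^sub>R (1::'a)) \<le> e/4" using norm_scaleR_one_le[of "e/4", where 'a='a] e by simp
  have "norm (c * c) \<le> norm a + norm ((e/4) *\<^sub>R (1::'a))" unfolding c(2) by (rule norm_triangle_ineq)
  then have "norm (c * c) \<le> r + e/4" using n1 r by linarith
  then have "(norm c)\<^sup>2 < r + e/2" using e cstar_identity[of c] c(1) by simp
  then have "norm ((r + e/2) *\<^sub>R 1 - c * c) \<le> r + e/2" by (rule norm_const_minus_square[OF c(1)])
  moreover have eq: "r *\<^sub>R 1 - a = ((r + e/2) *\<^sub>R 1 - c * c) - (e/4) *\<^sub>R 1"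
  proof -
    have "(e/2) *\<^sub>R (1::'a) = (e/4) *\<^sub>R 1 + (e/4) *\<^sub>R 1" by (simp add: scaleR_add_left[symmetric])
    then show ?thesis by (simp add: c(2) algebra_simps)
  qed
  ultimately show "norm (r *\<^sub>R 1 - a) \<le> r + e"
    using norm_triangle_ineq4[of "(r + e/2) *\<^sub>R 1 - c * c" "(e/4) *\<^sub>R 1"] n1 e
    unfolding eq by linarith
qed

lemma closed_cpos: "closed {a::'a::unital_cstar_algebra. cpos a}"
proof -
  have "cpos a \<longleftrightarrow> star a = a \<and> norm (norm a *\<^sub>R 1 - a) \<le> norm a" for a :: 'a
    using cpos_norm_le[of a "norm a"] cposI[of a "norm a"] cpos_star by blast
  then have "{a::'a. cpos a} = {a. star a = a} \<inter> {a. norm (norm a *\<^sub>R 1 - a) \<le> norm a}" by auto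
  also have "closed \<dots>"
    by (intro closed_Int closed_Collect_eq closed_Collect_le continuous_intros)
  finally show ?thesis .
qed

lemma cpos_limit:
  assumes "\<And>e. e > 0 \<Longrightarrow> cpos (a + e *\<^sub>R (b::'a::unital_cstar_algebra))"
  shows "cpos a"
proof -
  have "(\<lambda>n. a + inverse (real (Suc n)) *\<^sub>R b) \<longlonglongrightarrow> a + 0 *\<^sub>R b"
    by (intro tendsto_intros LIMSEQ_inverse_real_of_nat)
  then have "a + 0 *\<^sub>R b \<in> {a. cpos a}"
    by (rule closed_sequentially[OF closed_cpos, rotated]) (simp add: assms)
  then show ?thesis by simp
qed

text \<open>Two squares give the lower bound: \<open>2 t z - z\<^sup>2 = t\<^sup>2 - (t - z)\<^sup>2\<close> is positive if \<open>\<parallel>t - z\<parallel> \<le> t\<close>, and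
  \<open>z\<^sup>2 - e\<close> is the square of \<open>z \<surd>(1 - e z\<^sup>-\<^sup>2)\<close> for small \<open>e\<close>.  Hence \<open>2 t z\<close> exceeds \<open>e\<close>.\<close>

lemma cpos_invertible_diff:
  fixes z :: "'a::unital_cstar_algebra"
  assumes z: "cpos z" and inv: "invertible_elem z"
  obtains e where "e > 0" "cpos (z - e *\<^sub>R 1)"
proof -
  have sz: "star z = z" using z by (rule cpos_star)
  define t where "t = norm z + 1"
  have t: "norm (t *\<^sub>R 1 - z) \<le> t" "t > 0"
    using cpos_norm_le[OF z, of t] by (simp_all add: t_def add_nonneg_pos)
  let ?u = "t *\<^sub>R 1 - z"
  have "norm (?u * ?u) \<le> t\<^sup>2"
    using t cstar_identity[of ?u] by (simp add: star_simps sz power_mono)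
  then have "cpos (t\<^sup>2 *\<^sub>R 1 - ?u * ?u)" by (intro cpos_shift_of_norm) (simp add: star_simps sz)
  moreover have "t\<^sup>2 *\<^sub>R 1 - ?u * ?u = (2 * t) *\<^sub>R z - z * z"
    by (simp add: algebra_simps power2_eq_square scaleR_2 flip: scaleR_scaleR)
  ultimately have p1: "cpos ((2 * t) *\<^sub>R z - z * z)" by simp
  obtain y where y: "z * y = 1" "y * z = 1" using inv by (auto simp: invertible_elem_def)
  have sy: "star y = y"
    by (metis y sz star_mult star_one mult.assoc mult_1_left mult_1_right)
  \<comment> \<open>The bound \<open>e \<parallel>y\<^sup>2\<parallel> < 1\<close> is what the square root of \<open>1 - e y\<^sup>2\<close> requires.\<close>
  define e where "e = 1 / ((norm y)\<^sup>2 + 1)"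
  have e: "e > 0" by (simp add: e_def add_nonneg_pos)
  have "e * norm (y * y) \<le> e * (norm y)\<^sup>2" using cstar_identity[of y] sy by simp
  also have "\<dots> < 1" using zero_le_power2[of "norm y"] by (simp add: e_def divide_less_eq add_nonneg_pos)
  finally have nx: "norm (e *\<^sub>R (y * y)) < 1" using e by simp
  have sx: "star (e *\<^sub>R (y * y)) = e *\<^sub>R (y * y)" by (simp add: star_simps sy)
  obtain c where c: "star c = c" "norm c < 1" "(1 - c) * (1 - c) = 1 - e *\<^sub>R (y * y)"
     "\<And>w. e *\<^sub>R (y * y) * w = w * (e *\<^sub>R (y * y)) \<Longrightarrow> c * w = w * c"
    by (rule sqrt_one_minus[OF sx nx]) (rule that)
  have yyz: "y * y * z = z * (y * y)" using y by (metis mult.assoc mult_1_left mult_1_right)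
  have cz: "c * z = z * c" by (rule c(4)) (simp add: yyz)
  define w where "w = z * (1 - c)"
  have wc: "w = (1 - c) * z" by (simp add: w_def algebra_simps cz)
  have "w * w = z * ((1 - c) * (1 - c)) * z" by (subst (2) wc) (simp add: w_def mult.assoc)
  also have "\<dots> = z * z - e *\<^sub>R (z * y * y * z)"
    unfolding c(3) by (simp add: left_diff_distrib right_diff_distrib mult.assoc)
  also have "z * y * y * z = 1" by (simp add: y mult.assoc)
  finally have "w * w = z * z - e *\<^sub>R 1" .
  moreover have "cpos (w * w)"
    by (intro cpos_square) (metis w_def wc star_mult star_diff star_one sz c(1))
  ultimately have "cpos (((2 * t) *\<^sub>R z - z * z) + (z * z - e *\<^sub>R 1))"
    using p1 by (intro cpos_add) auto
  also have "((2 * t) *\<^sub>R z - z * z) + (z * z - e *\<^sub>R 1) = (2 * t) *\<^sub>R (z - (e / (2 * t)) *\<^sub>R 1)"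
    using t by (simp add: scaleR_diff_right)
  finally have "cpos (z - (e / (2 * t)) *\<^sub>R 1)" using t by (simp only: cpos_scaleR_iff)
  then show ?thesis using e t by (intro that[of "e / (2 * t)"]) auto
qed

text \<open>Positivity of the spectrum implies positivity.  Let \<open>s\<close> be the least number such that \<open>a + s\<close> is
  in the cone.  If \<open>s\<close> were positive, then \<open>a + s\<close> would be invertible, and by the previous lemma a
  smaller number would do.\<close>

lemma cpos_of_invertible:
  fixes a :: "'a::unital_cstar_algebra"
  assumes sa: "star a = a" and inv: "\<And>s. s > 0 \<Longrightarrow> invertible_elem (a + s *\<^sub>R 1)"
  shows "cpos a"
proof -
  define S where "S = {s. s \<ge> 0 \<and> cpos (a + s *\<^sub>R 1)}"
  define s where "s = Inf S"
  have ne: "norm a \<in> S"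
    using cpos_norm_plus[OF sa order_refl] by (simp add: S_def add.commute[of a])
  have bdd: "bdd_below S" by (auto simp: S_def intro: bdd_belowI[of _ 0])
  have s0: "s \<ge> 0" unfolding s_def using ne by (intro cInf_greatest) (blast, simp add: S_def)
  have "cpos (a + s *\<^sub>R 1 + e *\<^sub>R 1)" if e: "e > 0" for e
  proof -
    obtain s' where s': "s' \<in> S" "s' < s + e"
      using cInf_lessD[of S "s + e"] ne e by (auto simp: s_def)
    then have "cpos ((a + s' *\<^sub>R 1) + (s + e - s') *\<^sub>R 1)" 
      by (intro cpos_add[OF _ cpos_const, of "a + s' *\<^sub>R 1"]) (simp_all add: S_def)
    then show ?thesis by (simp add: scaleR_add_left scaleR_diff_left add.assoc)
  qed
  then have z: "cpos (a + s *\<^sub>R 1)" by (rule cpos_limit)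
  have "s = 0"
  proof (rule ccontr)
    assume "s \<noteq> 0"
    then have "s > 0" using s0 by simp
    then obtain e where e: "e > 0" "cpos (a + s *\<^sub>R 1 - e *\<^sub>R 1)"
      using cpos_invertible_diff[OF z inv] by blast
    define e' where "e' = min e s"
    have "cpos ((a + s *\<^sub>R 1 - e *\<^sub>R 1) + (e - e') *\<^sub>R 1)"
      using e by (intro cpos_add_const) (auto simp: e'_def)
    then have "s - e' \<in> S" by (simp add: S_def e'_def algebra_simps)
    then have "s \<le> s - e'" unfolding s_def by (intro cInf_lower bdd)
    then show False using \<open>s > 0\<close> e by (simp add: e'_def)
  qed
  then show ?thesis using z by simp
qed

lemma cpos_conj_commuting:
  assumes a: "cpos a" and b: "star b = b" "a * b = b * a"
  shows "cpos (b * a * b)"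
proof (rule cpos_limit)
  fix e :: real assume "e > 0"
  then obtain c where c: "star c = c" "c * c = a + e *\<^sub>R 1" "cpos c"
      "\<And>y. a * y = y * a \<Longrightarrow> c * y = y * c"
    by (rule cpos_sqrt[OF a]) (rule that)
  have cb: "c * b = b * c" by (rule c(4)[OF b(2)])
  have "cpos ((c * b) * (c * b))" by (rule cpos_square) (simp add: star_mult c(1) b(1) cb)
  also have "(c * b) * (c * b) = b * (c * c) * b" by (metis cb mult.assoc)
  also have "\<dots> = b * a * b + e *\<^sub>R (b * b)" by (simp add: c(2) distrib_left distrib_right)
  finally show "cpos (b * a * b + e *\<^sub>R (b * b))" .
qed

text \<open>If \<open>b\<close> is the inverse of \<open>r - x y\<close>, then \<open>(1 + y b x) / r\<close> is the inverse of \<open>r - y x\<close>.\<close>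

lemma invertible_elem_const_minus_swap:
  assumes r: "r \<noteq> 0" and inv: "invertible_elem (r *\<^sub>R 1 - x * y)"
  shows "invertible_elem (r *\<^sub>R 1 - y * (x::'a::unital_cstar_algebra))"
proof -
  obtain b where b: "(r *\<^sub>R 1 - x * y) * b = 1" "b * (r *\<^sub>R 1 - x * y) = 1"
    using inv by (auto simp: invertible_elem_def)
  have b1: "x * (y * b) = r *\<^sub>R b - 1" using b(1) by (simp add: left_diff_distrib mult.assoc algebra_simps)
  have b2: "b * (x * y) = r *\<^sub>R b - 1" using b(2) by (simp add: right_diff_distrib algebra_simps)
  let ?c = "1 + y * b * x"
  have "(r *\<^sub>R 1 - y * x) * ?c = r *\<^sub>R 1"
  proof -
    have "(r *\<^sub>R 1 - y * x) * ?c = r *\<^sub>R 1 + r *\<^sub>R (y * b * x) - y * x - y * (x * (y * b)) * x"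
      by (simp add: algebra_simps)
    then show ?thesis by (simp add: b1 algebra_simps)
  qed
  moreover have "?c * (r *\<^sub>R 1 - y * x) = r *\<^sub>R 1"
  proof -
    have "?c * (r *\<^sub>R 1 - y * x) = r *\<^sub>R 1 + r *\<^sub>R (y * b * x) - y * x - y * (b * (x * y)) * x"
      by (simp add: algebra_simps)
    then show ?thesis by (simp add: b2 algebra_simps)
  qed
  ultimately show ?thesis
    using r by (intro invertible_elemI2[of _ "inverse r *\<^sub>R ?c" "inverse r *\<^sub>R ?c"]) simp_all
qed

lemma cpos_const_minus_swap:
  fixes c :: "'a::unital_cstar_algebra"
  assumes p: "cpos (r *\<^sub>R 1 - star c * c)" and r: "r \<ge> 0"
  shows "cpos (r *\<^sub>R 1 - c * star c)"
proof (rule cpos_of_invertible)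
  fix s :: real assume s: "s > 0"
  have "invertible_elem ((r + s) *\<^sub>R 1 - star c * c)"
    using invertible_elem_cpos_plus[OF p s] by (simp add: algebra_simps)
  then have "invertible_elem ((r + s) *\<^sub>R 1 - c * star c)"
    using r s by (intro invertible_elem_const_minus_swap[where y = c]) auto
  then show "invertible_elem (r *\<^sub>R 1 - c * star c + s *\<^sub>R 1)" by (simp add: algebra_simps)
qed (simp add: star_simps)

text \<open>In terms of the real and imaginary parts \<open>x\<close> and \<open>y\<close> of \<open>c\<close> this is \<open>2 x\<^sup>2 + 2 y\<^sup>2\<close>.\<close>

lemma cpos_star_mult_add: "cpos (star c * c + c * star c)"
proof -
  \<comment> \<open>Up to sign, these are twice the real and twice the imaginary part.\<close>
  define x y where "x = c + star c" and "y = \<i> *\<^sub>C (c - star c)"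
  have "star x = x" by (simp add: x_def star_simps add.commute)
  moreover have "star y = y"
    by (simp add: y_def star_simps star_scaleC scaleC_minus_left scaleC_diff_right)
  ultimately have "cpos ((1/2) *\<^sub>R (x * x + y * y))" by (intro cpos_scaleR cpos_add cpos_square) auto
  also have "y * y = - ((c - star c) * (c - star c))"
    by (simp add: y_def mult_scaleC_left mult_scaleC_right scaleC_scaleC scaleC_minus_left scaleC_one)
  also have "x * x + - ((c - star c) * (c - star c)) = 2 *\<^sub>R (star c * c + c * star c)"
    by (simp add: x_def algebra_simps scaleR_2)
  finally show ?thesis by simp
qed

text \<open>For \<open>l > r\<close> the invertible element \<open>l\<^sup>3 - k\<^sup>3\<close> has the factor \<open>l - k\<close>.\<close>

lemma cpos_cube_root_le:
  assumes k: "cpos k" and r: "r \<ge> 0" and p: "cpos (r ^ 3 *\<^sub>R 1 - k * k * k)"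
  shows "cpos (r *\<^sub>R 1 - (k::'a::unital_cstar_algebra))"
proof (rule cpos_of_invertible)
  show "star (r *\<^sub>R 1 - k) = r *\<^sub>R 1 - k" using k by (simp add: star_simps cpos_star)
  fix s :: real assume s: "s > 0"
  define l where "l = r + s"
  let ?q = "(l * l) *\<^sub>R 1 + l *\<^sub>R k + k * k"
  have "l ^ 3 > r ^ 3" unfolding l_def using r s by (intro power_strict_mono) auto
  then have "invertible_elem ((r ^ 3 *\<^sub>R 1 - k * k * k) + (l ^ 3 - r ^ 3) *\<^sub>R 1)"
    by (intro invertible_elem_cpos_plus[OF p]) simp
  also have "(r ^ 3 *\<^sub>R 1 - k * k * k) + (l ^ 3 - r ^ 3) *\<^sub>R 1 = (l *\<^sub>R 1 - k) * ?q"
    by (simp add: algebra_simps power3_eq_cube)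
  finally have "invertible_elem ((l *\<^sub>R 1 - k) * ?q)" .
  moreover have "(l *\<^sub>R 1 - k) * ?q = ?q * (l *\<^sub>R 1 - k)"
    by (simp add: algebra_simps)
  ultimately have "invertible_elem (l *\<^sub>R 1 - k)" by (rule invertible_elem_commuting_factor)
  then show "invertible_elem (r *\<^sub>R 1 - k + s *\<^sub>R 1)" by (simp add: l_def algebra_simps)
qed

text \<open>Put \<open>a = b* b\<close> and let \<open>h\<close> be close to \<open>\<bar>a\<bar>\<close>, so that \<open>k = h - a\<close> is close to twice the
  negative part of \<open>a\<close>.  For \<open>c = b k\<close> the element \<open>c* c = k a k\<close> is close to \<open>- k\<^sup>3 / 2\<close>, hence almost
  negative.  Then so is \<open>c c*\<close>, which has the same spectrum up to \<open>0\<close>; but \<open>c* c + c c*\<close>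
  is positive.  So \<open>k\<^sup>3\<close> and therefore \<open>k\<close> are almost zero, and \<open>a\<close> is close to \<open>h\<close>.\<close>

theorem cpos_star_mult: "cpos (star b * (b::'a::unital_cstar_algebra))"
proof (rule cpos_limit[where b = 1])
  fix r :: real assume r: "r > 0"
  define a where "a = star b * b"
  have sa: "star a = a" by (simp add: a_def star_simps)
  define M where "M = 2 * norm a + 1"
  have M: "M > 0" by (simp add: M_def add_nonneg_pos)
  \<comment> \<open>With \<open>h\<^sup>2 = a\<^sup>2 + d\<close> the norm of \<open>k\<close> is at most \<open>M\<close>, uniformly in \<open>d \<le> 1\<close>, and the estimate
    for \<open>k\<^sup>3\<close> below comes out as \<open>2 d M\<close>, which should not exceed \<open>r\<^sup>3\<close>.\<close>
  define d where "d = min 1 (r ^ 3 / (2 * M))"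
  have d: "d > 0" "d \<le> 1" "2 * d * M \<le> r ^ 3"
    using r M by (auto simp: d_def min_def field_simps)
  obtain h where h': "star h = h" "h * h = a * a + d *\<^sub>R 1" "cpos h"
      "\<And>y. a * a * y = y * (a * a) \<Longrightarrow> h * y = y * h"
    by (rule cpos_sqrt[OF cpos_square[OF sa] d(1)]) (rule that)
  have "h * a = a * h" by (rule h'(4)) (simp add: mult.assoc)
  note h = h'(2,3) this
  have sh: "star h = h" using h(2) by (rule cpos_star)
  define k where "k = h - a"
  have sk: "star k = k" by (simp add: k_def star_simps sh sa)
  have ka: "k * a = a * k" by (simp add: k_def algebra_simps h(3))
  have pk: "cpos k"
  proof (rule cpos_of_invertible[OF sk])
    fix s :: real assume s: "s > 0"
    have "invertible_elem ((2 * s) *\<^sub>R h + (d + s * s) *\<^sub>R 1)"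
      using s d by (intro invertible_elem_cpos_plus cpos_scaleR h add_pos_pos) auto
    also have "(2 * s) *\<^sub>R h + (d + s * s) *\<^sub>R 1 = (k + s *\<^sub>R 1) * (h + a + s *\<^sub>R 1)"
      using h(1,3) by (simp add: k_def algebra_simps scaleR_2 flip: scaleR_scaleR)
    finally have "invertible_elem ((k + s *\<^sub>R 1) * (h + a + s *\<^sub>R 1))" .
    moreover have "(k + s *\<^sub>R 1) * (h + a + s *\<^sub>R 1) = (h + a + s *\<^sub>R 1) * (k + s *\<^sub>R 1)"
      using h(3) by (simp add: k_def algebra_simps)
    ultimately show "invertible_elem (k + s *\<^sub>R 1)" by (rule invertible_elem_commuting_factor)
  qed
  have "norm k \<le> M"
  proof -
    have "(norm h)\<^sup>2 = norm (a * a + d *\<^sub>R 1)" using cstar_identity[of h] by (simp add: sh h(1))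
    also have "\<dots> \<le> norm (a * a) + norm (d *\<^sub>R (1::'a))" by (rule norm_triangle_ineq)
    also have "\<dots> \<le> (norm a)\<^sup>2 + 1"
      using order_trans[OF norm_scaleR_one_le[of d, where 'a='a]] d cstar_identity[of a] sa by simp
    also have "\<dots> \<le> (norm a + 1)\<^sup>2" by (simp add: power2_eq_square algebra_simps)
    finally have "norm h \<le> norm a + 1" by (rule power2_le_imp_le) simp
    then show ?thesis using norm_triangle_ineq4[of h a] by (simp add: k_def M_def)
  qed
  then have Mk: "cpos (d *\<^sub>R (M *\<^sub>R 1 - k))" using d by (intro cpos_scaleR cpos_shift_of_norm sk) auto
  define c where "c = b * k"
  have scc: "star c * c = k * a * k" by (simp add: c_def star_simps sk a_def mult.assoc)
  have "k * (k + 2 *\<^sub>R a) = d *\<^sub>R 1"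
    using h(1,3) by (simp add: k_def algebra_simps scaleR_2)
  then have "k * (k + 2 *\<^sub>R a) * k = d *\<^sub>R k" by simp
  then have cc: "2 *\<^sub>R (star c * c) = d *\<^sub>R k - k * k * k"
    by (simp add: scc algebra_simps)
  let ?e = "d * M / 2"
  have kkk: "cpos (k * k * k)" using cpos_conj_commuting[OF pk sk] by simp
  have "2 *\<^sub>R (?e *\<^sub>R 1 - star c * c) = d *\<^sub>R (M *\<^sub>R 1 - k) + k * k * k"
    unfolding scaleR_diff_right[of 2] cc by (simp add: scaleR_diff_right)
  then have "cpos (2 *\<^sub>R (?e *\<^sub>R 1 - star c * c))" using cpos_add[OF Mk kkk] by simp
  then have "cpos (?e *\<^sub>R 1 - star c * c)" by (simp only: cpos_scaleR_iff zero_less_numeral)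
  then have "cpos (?e *\<^sub>R 1 - c * star c)" using d M by (intro cpos_const_minus_swap) auto
  then have "cpos ((star c * c + c * star c) + (?e *\<^sub>R 1 - c * star c))"
    by (intro cpos_add cpos_star_mult_add)
  then have q: "cpos (star c * c + ?e *\<^sub>R 1)" by (simp add: algebra_simps)
  have "cpos (2 *\<^sub>R (star c * c + ?e *\<^sub>R 1) + d *\<^sub>R (M *\<^sub>R 1 - k) + (r ^ 3 - 2 * d * M) *\<^sub>R 1)"
    by (intro cpos_add[OF cpos_add] cpos_scaleR[OF q] Mk cpos_const) (use d in auto)
  also have "(2 * d * M) *\<^sub>R (1::'a) = (d * M) *\<^sub>R 1 + (d * M) *\<^sub>R 1"
    by (simp add: scaleR_add_left[symmetric])
  then have "2 *\<^sub>R (star c * c + ?e *\<^sub>R 1) + d *\<^sub>R (M *\<^sub>R 1 - k) + (r ^ 3 - 2 * d * M) *\<^sub>R 1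
      = r ^ 3 *\<^sub>R 1 - k * k * k"
    unfolding scaleR_add_right cc by (simp add: scaleR_diff_right scaleR_diff_left)
  finally have "cpos (r *\<^sub>R 1 - k)" by (rule cpos_cube_root_le[OF pk less_imp_le[OF r]])
  then have "cpos (h + (r *\<^sub>R 1 - k))" using h(2) by (intro cpos_add)
  then show "cpos (star b * b + r *\<^sub>R 1)" by (simp add: k_def a_def algebra_simps)
qed

lemma cpos_conj:
  assumes a: "cpos a" shows "cpos (star b * a * b)"
proof (rule cpos_limit)
  fix e :: real assume "e > 0"
  then obtain c where c: "star c = c" "c * c = a + e *\<^sub>R 1" by (rule cpos_sqrt[OF a]) (rule that)
  have "cpos (star (c * b) * (c * b))" by (rule cpos_star_mult)
  also have "star (c * b) * (c * b) = star b * (c * c) * b" by (simp add: star_mult c(1) mult.assoc)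
  also have "\<dots> = star b * a * b + e *\<^sub>R (star b * b)" by (simp add: c(2) distrib_left distrib_right)
  finally show "cpos (star b * a * b + e *\<^sub>R (star b * b))" .
qed

lemma cpos_conj_norm: "cpos ((norm a)\<^sup>2 *\<^sub>R (star b * b) - star (a * b) * (a * b))"
proof -
  have "cpos ((norm a)\<^sup>2 *\<^sub>R 1 - star a * a)"
    by (intro cpos_shift_of_norm) (simp_all add: star_simps cstar_identity)
  from cpos_conj[OF this, of b] show ?thesis
    by (simp add: left_diff_distrib right_diff_distrib star_mult mult.assoc)
qed

section \<open>Positive matrices as positive quadratic forms\<close>

text \<open>Matrices and vectors are functions on a finite index set \<open>I\<close>.  The sum \<open>ip I u v\<close> is the
  inner product, with values in the algebra, of the Hilbert module of vectors.\<close>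

definition ip :: "'i set \<Rightarrow> ('i \<Rightarrow> 'a::unital_cstar_algebra) \<Rightarrow> ('i \<Rightarrow> 'a) \<Rightarrow> 'a" where
  "ip I u v = (\<Sum>i\<in>I. star (u i) * v i)"

definition app :: "'i set \<Rightarrow> ('i \<Rightarrow> 'i \<Rightarrow> 'a::unital_cstar_algebra) \<Rightarrow> ('i \<Rightarrow> 'a) \<Rightarrow> 'i \<Rightarrow> 'a" where
  "app I X v i = (\<Sum>j\<in>I. X i j * v j)"

definition hermitian :: "'i set \<Rightarrow> ('i \<Rightarrow> 'i \<Rightarrow> 'a::unital_cstar_algebra) \<Rightarrow> bool" where
  "hermitian I X \<longleftrightarrow> (\<forall>i\<in>I. \<forall>j\<in>I. star (X i j) = X j i)"

definition pos_form :: "'i set \<Rightarrow> ('i \<Rightarrow> 'i \<Rightarrow> 'a::unital_cstar_algebra) \<Rightarrow> bool" where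
  "pos_form I X \<longleftrightarrow> hermitian I X \<and> (\<forall>v. cpos (ip I v (app I X v)))"

lemma ip_add_left: "ip I (\<lambda>i. u i + v i) w = ip I u w + ip I v w"
  by (simp add: ip_def star_simps distrib_right sum.distrib)

lemma ip_add_right: "ip I w (\<lambda>i. u i + v i) = ip I w u + ip I w v"
  by (simp add: ip_def distrib_left sum.distrib)

lemma ip_diff_left: "ip I (\<lambda>i. u i - v i) w = ip I u w - ip I v w"
  by (simp add: ip_def star_simps left_diff_distrib sum_subtractf)

lemma ip_diff_right: "ip I w (\<lambda>i. u i - v i) = ip I w u - ip I w v"
  by (simp add: ip_def right_diff_distrib sum_subtractf)

lemma ip_scaleR_left: "ip I (\<lambda>i. r *\<^sub>R u i) w = r *\<^sub>R ip I u w"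
  by (simp add: ip_def star_simps scaleR_sum_right)

lemma ip_scaleR_right: "ip I w (\<lambda>i. r *\<^sub>R u i) = r *\<^sub>R ip I w u"
  by (simp add: ip_def scaleR_sum_right)

lemmas ip_simps = ip_add_left ip_add_right ip_diff_left ip_diff_right ip_scaleR_left ip_scaleR_right

lemma star_ip: "star (ip I u v) = ip I v u"
  by (simp add: ip_def star_sum star_simps)

lemma cpos_ip_self: "cpos (ip I v v)"
  unfolding ip_def by (intro cpos_sum cpos_star_mult)

lemma ip_cong: "(\<And>i. i \<in> I \<Longrightarrow> u i = u' i) \<Longrightarrow> (\<And>i. i \<in> I \<Longrightarrow> v i = v' i) \<Longrightarrow> ip I u v = ip I u' v'"
  unfolding ip_def by (rule sum.cong) simp_all

lemma app_diff: "app I X (\<lambda>j. u j - v j) = (\<lambda>i. app I X u i - app I X v i)"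
  by (simp add: app_def fun_eq_iff right_diff_distrib sum_subtractf)

lemma app_scaleR: "app I X (\<lambda>j. r *\<^sub>R v j) = (\<lambda>i. r *\<^sub>R app I X v i)"
  by (simp add: app_def fun_eq_iff scaleR_sum_right)

lemma ip_app_double_sum: "ip I v (app I X v) = (\<Sum>i\<in>I. \<Sum>j\<in>I. star (v i) * X i j * v j)"
  by (simp add: ip_def app_def sum_distrib_left mult.assoc)

lemma ip_app_adjoint: "ip I u (app I X v) = ip I (app I (\<lambda>i j. star (X j i)) u) v"
  unfolding ip_def app_def
  by (simp add: star_sum star_simps sum_distrib_left sum_distrib_right mult.assoc) (rule sum.swap)

lemma ip_app_hermitian:
  assumes "hermitian I X" shows "ip I u (app I X v) = ip I (app I X u) v"
  unfolding ip_app_adjoint[of I u]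
  by (rule ip_cong) (use assms in \<open>simp_all add: hermitian_def app_def\<close>)

lemma app_single:
  assumes "finite I" "n \<in> I"
  shows "app I X (\<lambda>j. if j = n then a else 0) i = X i n * a"
  unfolding app_def using assms by (simp add: if_distrib[of "\<lambda>x. _ * x"] cong: if_cong)

lemma ip_single_left:
  assumes "finite I" "n \<in> I"
  shows "ip I (\<lambda>j. if j = n then a else 0) w = star a * w n"
proof -
  have "star (if j = n then a else 0) * w j = (if j = n then star a * w n else 0)" for j by simp
  then show ?thesis unfolding ip_def using assms by simp
qed

text \<open>For a single entry this is \<open>(a b)* (a b) \<le> \<parallel>a\<parallel>\<^sup>2 b* b\<close>, and \<open>(p + q)* (p + q) \<le> 2 p* p + 2 q* q\<close>
  takes care of sums.\<close>

lemma app_bound: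
  fixes X :: "'i \<Rightarrow> 'i \<Rightarrow> 'a::unital_cstar_algebra"
  assumes I: "finite I"
  obtains R where "R > 0" "\<And>v. cpos (R *\<^sub>R ip I v v - ip I (app I X v) (app I X v))"
proof -
  define Q where "Q L \<longleftrightarrow> (\<exists>R\<ge>0. \<forall>v. cpos (R *\<^sub>R ip I v v - star (L v) * L v))" for L :: "('i \<Rightarrow> 'a) \<Rightarrow> 'a"
  have Q1: "Q (\<lambda>v. a * v j)" if j: "j \<in> I" for a j
  proof -
    have "cpos ((norm a)\<^sup>2 *\<^sub>R ip I v v - star (a * v j) * (a * v j))" for v
    proof -
      have "ip I v v = star (v j) * v j + (\<Sum>i\<in>I - {j}. star (v i) * v i)"
        unfolding ip_def using I j by (rule sum.remove)
      then have "(norm a)\<^sup>2 *\<^sub>R ip I v v - star (a * v j) * (a * v j)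
          = ((norm a)\<^sup>2 *\<^sub>R (star (v j) * v j) - star (a * v j) * (a * v j))
            + (norm a)\<^sup>2 *\<^sub>R (\<Sum>i\<in>I - {j}. star (v i) * v i)"
        by (simp add: scaleR_add_right)
      also have "cpos \<dots>"
        by (intro cpos_add cpos_conj_norm cpos_scaleR cpos_sum cpos_star_mult) simp
      finally show ?thesis .
    qed
    then show ?thesis unfolding Q_def by (intro exI[of _ "(norm a)\<^sup>2"]) simp
  qed
  have Q2: "Q (\<lambda>v. L v + M v)" if L: "Q L" and M: "Q M" for L M
  proof -
    obtain R where R: "R \<ge> 0" "\<And>v. cpos (R *\<^sub>R ip I v v - star (L v) * L v)" using L unfolding Q_def by blast
    obtain R' where R': "R' \<ge> 0" "\<And>v. cpos (R' *\<^sub>R ip I v v - star (M v) * M v)" using M unfolding Q_def by blast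
    have "cpos ((2 * R + 2 * R') *\<^sub>R ip I v v - star (L v + M v) * (L v + M v))" for v
    proof -
      have "(2 * R + 2 * R') *\<^sub>R ip I v v - star (L v + M v) * (L v + M v)
        = 2 *\<^sub>R (R *\<^sub>R ip I v v - star (L v) * L v) + 2 *\<^sub>R (R' *\<^sub>R ip I v v - star (M v) * M v)
          + star (L v - M v) * (L v - M v)"
        by (simp add: star_simps algebra_simps scaleR_2)
      also have "cpos \<dots>" using R(2) R'(2) by (intro cpos_add cpos_star_mult cpos_scaleR) auto
      finally show ?thesis .
    qed
    then show ?thesis unfolding Q_def using R(1) R'(1) by (intro exI[of _ "2 * R + 2 * R'"]) simp
  qed
  have Q0: "Q (\<lambda>v. 0)" unfolding Q_def by (intro exI[of _ 0]) simp
  have Qsum: "Q (\<lambda>v. \<Sum>j\<in>J. X i j * v j)" if "J \<subseteq> I" for i J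
    using finite_subset[OF that I] that
    by (induction J rule: finite_induct) (simp_all add: Q0 Q1 Q2)
  have "\<exists>R. R \<ge> 0 \<and> (\<forall>v. cpos (R *\<^sub>R ip I v v - star (app I X v i) * app I X v i))" for i
    using Qsum[of I i] unfolding Q_def app_def by auto
  then obtain R where R: "\<And>i. R i \<ge> 0" "\<And>i v. cpos (R i *\<^sub>R ip I v v - star (app I X v i) * app I X v i)"
    by metis
  have S: "cpos (sum R I *\<^sub>R ip I v v - ip I (app I X v) (app I X v))" for v
  proof -
    have "sum R I *\<^sub>R ip I v v - ip I (app I X v) (app I X v)
        = (\<Sum>i\<in>I. R i *\<^sub>R ip I v v - star (app I X v i) * app I X v i)"
      unfolding sum_subtractf scaleR_sum_left by (simp add: ip_def)
    also have "cpos \<dots>" by (intro cpos_sum R)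
    finally show ?thesis .
  qed
  have "cpos ((sum R I + 1) *\<^sub>R ip I v v - ip I (app I X v) (app I X v))" for v
  proof -
    have "(sum R I + 1) *\<^sub>R ip I v v - ip I (app I X v) (app I X v)
       = (sum R I *\<^sub>R ip I v v - ip I (app I X v) (app I X v)) + ip I v v"
      by (simp add: scaleR_add_left)
    also have "cpos \<dots>" by (intro cpos_add S cpos_ip_self)
    finally show ?thesis .
  qed
  moreover have "sum R I + 1 > 0" using sum_nonneg[of I R] R(1) by (simp add: add_nonneg_pos)
  ultimately show ?thesis using that by blast
qed

text \<open>Expand \<open>(v - X v)* (v - X v) \<ge> 0\<close>.\<close>

lemma form_bound:
  fixes X :: "'i \<Rightarrow> 'i \<Rightarrow> 'a::unital_cstar_algebra"
  assumes I: "finite I"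
  obtains R where "R > 0"
    "\<And>v. cpos (R *\<^sub>R ip I v v - (ip I v (app I X v) + ip I (app I X v) v))"
proof -
  obtain R where R: "R > 0" "\<And>v. cpos (R *\<^sub>R ip I v v - ip I (app I X v) (app I X v))"
    by (rule app_bound[OF I]) (rule that)
  have "cpos ((R + 1) *\<^sub>R ip I v v - (ip I v (app I X v) + ip I (app I X v) v))" for v
  proof -
    let ?d = "\<lambda>i. v i - app I X v i"
    have "(R + 1) *\<^sub>R ip I v v - (ip I v (app I X v) + ip I (app I X v) v)
      = (R *\<^sub>R ip I v v - ip I (app I X v) (app I X v)) + ip I ?d ?d"
      by (simp add: ip_simps scaleR_add_left)
    also have "cpos \<dots>" by (intro cpos_add R cpos_ip_self)
    finally show ?thesis .
  qed
  then show ?thesis using R(1) that[of "R + 1"] by simp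
qed

subsection \<open>Strictly positive matrices are invertible\<close>

text \<open>Elimination of one index \<open>n\<close>.  The diagonal entry \<open>X n n\<close> is bounded below, hence invertible, and
  the Schur complement is the restriction of the form to the vectors whose image
  vanishes at \<open>n\<close>, so it has the same lower bound.\<close>

lemma strictly_positive_surj:
  fixes X :: "'i \<Rightarrow> 'i \<Rightarrow> 'a::unital_cstar_algebra"
  assumes "finite I" "hermitian I X" "e > 0"
    "\<And>v. cpos (ip I v (app I X v) - e *\<^sub>R ip I v v)"
  shows "\<exists>v. \<forall>i\<in>I. app I X v i = w i"
  using assms(1,2,4)
proof (induction I arbitrary: X w rule: finite_induct)
  case empty
  then show ?case by simp
next
  case (insert n I)
  note I = insert.hyps(1) and n = insert.hyps(2)
  have herm: "star (X i j) = X j i" if "i \<in> insert n I" "j \<in> insert n I" for i j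
    using insert.prems(1) that unfolding hermitian_def by blast
  have app_ins: "app (insert n I) X v i = X i n * v n + app I X v i" for v i
    unfolding app_def using I n by simp
  have ip_ins: "ip (insert n I) u v = star (u n) * v n + ip I u v" for u v :: "'i \<Rightarrow> 'a"
    unfolding ip_def using I n by simp
  let ?\<delta> = "\<lambda>j. if j = n then 1 else (0::'a)"
  have "cpos (X n n - e *\<^sub>R 1)"
    using insert.prems(2)[of ?\<delta>] I by (simp add: ip_single_left app_single)
  then have "invertible_elem ((X n n - e *\<^sub>R 1) + e *\<^sub>R 1)"
    using \<open>e > 0\<close> by (rule invertible_elem_cpos_plus)
  then obtain b where b: "X n n * b = 1" "b * X n n = 1" by (auto simp: invertible_elem_def)
  have "star b * X n n = 1" using arg_cong[OF b(1), of star] herm[of n n] by (simp add: star_mult)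
  then have sb: "star b = b" using b by (metis mult.assoc mult_1_left mult_1_right)
  define S where "S i j = X i j - X i n * b * X n j" for i j
  have "hermitian I S"
    unfolding hermitian_def S_def by (simp add: star_simps herm sb mult.assoc)
  have app_S: "app I S v i = app I X v i - X i n * b * app I X v n" for v i
    unfolding app_def S_def
    by (simp add: left_diff_distrib sum_subtractf sum_distrib_left mult.assoc)
  have Spos: "cpos (ip I v (app I S v) - e *\<^sub>R ip I v v)" for v
  proof -
    let ?s = "app I X v n"
    let ?w = "\<lambda>i. if i = n then - (b * ?s) else v i"
    have w_v: "app I X ?w i = app I X v i" for i
      unfolding app_def by (rule sum.cong) (use n in auto)
    have aw: "app (insert n I) X ?w i = app I X v i - X i n * b * ?s" for i
      by (simp add: app_ins w_v mult.assoc)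
    have awn: "app (insert n I) X ?w n = 0" by (simp add: aw b)
    have "ip (insert n I) ?w (app (insert n I) X ?w) = ip I ?w (app (insert n I) X ?w)"
      by (simp add: ip_ins awn)
    also have "\<dots> = ip I v (app I S v)"
      by (rule ip_cong) (use n in \<open>auto simp: aw app_S\<close>)
    finally have 1: "ip (insert n I) ?w (app (insert n I) X ?w) = ip I v (app I S v)" .
    have "ip I ?w ?w = ip I v v" by (rule ip_cong) (use n in auto)
    then have 2: "ip (insert n I) ?w ?w = star (b * ?s) * (b * ?s) + ip I v v"
      by (simp add: ip_ins star_minus)
    have "cpos ((ip I v (app I S v) - e *\<^sub>R (star (b * ?s) * (b * ?s) + ip I v v)) + e *\<^sub>R (star (b * ?s) * (b * ?s)))"
      using insert.prems(2)[of ?w] \<open>e > 0\<close> unfolding 1 2 by (intro cpos_add cpos_scaleR cpos_star_mult) auto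
    then show ?thesis by (simp add: scaleR_add_right)
  qed
  obtain v where v: "\<And>i. i \<in> I \<Longrightarrow> app I S v i = w i - X i n * b * w n"
    using insert.IH[OF \<open>hermitian I S\<close> Spos, of "\<lambda>i. w i - X i n * b * w n"] by blast
  let ?z = "\<lambda>i. if i = n then b * (w n - app I X v n) else v i"
  have z_v: "app I X ?z i = app I X v i" for i
    unfolding app_def by (rule sum.cong) (use n in auto)
  have az: "app (insert n I) X ?z i = X i n * b * (w n - app I X v n) + app I X v i" for i
    by (simp add: app_ins z_v mult.assoc)
  have "app (insert n I) X ?z i = w i" if "i \<in> insert n I" for i
  proof (cases "i = n")
    case True
    then show ?thesis by (simp add: az b)
  next
    case False
    then have "app I S v i = w i - X i n * b * w n" using v that by simp
    then show ?thesis unfolding az app_S by (simp add: right_diff_distrib diff_eq_eq)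
  qed
  then show ?case by blast
qed

definition add_diag :: "('i \<Rightarrow> 'i \<Rightarrow> 'a::unital_cstar_algebra) \<Rightarrow> 'a \<Rightarrow> 'i \<Rightarrow> 'i \<Rightarrow> 'a" where
  "add_diag X c i j = X i j + (if i = j then c else 0)"

lemma app_add_diag:
  assumes "finite I" "i \<in> I"
  shows "app I (add_diag X c) v i = app I X v i + c * v i"
proof -
  have "(if i = j then c else 0) * v j = (if i = j then c * v i else 0)" for j by simp
  then show ?thesis using assms by (simp add: app_def add_diag_def distrib_right sum.distrib)
qed

lemma hermitian_add_diag: "hermitian I X \<Longrightarrow> star c = c \<Longrightarrow> hermitian I (add_diag X c)"
  by (simp add: hermitian_def add_diag_def star_add)

subsection \<open>Spectral positivity\<close>

text \<open>Let \<open>0 \<le> z \<le> R\<close>.  The identity \<open>R\<^sup>2 z - R z\<^sup>2 = z (R - z) z + (R - z) z (R - z)\<close> shows that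
  \<open>z\<^sup>2 \<le> R z\<close>.  A left inverse of \<open>z\<close> is bounded, so \<open>1 \<le> R' z\<^sup>2\<close>, and together \<open>1 \<le> R R' z\<close>.\<close>

lemma strict_form_of_left_inverse:
  fixes Z :: "'i \<Rightarrow> 'i \<Rightarrow> 'a::unital_cstar_algebra"
  assumes I: "finite I" and Z: "pos_form I Z"
    and Y: "\<And>v i. i \<in> I \<Longrightarrow> app I Y (app I Z v) i = v i"
  obtains e where "e > 0" "\<And>v. cpos (ip I v (app I Z v) - e *\<^sub>R ip I v v)"
proof -
  have herm: "hermitian I Z" using Z by (simp add: pos_form_def)
  obtain R where R: "R > 0" "\<And>v. cpos (R *\<^sub>R ip I v v - (ip I v (app I Z v) + ip I (app I Z v) v))"
    by (rule form_bound[OF I]) (rule that)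
  obtain R' where R': "R' > 0" "\<And>v. cpos (R' *\<^sub>R ip I v v - ip I (app I Y v) (app I Y v))"
    by (rule app_bound[OF I]) (rule that)
  have upper: "cpos (R *\<^sub>R ip I v v - ip I v (app I Z v))" for v
  proof -
    have "cpos ((R *\<^sub>R ip I v v - (ip I v (app I Z v) + ip I (app I Z v) v)) + ip I v (app I Z v))"
      using Z by (intro cpos_add R(2)) (simp add: pos_form_def)
    then show ?thesis by (simp add: ip_app_hermitian[OF herm])
  qed
  have sq: "cpos (R *\<^sub>R ip I v (app I Z v) - ip I (app I Z v) (app I Z v))" for v
  proof -
    let ?w = "app I Z v" and ?d = "\<lambda>i. R *\<^sub>R v i - app I Z v i"
    have "cpos ((R *\<^sub>R ip I ?w ?w - ip I ?w (app I Z ?w)) + ip I ?d (app I Z ?d))"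
      using Z by (intro cpos_add upper) (simp add: pos_form_def)
    also have "ip I ?d (app I Z ?d) = R *\<^sub>R (R *\<^sub>R ip I v ?w) - R *\<^sub>R ip I ?w ?w - R *\<^sub>R ip I ?w ?w
        + ip I ?w (app I Z ?w)"
      unfolding app_diff app_scaleR ip_simps ip_app_hermitian[OF herm, of v ?w]
      by (simp add: scaleR_diff_right)
    also have "(R *\<^sub>R ip I ?w ?w - ip I ?w (app I Z ?w)) + (R *\<^sub>R (R *\<^sub>R ip I v ?w) - R *\<^sub>R ip I ?w ?w
        - R *\<^sub>R ip I ?w ?w + ip I ?w (app I Z ?w)) = R *\<^sub>R (R *\<^sub>R ip I v ?w - ip I ?w ?w)"
      by (simp add: scaleR_diff_right)
    finally show ?thesis using R(1) by (simp only: cpos_scaleR_iff)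
  qed
  have low: "cpos ((R * R') *\<^sub>R (ip I v (app I Z v) - (1 / (R * R')) *\<^sub>R ip I v v))" for v
  proof -
    let ?w = "app I Z v"
    have "ip I (app I Y ?w) (app I Y ?w) = ip I v v" by (rule ip_cong) (simp_all add: Y)
    then have "cpos (R' *\<^sub>R (R *\<^sub>R ip I v ?w - ip I ?w ?w) + (R' *\<^sub>R ip I ?w ?w - ip I v v))"
      using R'(1) R'(2)[of ?w] by (intro cpos_add cpos_scaleR sq) auto
    then show ?thesis using R(1) R'(1) by (simp add: scaleR_diff_right mult.commute)
  qed
  have RR: "R * R' > 0" using R(1) R'(1) by simp
  show ?thesis
  proof (rule that[of "1 / (R * R')"])
    show "cpos (ip I v (app I Z v) - (1 / (R * R')) *\<^sub>R ip I v v)" for v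
      using low[of v] RR by (simp only: cpos_scaleR_iff)
  qed (use RR in simp)
qed

text \<open>As in \<open>cpos_of_invertible\<close>, the least \<open>s\<close> such that \<open>X + s\<close> has a positive form is zero: for
  \<open>s > 0\<close> the invertible matrix \<open>X + s\<close> would be strictly positive.\<close>

lemma pos_form_of_left_inverses:
  fixes X :: "'i \<Rightarrow> 'i \<Rightarrow> 'a::unital_cstar_algebra"
  assumes I: "finite I" and herm: "hermitian I X"
    and inv: "\<And>s. s > 0 \<Longrightarrow> \<exists>Y. \<forall>v. \<forall>i\<in>I. app I Y (app I (add_diag X (s *\<^sub>R 1)) v) i = v i"
  shows "pos_form I X"
proof -
  define S where "S = {s. s \<ge> 0 \<and> (\<forall>v. cpos (ip I v (app I X v) + s *\<^sub>R ip I v v))}"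
  define s where "s = Inf S"
  obtain R where R: "R > 0" "\<And>v. cpos (R *\<^sub>R ip I v v
      - (ip I v (app I (\<lambda>i j. - X i j) v) + ip I (app I (\<lambda>i j. - X i j) v) v))"
    by (rule form_bound[OF I]) (rule that)
  have neg: "app I (\<lambda>i j. - X i j) v = (\<lambda>i. 0 - app I X v i)" for v
    by (simp add: app_def fun_eq_iff sum_negf)
  have z0: "ip I v (\<lambda>i. 0) = 0" "ip I (\<lambda>i. 0) v = 0" for v :: "'i \<Rightarrow> 'a" by (simp_all add: ip_def)
  have "cpos (2 *\<^sub>R (ip I v (app I X v) + (R / 2) *\<^sub>R ip I v v))" for v
    using R(2)[of v]
    unfolding neg ip_diff_left ip_diff_right z0 ip_app_hermitian[OF herm, symmetric]
    by (simp add: scaleR_2 scaleR_add_right algebra_simps)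
  then have ne: "R / 2 \<in> S" using R(1) by (simp add: S_def cpos_scaleR_iff del: scaleR_add_right)
  have bdd: "bdd_below S" by (auto simp: S_def intro: bdd_belowI[of _ 0])
  have s0: "s \<ge> 0" unfolding s_def using ne by (intro cInf_greatest) (blast, simp add: S_def)
  have z: "cpos (ip I v (app I X v) + s *\<^sub>R ip I v v)" for v
  proof (rule cpos_limit)
    fix e :: real assume e: "e > 0"
    obtain s' where s': "s' \<in> S" "s' < s + e"
      using cInf_lessD[of S "s + e"] ne e by (auto simp: s_def)
    then have "cpos ((ip I v (app I X v) + s' *\<^sub>R ip I v v) + (s + e - s') *\<^sub>R ip I v v)"
      by (intro cpos_add[OF _ cpos_scaleR[OF cpos_ip_self], of "ip I v (app I X v) + s' *\<^sub>R ip I v v"])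
        (simp_all add: S_def)
    then show "cpos (ip I v (app I X v) + s *\<^sub>R ip I v v + e *\<^sub>R ip I v v)"
      by (simp add: scaleR_add_left scaleR_diff_left add.assoc)
  qed
  have "s = 0"
  proof (rule ccontr)
    assume "s \<noteq> 0"
    then have s: "s > 0" using s0 by simp
    let ?Z = "add_diag X (s *\<^sub>R 1)"
    have form: "ip I v (app I ?Z v) = ip I v (app I X v) + s *\<^sub>R ip I v v" for v
    proof -
      have "ip I v (app I ?Z v) = ip I v (\<lambda>i. app I X v i + s *\<^sub>R v i)"
        by (rule ip_cong) (simp_all add: app_add_diag I)
      then show ?thesis by (simp add: ip_simps)
    qed
    have pZ: "pos_form I ?Z"
      unfolding pos_form_def form by (intro conjI allI z hermitian_add_diag herm) (simp add: star_scaleR)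
    obtain Y where Y: "\<And>v i. i \<in> I \<Longrightarrow> app I Y (app I ?Z v) i = v i" using inv[OF s] by blast
    obtain e where e: "e > 0" "\<And>v. cpos (ip I v (app I ?Z v) - e *\<^sub>R ip I v v)"
      by (rule strict_form_of_left_inverse[OF I pZ Y]) (simp, rule that)
    define e' where "e' = min e s"
    have "cpos (ip I v (app I X v) + (s - e') *\<^sub>R ip I v v)" for v
    proof -
      have "cpos ((ip I v (app I ?Z v) - e *\<^sub>R ip I v v) + (e - e') *\<^sub>R ip I v v)"
        by (intro cpos_add e cpos_scaleR cpos_ip_self) (simp add: e'_def)
      then show ?thesis unfolding form by (simp add: scaleR_diff_left add_diff_eq)
    qed
    then have "s - e' \<in> S" by (simp add: S_def e'_def)
    then have "s \<le> s - e'" unfolding s_def by (intro cInf_lower bdd)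
    then show False using s e(1) by (simp add: e'_def)
  qed
  then show ?thesis using z herm by (simp add: pos_form_def)
qed

text \<open>Let \<open>l = \<alpha> + i \<beta>\<close>.  The form of \<open>(X - l) (X - l)*\<close> is that of \<open>(X - \<alpha>)\<^sup>2 + \<beta>\<^sup>2\<close>, which is strictly
  positive if \<open>\<beta> \<noteq> 0\<close>, and also if \<open>\<beta> = 0\<close> and \<open>\<alpha> < 0\<close>, as then it exceeds \<open>\<alpha>\<^sup>2\<close>.  So
  \<open>(X - l) (X - l)*\<close> is onto, and a fortiori \<open>X - l\<close> is.\<close>

lemma pos_form_resolvent_surj:
  fixes X :: "'i \<Rightarrow> 'i \<Rightarrow> 'a::unital_cstar_algebra"
  assumes I: "finite I" and X: "pos_form I X" and l: "l \<notin> complex_of_real ` {0..}"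
  shows "\<exists>v. \<forall>i\<in>I. app I (add_diag X (- (l *\<^sub>C 1))) v i = w i"
proof -
  have herm: "hermitian I X" and pos: "\<And>v. cpos (ip I v (app I X v))"
    using X by (simp_all add: pos_form_def)
  define \<alpha> \<beta> where "\<alpha> = Re l" and "\<beta> = Im l"
  let ?Z = "add_diag X (- (l *\<^sub>C 1))" and ?Zs = "add_diag X (- (cnj l *\<^sub>C 1))"
  define N where "N i j = (\<Sum>k\<in>I. ?Z i k * ?Zs k j)" for i j
  have starZ: "star (?Z i j) = ?Zs j i" "star (?Zs i j) = ?Z j i" if "i \<in> I" "j \<in> I" for i j
    using herm that by (auto simp: hermitian_def add_diag_def star_simps star_scaleC)
  have hermN: "hermitian I N"
    unfolding hermitian_def N_def by (simp add: star_sum star_mult starZ)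
  have appN: "app I N v i = app I ?Z (app I ?Zs v) i" for v i
    unfolding app_def N_def sum_distrib_left sum_distrib_right mult.assoc by (rule sum.swap)
  have form: "ip I v (app I N v) = ip I (app I ?Zs v) (app I ?Zs v)" for v
  proof -
    have "ip I v (app I N v) = ip I v (app I ?Z (app I ?Zs v))"
      by (rule ip_cong) (simp_all add: appN)
    also have "\<dots> = ip I (app I ?Zs v) (app I ?Zs v)"
      unfolding ip_app_adjoint[of I v]
      by (rule ip_cong) (simp_all add: app_def starZ)
    finally show ?thesis .
  qed
  have form2:
    "ip I v (app I N v) = ip I (\<lambda>i. app I X v i - \<alpha> *\<^sub>R v i) (\<lambda>i. app I X v i - \<alpha> *\<^sub>R v i) + (\<beta> * \<beta>) *\<^sub>R ip I v v" for v
  proof -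
    let ?d = "\<lambda>i. app I X v i - \<alpha> *\<^sub>R v i"
    have cl: "cnj l *\<^sub>C x = \<alpha> *\<^sub>R x - \<beta> *\<^sub>R (\<i> *\<^sub>C x)" for x :: 'a
    proof -
      have "cnj l = complex_of_real \<alpha> - complex_of_real \<beta> * \<i>"
        by (simp add: complex_eq_iff \<alpha>_def \<beta>_def)
      then show ?thesis
        by (simp add: scaleC_diff_left scaleR_scaleC scaleC_scaleC)
    qed
    have z: "app I ?Zs v i = ?d i + \<beta> *\<^sub>R (\<i> *\<^sub>C v i)" if "i \<in> I" for i
      using I that by (simp add: app_add_diag mult_scaleC_left cl left_diff_distrib)
    have iv: "ip I u (\<lambda>i. \<i> *\<^sub>C x i) = \<i> *\<^sub>C ip I u x" for u x :: "'i \<Rightarrow> 'a"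
    proof -
      have "\<i> *\<^sub>C sum f J = (\<Sum>j\<in>J. \<i> *\<^sub>C f j)" for f :: "'i \<Rightarrow> 'a" and J
        by (induction J rule: infinite_finite_induct) (simp_all add: scaleC_add_right)
      then show ?thesis by (simp add: ip_def mult_scaleC_right)
    qed
    have vi: "ip I (\<lambda>i. \<i> *\<^sub>C x i) u = - (\<i> *\<^sub>C ip I x u)" for u x :: "'i \<Rightarrow> 'a"
      by (subst (1 2) star_ip[symmetric]) (simp add: iv star_scaleC scaleC_minus_left)
    have dv: "ip I ?d v = ip I v ?d"
      by (simp add: ip_simps ip_app_hermitian[OF herm])
    have "ip I v (app I N v) = ip I (\<lambda>i. ?d i + \<beta> *\<^sub>R (\<i> *\<^sub>C v i)) (\<lambda>i. ?d i + \<beta> *\<^sub>R (\<i> *\<^sub>C v i))"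
      unfolding form by (rule ip_cong) (simp_all add: z)
    also have "\<dots> = ip I ?d ?d + \<beta> *\<^sub>R (\<i> *\<^sub>C ip I ?d v) - \<beta> *\<^sub>R (\<i> *\<^sub>C ip I v ?d)
        - (\<beta> * \<beta>) *\<^sub>R (\<i> *\<^sub>C (\<i> *\<^sub>C ip I v v))"
      unfolding ip_add_left ip_add_right ip_scaleR_left ip_scaleR_right iv vi
      by (simp add: scaleC_minus_right)
    also have "\<dots> = ip I ?d ?d + (\<beta> * \<beta>) *\<^sub>R ip I v v"
      unfolding dv by (simp add: scaleC_scaleC scaleC_minus_left scaleC_minus_right scaleC_one)
    finally show ?thesis .
  qed
  have "\<exists>e>0. \<forall>v. cpos (ip I v (app I N v) - e *\<^sub>R ip I v v)"
  proof (cases "\<beta> = 0")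
    case False
    then have "\<beta> * \<beta> > 0" using not_real_square_gt_zero[of \<beta>] by blast
    then show ?thesis
      by (intro exI[of _ "\<beta> * \<beta>"]) (simp only: form2 cpos_ip_self add_diff_cancel_right' simp_thms)
  next
    case True
    then have "l = complex_of_real \<alpha>" by (simp add: complex_eq_iff \<alpha>_def \<beta>_def)
    then have \<alpha>: "\<alpha> < 0" using l by (metis atLeast_iff image_eqI not_le)
    have "cpos (ip I v (app I N v) - (\<alpha> * \<alpha>) *\<^sub>R ip I v v)" for v
    proof -
      let ?u = "app I X v"
      have "ip I v (app I N v) - (\<alpha> * \<alpha>) *\<^sub>R ip I v v = ip I ?u ?u + (2 * (- \<alpha>)) *\<^sub>R ip I v ?u"
      proof -
        have "2 * - \<alpha> = - \<alpha> + - \<alpha>" by simp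
        then have "(2 * (- \<alpha>)) *\<^sub>R ip I v ?u = - (\<alpha> *\<^sub>R ip I v ?u) - \<alpha> *\<^sub>R ip I v ?u"
          by (simp only: scaleR_add_left scaleR_minus_left diff_conv_add_uminus)
        then show ?thesis
          unfolding form2 ip_simps True ip_app_hermitian[OF herm, of v v]
          by (simp add: scaleR_diff_right)
      qed
      also have "cpos \<dots>" using \<alpha> by (intro cpos_add cpos_ip_self cpos_scaleR pos) simp
      finally show ?thesis .
    qed
    then show ?thesis using \<alpha> by (intro exI[of _ "\<alpha> * \<alpha>"]) (simp add: mult_neg_neg)
  qed
  then obtain e where e: "e > 0" "\<And>v. cpos (ip I v (app I N v) - e *\<^sub>R ip I v v)" by blast
  obtain v where "\<forall>i\<in>I. app I N v i = w i"
    using strictly_positive_surj[OF I hermN e] by blast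
  then show ?thesis unfolding appN by blast
qed

lemma pos_form_if_mat_pos:
  fixes X :: "'a::unital_cstar_algebra mat"
  assumes X: "X \<in> mat_pos n"
  shows "pos_form {..<n} (\<lambda>i j. X $$ (i, j))"
proof -
  have dim: "X \<in> carrier_mat n n" and st: "mat_star X = X" and sp: "mat_spectrum n X \<subseteq> complex_of_real ` {0..}"
    using X by (auto simp: mat_pos_def)
  let ?I = "{..<n}" and ?X = "\<lambda>i j. X $$ (i, j)"
  have herm: "hermitian ?I ?X"
    unfolding hermitian_def
  proof (intro ballI)
    fix i j assume ij: "i \<in> ?I" "j \<in> ?I"
    have "star (X $$ (i, j)) = mat_star X $$ (j, i)" using dim ij by (simp add: mat_star_def)
    then show "star (X $$ (i, j)) = X $$ (j, i)" by (simp add: st)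
  qed
  show ?thesis
  proof (rule pos_form_of_left_inverses[OF _ herm])
    fix s :: real assume s: "s > 0"
    let ?l = "complex_of_real (- s)"
    have "?l \<notin> complex_of_real ` {0..}" using s by (auto simp del: of_real_minus)
    then have "?l \<notin> mat_spectrum n X" using sp by blast
    then obtain Y where Y: "Y \<in> carrier_mat n n" "Y * (X - (?l *\<^sub>C 1) \<cdot>\<^sub>m 1\<^sub>m n) = 1\<^sub>m n"
      unfolding mat_spectrum_def by blast
    have l1: "- (?l *\<^sub>C 1) = s *\<^sub>R (1::'a)" by (simp add: scaleR_scaleC[symmetric] scaleC_minus_left)
    let ?Z = "add_diag ?X (s *\<^sub>R 1)"
    have YZ: "(\<Sum>k\<in>?I. Y $$ (i, k) * ?Z k j) = (if i = j then 1 else 0)" if ij: "i \<in> ?I" "j \<in> ?I" for i j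
    proof -
      have "(Y * (X - (?l *\<^sub>C 1) \<cdot>\<^sub>m 1\<^sub>m n)) $$ (i, j)
          = (\<Sum>k\<in>?I. Y $$ (i, k) * (X $$ (k, j) - (?l *\<^sub>C 1) * (if k = j then 1 else 0)))"
        using dim Y(1) ij by (simp add: scalar_prod_def lessThan_atLeast0)
      also have "\<dots> = (\<Sum>k\<in>?I. Y $$ (i, k) * ?Z k j)"
        by (rule sum.cong) (simp_all add: add_diag_def l1[symmetric])
      finally show ?thesis using ij by (simp only: Y(2)) simp
    qed
    have "app ?I (\<lambda>i j. Y $$ (i, j)) (app ?I ?Z v) i = v i" if "i \<in> ?I" for v i
    proof -
      have "app ?I (\<lambda>i j. Y $$ (i, j)) (app ?I ?Z v) i = (\<Sum>j\<in>?I. (\<Sum>k\<in>?I. Y $$ (i, k) * ?Z k j) * v j)"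
        unfolding app_def sum_distrib_left sum_distrib_right mult.assoc by (rule sum.swap)
      also have "\<dots> = (\<Sum>j\<in>?I. if j = i then v i else 0)"
        by (rule sum.cong) (use that in \<open>auto simp: YZ\<close>)
      finally show ?thesis using that by simp
    qed
    then show "\<exists>Y. \<forall>v. \<forall>i\<in>?I. app ?I Y (app ?I ?Z v) i = v i" by blast
  qed simp
qed

text \<open>Solving \<open>(X - l) v = w\<close> for the unit vectors \<open>w\<close> gives a right inverse of \<open>X - l\<close>.  The adjoint
  of a right inverse of \<open>X - cnj l\<close> is a left inverse of \<open>X - l\<close>, and the two coincide.\<close>

lemma mat_pos_if_pos_form:
  fixes X :: "'a::unital_cstar_algebra mat"
  assumes dim: "X \<in> carrier_mat n n" and X: "pos_form {..<n} (\<lambda>i j. X $$ (i, j))"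
  shows "X \<in> mat_pos n"
proof -
  let ?I = "{..<n}" and ?X = "\<lambda>i j. X $$ (i, j)"
  have herm: "star (X $$ (i, j)) = X $$ (j, i)" if "i < n" "j < n" for i j
    using X that by (simp add: pos_form_def hermitian_def)
  have st: "mat_star X = X"
    by (rule eq_matI) (use dim herm in \<open>auto simp: mat_star_def\<close>)
  have "l \<notin> mat_spectrum n X" if l: "l \<notin> complex_of_real ` {0..}" for l
  proof -
    let ?Z = "\<lambda>l. add_diag ?X (- (l *\<^sub>C 1))"
    let ?M = "\<lambda>l. X - (l *\<^sub>C 1) \<cdot>\<^sub>m 1\<^sub>m n"
    have right: "\<exists>Y. \<forall>i\<in>?I. \<forall>j\<in>?I. (\<Sum>k\<in>?I. ?Z l i k * Y k j) = (if i = j then 1 else 0)"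
      if l: "l \<notin> complex_of_real ` {0..}" for l
    proof -
      have "\<exists>v. \<forall>i\<in>?I. app ?I (?Z l) v i = (if i = j then 1 else 0)" for j
        using pos_form_resolvent_surj[OF _ X l] by simp
      then obtain Y where "\<And>j. \<forall>i\<in>?I. app ?I (?Z l) (Y j) i = (if i = j then 1 else 0)" by metis
      then show ?thesis by (intro exI[of _ "\<lambda>k j. Y j k"]) (simp add: app_def)
    qed
    have cl: "cnj l \<notin> complex_of_real ` {0..}"
      using l by (metis (no_types, lifting) complex_cnj_cnj complex_cnj_complex_of_real image_iff)
    obtain Y where Y: "\<And>i j. i < n \<Longrightarrow> j < n \<Longrightarrow> (\<Sum>k\<in>?I. ?Z l i k * Y k j) = (if i = j then 1 else 0)"
      using right[OF l] by auto
    obtain Y' where Y': "\<And>i j. i < n \<Longrightarrow> j < n \<Longrightarrow> (\<Sum>k\<in>?I. ?Z (cnj l) i k * Y' k j) = (if i = j then 1 else 0)"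
      using right[OF cl] by auto
    define W where "W i j = star (Y' j i)" for i j
    have starZ: "star (?Z (cnj l) i j) = ?Z l j i" if "i < n" "j < n" for i j
      using herm that by (simp add: add_diag_def star_simps star_scaleC)
    have W: "(\<Sum>k\<in>?I. W i k * ?Z l k j) = (if i = j then 1 else 0)" if "i < n" "j < n" for i j
    proof -
      have "(\<Sum>k\<in>?I. W i k * ?Z l k j) = star (\<Sum>k\<in>?I. ?Z (cnj l) j k * Y' k i)"
        unfolding star_sum by (rule sum.cong) (use that in \<open>simp_all add: W_def star_mult starZ\<close>)
      then show ?thesis using that by (simp add: Y')
    qed
    have WY: "W i j = Y i j" if ij: "i < n" "j < n" for i j
    proof -
      have "(\<Sum>k\<in>?I. W i k * (\<Sum>m\<in>?I. ?Z l k m * Y m j)) = (\<Sum>m\<in>?I. (\<Sum>k\<in>?I. W i k * ?Z l k m) * Y m j)"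
        unfolding sum_distrib_left sum_distrib_right mult.assoc by (rule sum.swap)
      moreover have "(\<Sum>k\<in>?I. W i k * (\<Sum>m\<in>?I. ?Z l k m * Y m j)) = (\<Sum>k\<in>?I. if k = j then W i j else 0)"
        by (rule sum.cong) (use ij in \<open>simp_all add: Y\<close>)
      moreover have "(\<Sum>m\<in>?I. (\<Sum>k\<in>?I. W i k * ?Z l k m) * Y m j) = (\<Sum>m\<in>?I. if m = i then Y i j else 0)"
        by (rule sum.cong) (use ij in \<open>auto simp: W\<close>)
      ultimately show ?thesis using ij by simp
    qed
    let ?Y = "mat n n (\<lambda>(i, j). Y i j)"
    have entry: "?M l $$ (i, j) = ?Z l i j" if "i < n" "j < n" for i j
      using dim that by (simp add: add_diag_def)
    have "?M l * ?Y = 1\<^sub>m n"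
    proof (rule eq_matI)
      fix i j assume "i < dim_row (1\<^sub>m n :: 'a mat)" "j < dim_col (1\<^sub>m n :: 'a mat)"
      then have ij: "i < n" "j < n" by simp_all
      have "(?M l * ?Y) $$ (i, j) = (\<Sum>k\<in>?I. ?M l $$ (i, k) * Y k j)"
        using dim ij by (simp add: scalar_prod_def lessThan_atLeast0)
      also have "\<dots> = (\<Sum>k\<in>?I. ?Z l i k * Y k j)"
        by (rule sum.cong) (use ij in \<open>simp_all only: entry lessThan_iff\<close>)
      finally show "(?M l * ?Y) $$ (i, j) = 1\<^sub>m n $$ (i, j)" using ij by (simp add: Y)
    qed (use dim in auto)
    moreover have "?Y * ?M l = 1\<^sub>m n"
    proof (rule eq_matI)
      fix i j assume "i < dim_row (1\<^sub>m n :: 'a mat)" "j < dim_col (1\<^sub>m n :: 'a mat)"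
      then have ij: "i < n" "j < n" by simp_all
      have "(?Y * ?M l) $$ (i, j) = (\<Sum>k\<in>?I. Y i k * ?M l $$ (k, j))"
        using dim ij by (simp add: scalar_prod_def lessThan_atLeast0)
      also have "\<dots> = (\<Sum>k\<in>?I. W i k * ?Z l k j)"
        by (rule sum.cong) (use ij in \<open>simp_all only: entry lessThan_iff WY\<close>)
      finally show "(?Y * ?M l) $$ (i, j) = 1\<^sub>m n $$ (i, j)" using ij by (simp add: W)
    qed (use dim in auto)
    ultimately show ?thesis unfolding mat_spectrum_def by (auto intro!: bexI[of _ ?Y])
  qed
  then have "mat_spectrum n X \<subseteq> complex_of_real ` {0..}" by blast
  then show ?thesis using dim st by (simp add: mat_pos_def)
qed

lemma mat_pos_iff:
  "X \<in> mat_pos n \<longleftrightarrow> X \<in> carrier_mat n n \<and> pos_form {..<n} (\<lambda>i j. X $$ (i, j))"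
proof -
  have "X \<in> mat_pos n \<Longrightarrow> X \<in> carrier_mat n n" by (simp add: mat_pos_def)
  then show ?thesis using pos_form_if_mat_pos mat_pos_if_pos_form by blast
qed

lemma pos_form_cong:
  assumes "\<And>i j. i \<in> I \<Longrightarrow> j \<in> I \<Longrightarrow> X i j = Y i j"
  shows "pos_form I X \<longleftrightarrow> pos_form I Y"
proof -
  have "app I X v i = app I Y v i" if "i \<in> I" for v i
    unfolding app_def by (rule sum.cong) (use assms that in auto)
  then have "ip I v (app I X v) = ip I v (app I Y v)" for v by (intro ip_cong) auto
  moreover have "hermitian I X \<longleftrightarrow> hermitian I Y" using assms by (simp add: hermitian_def)
  ultimately show ?thesis by (simp add: pos_form_def)
qed

section \<open>Positive operators and positive operator matrices\<close>

lemma bop_apply_sum: "bop_apply (\<Sum>i\<in>I. T i) x = (\<Sum>i\<in>I. bop_apply (T i) x)"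
  by (induction I rule: infinite_finite_induct) (simp_all add: bop_apply_simps zero_bop.rep_eq)

lemma cinner_sum_left: "cinner (\<Sum>i\<in>I. f i) y = (\<Sum>i\<in>I. cinner (f i) (y::'a::complex_inner))"
  by (induction I rule: infinite_finite_induct) (simp_all add: cinner_add_left)

lemma cinner_scaleR: "cinner (r *\<^sub>R x) y = of_real r * cinner x y" "cinner x (r *\<^sub>R y) = of_real r * cinner x (y::'a::complex_inner)"
  by (simp_all add: scaleR_scaleC cinner_scaleC_left cinner_scaleC_right)

text \<open>A self-adjoint operator with \<open>0 \<le> T \<le> R\<close> satisfies \<open>\<parallel>T x\<parallel>\<^sup>2 \<le> R \<langle>T x, x\<rangle>\<close>, which says that
  \<open>\<parallel>(R - T) x\<parallel> \<le> R \<parallel>x\<parallel>\<close>.\<close>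

lemma cpos_bop_iff:
  fixes T :: "'h::chilbert_space bop"
  shows "cpos T \<longleftrightarrow> star T = T \<and> (\<forall>x. 0 \<le> Re (cinner (bop_apply T x) x))"
proof
  assume T: "cpos T"
  have "0 \<le> Re (cinner (bop_apply T x) x)" for x
  proof (rule field_le_epsilon)
    fix e :: real assume e: "e > 0"
    define d where "d = e / ((norm x)\<^sup>2 + 1)"
    have d: "d > 0" using e by (simp add: d_def add_nonneg_pos)
    obtain c where c: "star c = c" "c * c = T + d *\<^sub>R 1"
      by (rule cpos_sqrt[OF T d]) (rule that)
    have "Re (cinner (bop_apply (c * c) x) x) = (norm (bop_apply c x))\<^sup>2"
      by (simp add: bop_apply_simps star_bop[of c] c(1) cinner_self flip: of_real_power)
    then have "0 \<le> Re (cinner (bop_apply (T + d *\<^sub>R 1) x) x)" by (simp add: c(2))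
    also have "\<dots> = Re (cinner (bop_apply T x) x) + d * (norm x)\<^sup>2"
      by (simp add: bop_apply_simps one_bop.rep_eq cinner_add_left cinner_scaleR cinner_self flip: of_real_power of_real_mult)
    also have "d * (norm x)\<^sup>2 \<le> e"
    proof -
      have "e * (norm x)\<^sup>2 \<le> e * ((norm x)\<^sup>2 + 1)" using e by (intro mult_left_mono) auto
      then show ?thesis using zero_le_power2[of "norm x"] by (simp add: d_def divide_le_eq add_nonneg_pos)
    qed
    finally show "0 \<le> Re (cinner (bop_apply T x) x) + e" by simp
  qed
  then show "star T = T \<and> (\<forall>x. 0 \<le> Re (cinner (bop_apply T x) x))" using cpos_star[OF T] by blast
next
  assume T: "star T = T \<and> (\<forall>x. 0 \<le> Re (cinner (bop_apply T x) x))"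
  let ?R = "norm T"
  let ?A = "bop_apply T"
  have sym: "cinner (?A x) y = cinner x (?A y)" for x y using T star_bop[of T x y] by simp
  have upper: "Re (cinner (?A x) x) \<le> ?R * (norm x)\<^sup>2" for x
  proof -
    have "Re (cinner (?A x) x) \<le> norm (?A x) * norm x"
      using complex_Re_le_cmod cinner_Cauchy_Schwarz order_trans by blast
    also have "\<dots> \<le> (?R * norm x) * norm x" by (intro mult_right_mono norm_bop_apply) simp
    finally show ?thesis by (simp add: power2_eq_square mult.assoc)
  qed
  have sq: "(norm (?A x))\<^sup>2 \<le> ?R * Re (cinner (?A x) x)" for x
  proof (cases "?R = 0")
    case True
    then have "?A x = 0" using norm_bop_apply[of T x] by simp
    then show ?thesis by simp
  next
    case False
    then have R: "?R > 0" by simp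
    let ?w = "?A x" let ?d = "?R *\<^sub>R x - ?w"
    have "0 \<le> Re (cinner (?A ?d) ?d) + (?R * (norm ?w)\<^sup>2 - Re (cinner (?A ?w) ?w))"
      using T upper[of ?w] by (simp add: add_nonneg_nonneg)
    also have "Re (cinner (?A ?d) ?d) = ?R * (?R * Re (cinner ?w x)) - 2 * (?R * (norm ?w)\<^sup>2) + Re (cinner (?A ?w) ?w)"
    proof -
      have ad: "?A ?d = ?R *\<^sub>R ?w - ?A ?w" by (simp add: blinfun.diff_right blinfun.scaleR_right)
      have "cinner (?A ?w) x = cinner ?w ?w" by (rule sym)
      then show ?thesis
        unfolding ad cinner_diff_left cinner_diff_right cinner_scaleR
        by (simp add: cinner_self algebra_simps flip: of_real_power)
    qed
    finally have "0 \<le> ?R * (?R * Re (cinner ?w x) - (norm ?w)\<^sup>2)" by (simp add: algebra_simps)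
    then show ?thesis using R by (simp add: zero_le_mult_iff)
  qed
  show "cpos T"
  proof (rule cposI)
    show "star T = T" using T by simp
    show "norm (?R *\<^sub>R 1 - T) \<le> ?R"
    proof (rule norm_bop_bound)
      fix x
      have "(norm (bop_apply (?R *\<^sub>R 1 - T) x))\<^sup>2 = (norm (?R *\<^sub>R x + - ?A x))\<^sup>2"
        by (simp add: bop_apply_simps one_bop.rep_eq)
      also have "\<dots> = (?R * norm x)\<^sup>2 + (norm (?A x))\<^sup>2 - 2 * (?R * Re (cinner (?A x) x))"
      proof -
        have "cinner (?R *\<^sub>R x) (- ?A x) = - (of_real ?R * cinner x (?A x))"
          by (metis cinner_commute cinner_minus_left cinner_scaleR(1) complex_cnj_minus mult_minus_right)
        then show ?thesis
          unfolding norm_add_sq[of "?R *\<^sub>R x" "- ?A x"] using sym[of x x] by (simp add: power_mult_distrib)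
      qed
      also have "\<dots> \<le> (?R * norm x)\<^sup>2"
      proof -
        have "?R * Re (cinner (?A x) x) \<ge> 0" using T by simp
        then show ?thesis using sq[of x] by linarith
      qed
      finally show "norm (bop_apply (?R *\<^sub>R 1 - T) x) \<le> ?R * norm x" by (rule power2_le_imp_le) simp
    qed simp
  qed
qed

lemma exists_bop_mapping:
  fixes e x :: "'h::chilbert_space"
  assumes e: "e \<noteq> 0"
  shows "\<exists>T. bop_apply T e = x"
proof -
  define f where "f y = cinner y e *\<^sub>C x" for y
  have "bounded_linear f"
  proof (rule bounded_linear_intro[where K = "norm e * norm x"])
    fix y
    have "cmod (cinner y e) * norm x \<le> (norm y * norm e) * norm x"
      by (intro mult_right_mono cinner_Cauchy_Schwarz) simp
    then show "norm (f y) \<le> norm y * (norm e * norm x)" by (simp add: f_def norm_scaleC mult.assoc)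
  qed (simp_all add: f_def cinner_add_left scaleC_add_left cinner_scaleR scaleR_scaleC cinner_scaleC_left scaleC_scaleC)
  moreover have "f (c *\<^sub>C y) = c *\<^sub>C f y" for c y by (simp add: f_def cinner_scaleC_left scaleC_scaleC)
  ultimately have F: "bop_apply (Bop (Blinfun f)) = f"
    by (subst Bop_inverse) (simp_all add: bounded_linear_Blinfun_apply)
  have "bop_apply (inverse (cinner e e) *\<^sub>C Bop (Blinfun f)) e = x"
    using e by (simp add: bop_apply_simps F f_def scaleC_scaleC scaleC_one cinner_self)
  then show ?thesis by blast
qed

text \<open>The vectors of operators in the definition of a positive form can be replaced by vectors in
  the Hilbert space, because every tuple \<open>(x\<^sub>i)\<close> is the image of a single nonzero vector under
  a tuple of operators.\<close>

lemma pos_form_bop_iff: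
  fixes X :: "'i \<Rightarrow> 'i \<Rightarrow> 'h::chilbert_space bop"
  shows "pos_form I X \<longleftrightarrow> hermitian I X \<and>
    (\<forall>x. 0 \<le> Re (\<Sum>i\<in>I. \<Sum>j\<in>I. cinner (bop_apply (X i j) (x j)) (x i)))"
proof -
  have form: "cinner (bop_apply (ip I v (app I X v)) y) y
      = (\<Sum>i\<in>I. \<Sum>j\<in>I. cinner (bop_apply (X i j) (bop_apply (v j) y)) (bop_apply (v i) y))" for v y
    unfolding ip_app_double_sum
    by (simp add: bop_apply_sum cinner_sum_left bop_apply_simps star_bop star_star)
  show ?thesis
  proof
    assume X: "pos_form I X"
    have "0 \<le> Re (\<Sum>i\<in>I. \<Sum>j\<in>I. cinner (bop_apply (X i j) (x j)) (x i))" for x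
    proof (cases "\<exists>e::'h. e \<noteq> 0")
      case True
      then obtain e :: 'h where "e \<noteq> 0" by blast
      then have "\<forall>i. \<exists>T. bop_apply T e = x i" by (intro allI exists_bop_mapping)
      from choice[OF this] obtain v where v: "\<And>i. bop_apply (v i) e = x i" by blast
      have "cpos (ip I v (app I X v))" using X by (simp add: pos_form_def)
      then have "0 \<le> Re (cinner (bop_apply (ip I v (app I X v)) e) e)" by (simp add: cpos_bop_iff)
      then show ?thesis by (simp only: form v)
    next
      case False
      then have "x i = 0" for i by blast
      then have "cinner y (x i) = 0" for y i by (subst cinner_commute) simp
      then show ?thesis by simp
    qed
    then show "hermitian I X \<and> (\<forall>x. 0 \<le> Re (\<Sum>i\<in>I. \<Sum>j\<in>I. cinner (bop_apply (X i j) (x j)) (x i)))"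
      using X by (simp add: pos_form_def)
  next
    assume X: "hermitian I X \<and> (\<forall>x. 0 \<le> Re (\<Sum>i\<in>I. \<Sum>j\<in>I. cinner (bop_apply (X i j) (x j)) (x i)))"
    have "cpos (ip I v (app I X v))" for v
    proof -
      have "star (ip I v (app I X v)) = ip I v (app I X v)"
        using X by (simp add: star_ip ip_app_hermitian)
      then show ?thesis using X unfolding cpos_bop_iff form by simp
    qed
    then show "pos_form I X" using X by (simp add: pos_form_def)
  qed
qed

section \<open>Extension of positive functionals\<close>

text \<open>The extension theorem of M. Riesz.  Partially defined functionals are represented by their graphs,
  so that linearity is a subspace condition.  Nonnegativity on the cone makes such a subspace
  single-valued, since \<open>(0, r)\<close> and \<open>(0, - r)\<close> give \<open>r = 0\<close>.  A maximal graph
  is defined on all of \<open>E\<close>: at a new vector \<open>v0\<close> any value between the values at the smaller and those at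
  the larger vectors of the domain is admissible.\<close>

theorem riesz_extension:
  fixes K E :: "'v::real_vector set" and G :: "('v \<times> real) set"
  assumes G: "subspace G" and E: "subspace E"
    and K_add: "\<And>u v. u \<in> K \<Longrightarrow> v \<in> K \<Longrightarrow> u + v \<in> K"
    and K_scale: "\<And>r v. r \<ge> 0 \<Longrightarrow> v \<in> K \<Longrightarrow> r *\<^sub>R v \<in> K"
    and pos: "\<And>v r. (v, r) \<in> G \<Longrightarrow> v \<in> K \<Longrightarrow> r \<ge> 0"
    and dom: "\<And>v. v \<in> E \<Longrightarrow> \<exists>w r. (w, r) \<in> G \<and> w - v \<in> K"
  obtains f where "\<And>u v. u \<in> E \<Longrightarrow> v \<in> E \<Longrightarrow> f (u + v) = f u + f v"
    "\<And>r v. v \<in> E \<Longrightarrow> f (r *\<^sub>R v) = r * f v"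
    "\<And>v r. v \<in> E \<Longrightarrow> (v, r) \<in> G \<Longrightarrow> f v = r"
    "\<And>v. v \<in> E \<Longrightarrow> v \<in> K \<Longrightarrow> f v \<ge> 0"
proof -
  define \<A> where "\<A> = {H. subspace H \<and> G \<subseteq> H \<and> (\<forall>v r. (v, r) \<in> H \<longrightarrow> v \<in> K \<longrightarrow> r \<ge> 0)}"
  have "\<exists>M\<in>\<A>. \<forall>X\<in>\<A>. M \<subseteq> X \<longrightarrow> X = M"
  proof (rule subset_Zorn_nonempty)
    show "\<A> \<noteq> {}" using G pos by (auto simp: \<A>_def)
    fix \<C> assume ne: "\<C> \<noteq> {}" and ch: "subset.chain \<A> \<C>"
    have sub: "H \<in> \<A>" if "H \<in> \<C>" for H using ch that by (auto simp: subset.chain_def)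
    have "subspace (\<Union>\<C>)"
      unfolding subspace_def
    proof (intro conjI ballI allI)
      show "0 \<in> \<Union>\<C>" using ne sub by (auto simp: \<A>_def subspace_def)
      fix p q assume "p \<in> \<Union>\<C>" "q \<in> \<Union>\<C>"
      then obtain P Q where "P \<in> \<C>" "p \<in> P" "Q \<in> \<C>" "q \<in> Q" by blast
      moreover have "P \<subseteq> Q \<or> Q \<subseteq> P" using ch \<open>P \<in> \<C>\<close> \<open>Q \<in> \<C>\<close> by (auto simp: subset.chain_def)
      ultimately obtain H where "H \<in> \<C>" "p \<in> H" "q \<in> H" by blast
      then show "p + q \<in> \<Union>\<C>" using sub[of H] by (auto simp: \<A>_def subspace_def)
    next
      fix c p assume "p \<in> \<Union>\<C>"
      then obtain H where "H \<in> \<C>" "p \<in> H" by blast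
      then have "c *\<^sub>R p \<in> H" using sub[of H] by (simp add: \<A>_def subspace_scale)
      then show "c *\<^sub>R p \<in> \<Union>\<C>" using \<open>H \<in> \<C>\<close> by blast
    qed
    moreover have "G \<subseteq> \<Union>\<C>" using ne sub by (auto simp: \<A>_def)
    moreover have "\<forall>v r. (v, r) \<in> \<Union>\<C> \<longrightarrow> v \<in> K \<longrightarrow> r \<ge> 0" using sub by (auto simp: \<A>_def)
    ultimately show "\<Union>\<C> \<in> \<A>" by (simp add: \<A>_def)
  qed
  then obtain M where M: "M \<in> \<A>" and max: "\<And>X. X \<in> \<A> \<Longrightarrow> M \<subseteq> X \<Longrightarrow> X = M" by blast
  have sM: "subspace M" and GM: "G \<subseteq> M" and posM: "\<And>v r. (v, r) \<in> M \<Longrightarrow> v \<in> K \<Longrightarrow> r \<ge> 0"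
    using M by (auto simp: \<A>_def)
  have M_scale: "(c *\<^sub>R v, c * r) \<in> M" if "(v, r) \<in> M" for c v r
    using subspace_scale[OF sM that, of c] by simp
  have M_add: "(u + v, q + r) \<in> M" if "(u, q) \<in> M" "(v, r) \<in> M" for u v q r
    using subspace_add[OF sM that] by simp
  have M_diff: "(u - v, q - r) \<in> M" if "(u, q) \<in> M" "(v, r) \<in> M" for u v q r
    using subspace_diff[OF sM that] by simp
  have zero: "r = 0" if "(0, r) \<in> M" for r
  proof -
    obtain w q where w: "(w, q) \<in> G" "w - 0 \<in> K" using dom[OF subspace_0[OF E]] by blast
    have "0 \<in> K" using K_scale[OF order_refl w(2)] by simp
    then show ?thesis using posM[OF that] posM[of 0 "- r"] M_scale[OF that, of "- 1"] by auto
  qed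
  have total: "\<exists>c. (v0, c) \<in> M" if v0: "v0 \<in> E" for v0
  proof -
    define L where "L = {r. \<exists>v. (v, r) \<in> M \<and> v0 - v \<in> K}"
    define U where "U = {r. \<exists>v. (v, r) \<in> M \<and> v - v0 \<in> K}"
    obtain u where u: "u \<in> U" using dom[OF v0] GM by (auto simp: U_def)
    obtain w r where "(w, r) \<in> G" "w - (- v0) \<in> K" using dom[OF subspace_neg[OF E v0]] by blast
    then have "- r \<in> L"
      using M_scale[of w r "- 1"] GM by (auto simp: L_def intro!: exI[of _ "- w"] simp: add.commute)
    moreover have LU: "l \<le> u" if "l \<in> L" "u \<in> U" for l u
    proof -
      obtain v v' where v: "(v, l) \<in> M" "v0 - v \<in> K" "(v', u) \<in> M" "v' - v0 \<in> K"
        using \<open>l \<in> L\<close> \<open>u \<in> U\<close> by (auto simp: L_def U_def)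
      have "(v' - v0) + (v0 - v) \<in> K" using v by (intro K_add)
      then have "u - l \<ge> 0" using v by (intro posM[OF M_diff]) auto
      then show ?thesis by simp
    qed
    define c where "c = Sup L"
    have Lc: "l \<le> c" if "l \<in> L" for l
      unfolding c_def by (rule cSup_upper[OF that], rule bdd_aboveI[of _ u], rule LU[OF _ u])
    have cU: "c \<le> u" if "u \<in> U" for u
      unfolding c_def by (rule cSup_least) (use LU that \<open>- r \<in> L\<close> in auto)
    define M' where "M' = span (insert (v0, c) M)"
    have "r \<ge> 0" if vr: "(v, r) \<in> M'" and vK: "v \<in> K" for v r
    proof -
      have "span M = M" using sM by (simp add: span_eq_iff)
      then obtain t where t: "(v - t *\<^sub>R v0, r - t * c) \<in> M"
        using vr unfolding M'_def span_insert \<open>span M = M\<close> by auto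
      consider "t = 0" | "t > 0" | "t < 0" by linarith
      then show ?thesis
      proof cases
        case 1
        then show ?thesis using t posM[OF _ vK] by simp
      next
        case 2
        have "(1 / t) *\<^sub>R v \<in> K" using 2 vK by (intro K_scale) auto
        moreover have "v0 - (- 1 / t) *\<^sub>R (v - t *\<^sub>R v0) = (1 / t) *\<^sub>R v"
          using 2 by (simp add: scaleR_diff_right)
        ultimately have "(- 1 / t) * (r - t * c) \<in> L"
          using M_scale[OF t, of "- 1 / t"] unfolding L_def by fastforce
        then have "(- 1 / t) * (r - t * c) \<le> c" by (rule Lc)
        then show ?thesis using 2 by (simp add: field_simps)
      next
        case 3
        have "(- 1 / t) *\<^sub>R v \<in> K" using 3 vK by (intro K_scale) (auto simp: divide_nonpos_neg)
        moreover have "(- 1 / t) *\<^sub>R (v - t *\<^sub>R v0) - v0 = (- 1 / t) *\<^sub>R v"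
          using 3 by (simp add: scaleR_diff_right)
        ultimately have "(- 1 / t) * (r - t * c) \<in> U"
          using M_scale[OF t, of "- 1 / t"] unfolding U_def by fastforce
        then have "c \<le> (- 1 / t) * (r - t * c)" by (rule cU)
        then show ?thesis using 3 by (simp add: field_simps)
      qed
    qed
    moreover have "M \<subseteq> M'" "(v0, c) \<in> M'" unfolding M'_def by (auto intro: span_base)
    ultimately have "M' \<in> \<A>" using GM by (auto simp: \<A>_def M'_def)
    then have "M' = M" using \<open>M \<subseteq> M'\<close> by (rule max)
    then show ?thesis using \<open>(v0, c) \<in> M'\<close> by blast
  qed
  have single: "q = r" if "(v, q) \<in> M" "(v, r) \<in> M" for v q r
    using zero[of "q - r"] M_diff[OF that] by simp
  define f where "f v = (THE r. (v, r) \<in> M)" for v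
  have f_eq: "f v = r" if "(v, r) \<in> M" for v r
    unfolding f_def using that single by (intro the_equality) auto
  have f_in: "(v, f v) \<in> M" if "v \<in> E" for v using total[OF that] f_eq by blast
  show ?thesis
  proof (rule that[of f])
    show "f (u + v) = f u + f v" if "u \<in> E" "v \<in> E" for u v
      by (intro f_eq M_add f_in that)
    show "f (r *\<^sub>R v) = r * f v" if "v \<in> E" for r v
      by (intro f_eq M_scale f_in that)
    show "f v = r" if "v \<in> E" "(v, r) \<in> G" for v r
      using that GM by (intro f_eq) auto
    show "f v \<ge> 0" if "v \<in> E" "v \<in> K" for v
      using posM f_in that by blast
  qed
qed

section \<open>Function spaces, coordinates and sesquilinear forms\<close>

instantiation "fun" :: (type, scaleR) scaleR
begin

definition scaleR_fun :: "real \<Rightarrow> ('a \<Rightarrow> 'b) \<Rightarrow> 'a \<Rightarrow> 'b" where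
  "scaleR_fun r f = (\<lambda>x. r *\<^sub>R f x)"

instance ..

end

instance "fun" :: (type, real_vector) real_vector
  by standard (simp_all add: scaleR_fun_def fun_eq_iff scaleR_add_right scaleR_add_left)

text \<open>Coordinates with respect to a Hamel basis, indexed by all vectors; those that are not in the basis
  get coordinate \<open>0\<close>.  An orthonormal basis would not do, as only finite sums are available
  for the matrices below.\<close>

lemma hamel_coordinates:
  obtains rep :: "'h::complex_vector \<Rightarrow> 'h \<Rightarrow> complex" where
    "\<And>x. finite {b. rep x b \<noteq> 0}"
    "\<And>x y b. rep (x + y) b = rep x b + rep y b"
    "\<And>c x b. rep (c *\<^sub>C x) b = c * rep x b"
    "\<And>x. (\<Sum>b | rep x b \<noteq> 0. rep x b *\<^sub>C b) = x"
proof -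
  interpret V: vector_space "scaleC :: complex \<Rightarrow> 'h \<Rightarrow> 'h"
    by unfold_locales (rule scaleC_add_right scaleC_add_left scaleC_scaleC scaleC_one)+
  define B where "B = V.extend_basis {}"
  have B: "V.independent B" "V.span B = UNIV"
    unfolding B_def by (simp_all add: V.independent_extend_basis V.span_extend_basis V.independent_empty)
  show ?thesis
    using B by (intro that[of "V.representation B"])
      (simp_all add: V.finite_representation V.representation_add V.representation_scale
        V.sum_nonzero_representation_eq)
qed

lemma bop_eqI_cinner: "S = T" if "\<And>x y. cinner (bop_apply S x) y = cinner (bop_apply T x) (y::'h::chilbert_space)"
  by (rule bop_eqI, rule cinner_right_eqI, subst (1 2) cinner_commute) (simp add: that)

lemma bop_of_sesquilinear:
  fixes s :: "'h::chilbert_space \<Rightarrow> 'h \<Rightarrow> complex"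
  assumes add_left: "\<And>x x' y. s (x + x') y = s x y + s x' y"
    and scale_left: "\<And>c x y. s (c *\<^sub>C x) y = c * s x y"
    and add_right: "\<And>x y y'. s x (y + y') = s x y + s x y'"
    and scale_right: "\<And>c x y. s x (c *\<^sub>C y) = cnj c * s x y"
    and bound: "\<And>x y. cmod (s x y) \<le> C * norm x * norm y"
    and C: "C \<ge> 0"
  shows "\<exists>T. norm T \<le> C \<and> (\<forall>x y. cinner (bop_apply T x) y = s x y)"
proof -
  have "\<exists>z. \<forall>y. cnj (s x y) = cinner y z" for x
    by (rule riesz_representation[where K = "C * norm x"]) (simp_all add: add_right scale_right bound)
  then obtain z where z: "\<And>x y. cnj (s x y) = cinner y (z x)" by metis
  have zs: "cinner (z x) y = s x y" for x y
    by (subst cinner_commute) (simp add: z[symmetric])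
  have z_add: "z (x + x') = z x + z x'" for x x'
    by (rule cinner_right_eqI) (simp add: z[symmetric] add_left cinner_add_right)
  have z_scale: "z (c *\<^sub>C x) = c *\<^sub>C z x" for c x
    by (rule cinner_right_eqI) (simp add: z[symmetric] scale_left cinner_scaleC_right)
  have z_bound: "norm (z x) \<le> C * norm x" for x
  proof (cases "z x = 0")
    case False
    have "norm (z x) * norm (z x) = cmod (s x (z x))"
      by (simp add: zs[symmetric] cinner_self norm_mult power2_eq_square)
    also have "\<dots> \<le> (C * norm x) * norm (z x)" by (rule bound)
    finally show ?thesis using False by simp
  qed (simp add: C)
  have bl: "bounded_linear z"
    by (rule bounded_linear_intro[where K = C])
      (simp_all add: z_add scaleR_scaleC z_scale z_bound mult.commute)
  then have T: "bop_apply (Bop (Blinfun z)) = z"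
    using z_scale by (subst Bop_inverse) (simp_all add: bounded_linear_Blinfun_apply)
  show ?thesis
    by (intro exI[of _ "Bop (Blinfun z)"] conjI allI norm_bop_bound) (simp_all add: T zs C z_bound)
qed

section \<open>The ordered space of finite matrices\<close>

text \<open>A family of matrices \<open>X\<^sub>1, \<dots>, X\<^sub>m\<close> over the algebra, which is one finite matrix over its \<open>m\<close>-fold
  direct sum.  With rows and columns indexed by the vectors of a Hilbert space it stands for the sum
  of the elements \<open>X\<^sub>k(b, c)\<close> tensored with the rank-one operators \<open>x \<mapsto> \<langle>x, b\<rangle> c\<close>.\<close>

type_synonym ('b, 'a) mats = "nat \<times> 'b \<times> 'b \<Rightarrow> 'a"

definition slice :: "('b, 'a) mats \<Rightarrow> nat \<Rightarrow> 'b \<Rightarrow> 'b \<Rightarrow> 'a" where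
  "slice X k b c = X (k, b, c)"

definition supported :: "nat \<Rightarrow> 'b set \<Rightarrow> ('b, 'a::unital_cstar_algebra) mats \<Rightarrow> bool" where
  "supported m B X \<longleftrightarrow> (\<forall>k b c. X (k, b, c) \<noteq> 0 \<longrightarrow> k \<in> {1..m} \<and> b \<in> B \<and> c \<in> B)"

definition fin_mats :: "nat \<Rightarrow> ('b, 'a::unital_cstar_algebra) mats set" where
  "fin_mats m = {X. \<exists>B. finite B \<and> supported m B X}"

definition qf :: "'b set \<Rightarrow> ('b \<Rightarrow> 'a) \<Rightarrow> nat \<Rightarrow> ('b, 'a::unital_cstar_algebra) mats \<Rightarrow> 'a" where
  "qf J v k X = ip J v (app J (slice X k) v)"

text \<open>The cone consists of the families whose Hermitian parts are positive.  Since it contains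
  every skew-Hermitian family together with its negative, a linear functional that is nonnegative on
  it vanishes at skew-Hermitian families.\<close>

definition mats_cone :: "nat \<Rightarrow> ('b, 'a::unital_cstar_algebra) mats set" where
  "mats_cone m = {X. \<forall>k\<in>{1..m}. \<forall>J v. finite J \<longrightarrow> cpos (qf J v k X + star (qf J v k X))}"

lemma mats_coneI:
  "(\<And>k J v. k \<in> {1..m} \<Longrightarrow> finite J \<Longrightarrow> cpos (qf J v k X + star (qf J v k X))) \<Longrightarrow> X \<in> mats_cone m"
  by (simp add: mats_cone_def)

lemma qf_double_sum: "qf J v k X = (\<Sum>b\<in>J. \<Sum>c\<in>J. star (v b) * X (k, b, c) * v c)"
  by (simp add: qf_def ip_app_double_sum slice_def)

lemma qf_add: "qf J v k (X + Y) = qf J v k X + qf J v k Y"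
  by (simp add: qf_double_sum distrib_left distrib_right sum.distrib)

lemma qf_diff: "qf J v k (X - Y) = qf J v k X - qf J v k Y"
  by (simp add: qf_double_sum left_diff_distrib right_diff_distrib sum_subtractf)

lemma qf_scaleR: "qf J v k (r *\<^sub>R X) = r *\<^sub>R qf J v k X"
  by (simp add: qf_double_sum scaleR_fun_def scaleR_sum_right)

lemma qf_zero: "qf J v k 0 = 0"
  by (simp add: qf_double_sum)

lemma qf_sum: "qf J v k (\<Sum>i\<in>I. X i) = (\<Sum>i\<in>I. qf J v k (X i))"
proof (induction I rule: infinite_finite_induct)
  case (insert i I)
  show ?case unfolding sum.insert[OF insert.hyps] qf_add insert.IH ..
qed (simp_all only: sum.infinite sum.empty qf_zero not_False_eq_True)

lemma subspace_fin_mats: "subspace (fin_mats m :: ('b, 'a::unital_cstar_algebra) mats set)"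
  unfolding subspace_def
proof (intro conjI ballI allI)
  show "0 \<in> (fin_mats m :: ('b, 'a) mats set)" by (auto simp: fin_mats_def supported_def)
  fix X Y :: "('b, 'a) mats" assume "X \<in> fin_mats m" "Y \<in> fin_mats m"
  then obtain B B' where B: "finite B" "supported m B X" "finite B'" "supported m B' Y"
    by (auto simp: fin_mats_def)
  then have "supported m (B \<union> B') (X + Y)" unfolding supported_def by (metis UnCI add_0 plus_fun_apply)
  then show "X + Y \<in> fin_mats m" using B unfolding fin_mats_def by blast
next
  fix r and X :: "('b, 'a) mats" assume "X \<in> fin_mats m"
  then show "r *\<^sub>R X \<in> fin_mats m" by (auto simp: fin_mats_def supported_def scaleR_fun_def)
qed

lemma mats_cone_add:
  fixes X Y :: "('b, 'a::unital_cstar_algebra) mats"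
  assumes "X \<in> mats_cone m" "Y \<in> mats_cone m"
  shows "X + Y \<in> mats_cone m"
proof (rule mats_coneI)
  fix k and J :: "'b set" and v :: "'b \<Rightarrow> 'a"
  assume "k \<in> {1..m}" "finite J"
  then have "cpos ((qf J v k X + star (qf J v k X)) + (qf J v k Y + star (qf J v k Y)))"
    using assms by (intro cpos_add[of "_ + _" "_ + _"]) (simp_all add: mats_cone_def)
  then show "cpos (qf J v k (X + Y) + star (qf J v k (X + Y)))"
    unfolding qf_add star_add by (simp add: ac_simps)
qed

lemma mats_cone_scale:
  fixes X :: "('b, 'a::unital_cstar_algebra) mats"
  assumes "r \<ge> 0" "X \<in> mats_cone m" shows "r *\<^sub>R X \<in> mats_cone m"
proof (rule mats_coneI)
  fix k and J :: "'b set" and v :: "'b \<Rightarrow> 'a"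
  assume "k \<in> {1..m}" "finite J"
  then have "cpos (r *\<^sub>R (qf J v k X + star (qf J v k X)))"
    using assms by (intro cpos_scaleR) (simp_all add: mats_cone_def)
  then show "cpos (qf J v k (r *\<^sub>R X) + star (qf J v k (r *\<^sub>R X)))"
    unfolding qf_scaleR star_scaleR by (simp add: scaleR_add_right)
qed

lemma qf_support:
  assumes B: "finite B" "supported m B X" and J: "finite J"
  shows "qf J v k X = qf B (\<lambda>b. if b \<in> J then v b else 0) k X"
proof -
  let ?w = "\<lambda>b. if b \<in> J then v b else 0"
  have z: "X (k, b, c) = 0" if "b \<notin> B \<or> c \<notin> B" for b c
    using B(2) that unfolding supported_def by blast
  have "qf J v k X = (\<Sum>b\<in>J. \<Sum>c\<in>J \<union> B. star (?w b) * X (k, b, c) * ?w c)"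
    unfolding qf_double_sum by (intro sum.cong refl sum.mono_neutral_cong_left) (use B J in auto)
  also have "\<dots> = (\<Sum>b\<in>J \<union> B. \<Sum>c\<in>J \<union> B. star (?w b) * X (k, b, c) * ?w c)"
    by (intro sum.mono_neutral_left) (use B J in auto)
  also have "\<dots> = (\<Sum>b\<in>B. \<Sum>c\<in>J \<union> B. star (?w b) * X (k, b, c) * ?w c)"
    by (intro sum.mono_neutral_right) (use B J z in auto)
  also have "\<dots> = qf B ?w k X"
    unfolding qf_double_sum by (intro sum.cong refl sum.mono_neutral_right) (use B J z in auto)
  finally show ?thesis .
qed

section \<open>The functional of a map\<close>

text \<open>If \<open>\<theta> = \<Sum>\<^sub>k \<psi>\<^sub>k \<circ> \<phi>\<^sub>k\<close>, then the functional \<open>X \<mapsto> \<Sum>\<^sub>k \<Sum>\<^bsub>b,c\<^esub> \<langle>\<psi>\<^sub>k (X\<^sub>k(b, c)) c, b\<rangle>\<close> takes the value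
  \<open>pairing \<theta> B a\<close> at the family \<open>image_mats m \<phi> a\<close> of a matrix \<open>a\<close> that vanishes off \<open>B\<close>.  This dictates the
  functional that has to be extended.\<close>

definition image_mats :: "nat \<Rightarrow> (nat \<Rightarrow> 'a \<Rightarrow> 'a) \<Rightarrow> ('b \<Rightarrow> 'b \<Rightarrow> 'a::unital_cstar_algebra) \<Rightarrow> ('b, 'a) mats" where
  "image_mats m \<phi> a = (\<lambda>(k, b, c). if k \<in> {1..m} then \<phi> k (a b c) else 0)"

definition pairing :: "('a::unital_cstar_algebra \<Rightarrow> 'h::chilbert_space bop) \<Rightarrow> 'h set \<Rightarrow> ('h \<Rightarrow> 'h \<Rightarrow> 'a) \<Rightarrow> complex" where
  "pairing \<theta> B a = (\<Sum>b\<in>B. \<Sum>c\<in>B. cinner (bop_apply (\<theta> (a b c)) c) b)"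

definition vanishes_off :: "'b set \<Rightarrow> ('b \<Rightarrow> 'b \<Rightarrow> 'a::zero) \<Rightarrow> bool" where
  "vanishes_off B a \<longleftrightarrow> (\<forall>b c. b \<notin> B \<or> c \<notin> B \<longrightarrow> a b c = 0)"

definition functional_graph ::
  "nat \<Rightarrow> (nat \<Rightarrow> 'a \<Rightarrow> 'a) \<Rightarrow> ('a::unital_cstar_algebra \<Rightarrow> 'h::chilbert_space bop) \<Rightarrow> (('h, 'a) mats \<times> real) set" where
  "functional_graph m \<phi> \<theta> =
     {(image_mats m \<phi> a, Re (pairing \<theta> B a)) |a B. finite B \<and> vanishes_off B a}"

lemma bounded_clinear_simps:
  assumes "bounded_clinear f"
  shows "f (x + y) = f x + f y" "f (x - y) = f x - f y" "f (- x) = - f x" "f 0 = 0"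
    "f (r *\<^sub>R x) = r *\<^sub>R f x" "f (c *\<^sub>C x) = c *\<^sub>C f x"
proof -
  have "bounded_linear f" using assms by (simp add: bounded_clinear_def)
  then interpret bounded_linear f .
  show "f (x + y) = f x + f y" "f (x - y) = f x - f y" "f (- x) = - f x" "f 0 = 0" "f (r *\<^sub>R x) = r *\<^sub>R f x"
    by (simp_all add: add diff neg zero scaleR)
  show "f (c *\<^sub>C x) = c *\<^sub>C f x" using assms by (simp add: bounded_clinear_def)
qed

lemma pairing_mono:
  assumes \<theta>: "bounded_clinear \<theta>" and "finite B'" "B \<subseteq> B'" "vanishes_off B a"
  shows "pairing \<theta> B' a = pairing \<theta> B a"
proof -
  have z: "cinner (bop_apply (\<theta> (a b c)) c) b = 0" if "b \<notin> B \<or> c \<notin> B" for b c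
    using assms(4) that by (auto simp: vanishes_off_def bounded_clinear_simps[OF \<theta>] zero_bop.rep_eq)
  have "pairing \<theta> B' a = (\<Sum>b\<in>B. \<Sum>c\<in>B'. cinner (bop_apply (\<theta> (a b c)) c) b)"
    unfolding pairing_def by (intro sum.mono_neutral_right) (use assms z in auto)
  also have "\<dots> = pairing \<theta> B a"
    unfolding pairing_def by (intro sum.cong refl sum.mono_neutral_right) (use assms z in auto)
  finally show ?thesis .
qed

lemma pairing_add:
  "bounded_clinear \<theta> \<Longrightarrow> pairing \<theta> B (\<lambda>b c. a b c + a' b c) = pairing \<theta> B a + pairing \<theta> B a'"
  by (simp add: pairing_def bounded_clinear_simps bop_apply_simps cinner_add_left sum.distrib)

lemma pairing_scaleC:
  "bounded_clinear \<theta> \<Longrightarrow> pairing \<theta> B (\<lambda>b c. z *\<^sub>C a b c) = z * pairing \<theta> B a"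
  by (simp add: pairing_def bounded_clinear_simps bop_apply_simps cinner_scaleC_left sum_distrib_left)

lemma subspace_functional_graph:
  assumes \<phi>: "\<And>k. k \<in> {1..m} \<Longrightarrow> bounded_clinear (\<phi> k)" and \<theta>: "bounded_clinear \<theta>"
  shows "subspace (functional_graph m \<phi> \<theta>)"
  unfolding subspace_def
proof (intro conjI ballI allI)
  have "image_mats m \<phi> (\<lambda>b c. 0) = 0"
    by (auto simp: image_mats_def fun_eq_iff bounded_clinear_simps[OF \<phi>])
  then show "0 \<in> functional_graph m \<phi> \<theta>"
    unfolding functional_graph_def
    by (auto simp: zero_prod_def pairing_def vanishes_off_def intro!: exI[of _ "\<lambda>b c. 0"] exI[of _ "{}"])
next
  fix p q assume "p \<in> functional_graph m \<phi> \<theta>" "q \<in> functional_graph m \<phi> \<theta>"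
  then obtain a B a' B' where p: "p = (image_mats m \<phi> a, Re (pairing \<theta> B a))" "finite B" "vanishes_off B a"
    and q: "q = (image_mats m \<phi> a', Re (pairing \<theta> B' a'))" "finite B'" "vanishes_off B' a'"
    by (auto simp: functional_graph_def)
  let ?a = "\<lambda>b c. a b c + a' b c" and ?B = "B \<union> B'"
  have "image_mats m \<phi> ?a = image_mats m \<phi> a + image_mats m \<phi> a'"
    by (auto simp: image_mats_def fun_eq_iff bounded_clinear_simps(1)[OF \<phi>])
  moreover have "pairing \<theta> ?B ?a = pairing \<theta> B a + pairing \<theta> B' a'"
    using p q pairing_mono[OF \<theta>, of ?B B a] pairing_mono[OF \<theta>, of ?B B' a']
    by (simp add: pairing_add[OF \<theta>])
  moreover have "vanishes_off ?B ?a" using p q by (auto simp: vanishes_off_def)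
  ultimately show "p + q \<in> functional_graph m \<phi> \<theta>"
    unfolding functional_graph_def using p q
    by (intro CollectI exI[of _ ?a] exI[of _ ?B]) simp
next
  fix r :: real and p assume "p \<in> functional_graph m \<phi> \<theta>"
  then obtain a B where p: "p = (image_mats m \<phi> a, Re (pairing \<theta> B a))" "finite B" "vanishes_off B a"
    by (auto simp: functional_graph_def)
  let ?a = "\<lambda>b c. of_real r *\<^sub>C a b c"
  have "image_mats m \<phi> ?a = r *\<^sub>R image_mats m \<phi> a"
    by (auto simp: image_mats_def fun_eq_iff scaleR_fun_def bounded_clinear_simps(6)[OF \<phi>] scaleR_scaleC)
  moreover have "vanishes_off B ?a" using p by (auto simp: vanishes_off_def)
  ultimately show "r *\<^sub>R p \<in> functional_graph m \<phi> \<theta>"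
    unfolding functional_graph_def using p
    by (intro CollectI exI[of _ ?a] exI[of _ B]) (simp add: pairing_scaleC[OF \<theta>])
qed

text \<open>Every finite family is dominated by a multiple of the unit of a finite block, which is the
  image of a diagonal matrix under the unital maps \<open>\<phi>\<^sub>k\<close>.\<close>

lemma functional_graph_cofinal:
  assumes \<phi>: "\<And>k. k \<in> {1..m} \<Longrightarrow> bounded_clinear (\<phi> k)" and one: "\<And>k. k \<in> {1..m} \<Longrightarrow> \<phi> k 1 = 1"
    and X: "X \<in> (fin_mats m :: ('h::chilbert_space, 'a::unital_cstar_algebra) mats set)"
  shows "\<exists>W r. (W, r) \<in> functional_graph m \<phi> \<theta> \<and> W - X \<in> mats_cone m"
proof -
  obtain B where B: "finite B" "supported m B X" using X by (auto simp: fin_mats_def)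
  have "\<exists>R. R > 0 \<and> (\<forall>v. cpos (R *\<^sub>R ip B v v - (qf B v k X + star (qf B v k X))))" for k
    using form_bound[OF B(1), of "slice X k"] by (metis qf_def star_ip)
  then obtain R where R: "\<And>k. R k > 0" "\<And>k v. cpos (R k *\<^sub>R ip B v v - (qf B v k X + star (qf B v k X)))"
    by metis
  define S where "S = (\<Sum>k\<in>{1..m}. R k)"
  have RS: "R k \<le> S" if "k \<in> {1..m}" for k
    unfolding S_def using that R(1) by (intro member_le_sum) (auto intro: less_imp_le)
  define a where "a b c = (if b = c \<and> b \<in> B then S *\<^sub>R 1 else (0::'a))" for b c :: 'h
  let ?W = "image_mats m \<phi> a"
  have \<phi>a: "\<phi> k (a b c) = a b c" if "k \<in> {1..m}" for k and b c :: 'h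
    by (simp add: a_def bounded_clinear_simps[OF \<phi>[OF that]] one[OF that])
  have "vanishes_off B a" by (auto simp: a_def vanishes_off_def)
  then have "(?W, Re (pairing \<theta> B a)) \<in> functional_graph m \<phi> \<theta>"
    unfolding functional_graph_def using B(1) by blast
  moreover have "?W - X \<in> mats_cone m"
  proof (rule mats_coneI)
    fix k and J :: "'h set" and v :: "'h \<Rightarrow> 'a"
    assume k: "k \<in> {1..m}" and J: "finite J"
    let ?w = "\<lambda>b. if b \<in> J then v b else 0"
    have W_eq: "?W (k, b, c) = (if k \<in> {1..m} then a b c else 0)" for k b c
      by (simp add: image_mats_def \<phi>a)
    have "supported m B ?W"
      by (auto simp: supported_def W_eq a_def split: if_splits)
    then have sup: "supported m B (?W - X)"
      using B(2) unfolding supported_def by (metis cancel_comm_monoid_add_class.diff_cancel minus_apply)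
    have "qf B ?w k ?W = (\<Sum>b\<in>B. \<Sum>c\<in>B. if b = c then S *\<^sub>R (star (?w b) * ?w b) else 0)"
      unfolding qf_double_sum by (intro sum.cong refl) (use k in \<open>simp add: W_eq a_def\<close>)
    also have "\<dots> = S *\<^sub>R ip B ?w ?w" using B(1) by (simp add: ip_def scaleR_sum_right)
    finally have qW: "qf B ?w k ?W = S *\<^sub>R ip B ?w ?w" .
    have "cpos ((R k *\<^sub>R ip B ?w ?w - (qf B ?w k X + star (qf B ?w k X))) + (2 * S - R k) *\<^sub>R ip B ?w ?w)"
      using RS[OF k] R(1)[of k] by (intro cpos_add R cpos_scaleR cpos_ip_self) simp
    moreover have "(2 * S) *\<^sub>R ip B ?w ?w = S *\<^sub>R ip B ?w ?w + S *\<^sub>R ip B ?w ?w"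
      by (simp add: scaleR_add_left[symmetric])
    ultimately have "cpos (qf B ?w k (?W - X) + star (qf B ?w k (?W - X)))"
      unfolding qf_diff qW star_diff star_scaleR star_ip scaleR_diff_left by (simp add: algebra_simps)
    then show "cpos (qf J v k (?W - X) + star (qf J v k (?W - X)))"
      by (simp only: qf_support[OF B(1) sup J])
  qed
  ultimately show ?thesis by blast
qed

lemma sum_double_reindex:
  assumes "bij_betw e I B"
  shows "(\<Sum>i\<in>I. \<Sum>j\<in>I. f (e i) (e j)) = (\<Sum>b\<in>B. \<Sum>c\<in>B. f b c)"
proof -
  have "(\<Sum>i\<in>I. \<Sum>j\<in>I. f (e i) (e j)) = (\<Sum>i\<in>I. \<Sum>c\<in>B. f (e i) c)"
    by (intro sum.cong refl sum.reindex_bij_betw assms)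
  also have "\<dots> = (\<Sum>b\<in>B. \<Sum>c\<in>B. f b c)"
    by (rule sum.reindex_bij_betw[OF assms, of "\<lambda>b. \<Sum>c\<in>B. f b c"])
  finally show ?thesis .
qed

lemma pairing_star:
  assumes \<theta>: "\<And>a. \<theta> (star a) = star (\<theta> a)"
  shows "pairing \<theta> B (\<lambda>b c. star (a c b)) = cnj (pairing \<theta> B a)"
proof -
  have "cinner (bop_apply (\<theta> (star (a c b))) c) b = cnj (cinner (bop_apply (\<theta> (a c b)) b) c)" for b c
    by (subst cinner_commute) (simp add: \<theta> star_bop)
  then show ?thesis unfolding pairing_def cnj_sum by (subst sum.swap) simp
qed

text \<open>The functional is nonnegative on the part of the cone where it is defined: enumerating the
  finite index set turns the Hermitian part of \<open>a\<close> into a matrix in the cone that \<open>\<theta>\<close> is assumed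
  to map to positive matrices.\<close>

lemma functional_graph_nonneg:
  assumes \<phi>: "\<And>k. k \<in> {1..m} \<Longrightarrow> bounded_star_map (\<phi> k)" and \<theta>: "bounded_star_map \<theta>"
    and pos: "\<And>n X. X \<in> carrier_mat n n \<Longrightarrow> X \<in> Gamma_pos n m \<phi> \<Longrightarrow> map_mat \<theta> X \<in> mat_pos n"
    and W: "(W, r) \<in> functional_graph m \<phi> \<theta>" "W \<in> mats_cone m"
  shows "r \<ge> 0"
proof -
  obtain a B where a: "W = image_mats m \<phi> a" "r = Re (pairing \<theta> B a)" "finite B"
    using W(1) by (auto simp: functional_graph_def)
  have \<phi>_lin: "bounded_clinear (\<phi> k)" and \<phi>_star: "\<phi> k (star x) = star (\<phi> k x)" if "k \<in> {1..m}" for k x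
    using \<phi>[OF that] by (simp_all add: bounded_star_map_def)
  have \<theta>_lin: "bounded_clinear \<theta>" and \<theta>_star: "\<And>x. \<theta> (star x) = star (\<theta> x)"
    using \<theta> by (simp_all add: bounded_star_map_def)
  \<comment> \<open>Membership in the cone only controls the Hermitian part of \<open>W\<close>.\<close>
  define h where "h b c = a b c + star (a c b)" for b c
  have sh: "star (h b c) = h c b" for b c by (simp add: h_def star_simps add.commute)
  obtain e where e: "bij_betw e {..<card B} B"
    using ex_bij_betw_nat_finite[OF a(3)] by (auto simp: lessThan_atLeast0)
  define n where "n = card B"
  define X where "X = mat n n (\<lambda>(i, j). h (e i) (e j))"
  have XC: "X \<in> carrier_mat n n" by (simp add: X_def)
  have "map_mat (\<phi> k) X \<in> mat_pos n" if k: "k \<in> {1..m}" for k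
  proof -
    have herm: "hermitian {..<n} (\<lambda>i j. \<phi> k (h (e i) (e j)))"
      by (simp add: hermitian_def \<phi>_star[OF k, symmetric] sh)
    have "cpos (ip {..<n} v (app {..<n} (\<lambda>i j. \<phi> k (h (e i) (e j))) v))" for v
    proof -
      define w where "w b = v (the_inv_into {..<n} e b)" for b
      have w: "w (e i) = v i" if "i < n" for i
        using e that unfolding w_def n_def by (simp add: the_inv_into_f_f bij_betw_def)
      have "ip {..<n} v (app {..<n} (\<lambda>i j. \<phi> k (h (e i) (e j))) v)
          = (\<Sum>i\<in>{..<n}. \<Sum>j\<in>{..<n}. star (w (e i)) * \<phi> k (h (e i) (e j)) * w (e j))"
        unfolding ip_app_double_sum by (intro sum.cong refl) (simp add: w)
      also have "\<dots> = (\<Sum>b\<in>B. \<Sum>c\<in>B. star (w b) * \<phi> k (h b c) * w c)"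
        by (rule sum_double_reindex) (simp add: e n_def)
      also have "\<dots> = qf B w k W + star (qf B w k W)"
      proof -
        have "star (qf B w k W) = (\<Sum>b\<in>B. \<Sum>c\<in>B. star (w b) * star (\<phi> k (a c b)) * w c)"
          unfolding qf_double_sum star_sum
          by (subst sum.swap) (use k in \<open>simp add: a(1) image_mats_def star_simps mult.assoc\<close>)
        then show ?thesis
          using k by (simp add: h_def bounded_clinear_simps(1)[OF \<phi>_lin[OF k]] \<phi>_star[OF k]
              qf_double_sum a(1) image_mats_def distrib_left distrib_right sum.distrib)
      qed
      also have "cpos \<dots>" using W(2) k a(3) by (simp add: mats_cone_def)
      finally show ?thesis .
    qed
    then have "pos_form {..<n} (\<lambda>i j. \<phi> k (h (e i) (e j)))" using herm by (simp add: pos_form_def)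
    then have "pos_form {..<n} (\<lambda>i j. map_mat (\<phi> k) X $$ (i, j))"
      by (subst pos_form_cong[where Y = "\<lambda>i j. \<phi> k (h (e i) (e j))"]) (simp_all add: X_def)
    then show ?thesis by (simp add: mat_pos_iff X_def)
  qed
  then have "map_mat \<theta> X \<in> mat_pos n"
    using pos[OF XC] XC by (simp add: Gamma_pos_def)
  then have "pos_form {..<n} (\<lambda>i j. map_mat \<theta> X $$ (i, j))" by (simp add: mat_pos_iff)
  then have "0 \<le> Re (\<Sum>i\<in>{..<n}. \<Sum>j\<in>{..<n}. cinner (bop_apply (map_mat \<theta> X $$ (i, j)) (e j)) (e i))"
    unfolding pos_form_bop_iff by blast
  also have "(\<Sum>i\<in>{..<n}. \<Sum>j\<in>{..<n}. cinner (bop_apply (map_mat \<theta> X $$ (i, j)) (e j)) (e i))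
      = (\<Sum>i\<in>{..<n}. \<Sum>j\<in>{..<n}. cinner (bop_apply (\<theta> (h (e i) (e j))) (e j)) (e i))"
    by (intro sum.cong refl) (simp add: X_def)
  also have "\<dots> = pairing \<theta> B h"
    unfolding pairing_def by (rule sum_double_reindex) (simp add: e n_def)
  also have "pairing \<theta> B h = pairing \<theta> B a + cnj (pairing \<theta> B a)"
    unfolding h_def pairing_add[OF \<theta>_lin] pairing_star[of \<theta>, OF \<theta>_star] ..
  finally show ?thesis by (simp add: a(2))
qed

section \<open>Completely positive maps from positive functionals\<close>

definition mats_scaleC :: "complex \<Rightarrow> ('b, 'a::unital_cstar_algebra) mats \<Rightarrow> ('b, 'a) mats" where
  "mats_scaleC z X = (\<lambda>p. z *\<^sub>C X p)"

definition mats_adj :: "('b, 'a::unital_cstar_algebra) mats \<Rightarrow> ('b, 'a) mats" where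
  "mats_adj X = (\<lambda>(k, b, c). star (X (k, c, b)))"

text \<open>In the \<open>k\<close>-th component this is \<open>a\<close> tensored with the rank-one matrix of the coordinate
  vectors \<open>p\<close> and \<open>q\<close>.\<close>

definition elem_mats :: "nat \<Rightarrow> 'a \<Rightarrow> ('b \<Rightarrow> complex) \<Rightarrow> ('b \<Rightarrow> complex) \<Rightarrow> ('b, 'a::unital_cstar_algebra) mats" where
  "elem_mats k a p q = (\<lambda>(k', b, c). if k' = k then (cnj (q b) * p c) *\<^sub>C a else 0)"

lemma mats_scaleC_fin: "X \<in> fin_mats m \<Longrightarrow> mats_scaleC z X \<in> fin_mats m"
proof -
  assume "X \<in> fin_mats m"
  then obtain B where "finite B" "supported m B X" by (auto simp: fin_mats_def)
  moreover from this have "supported m B (mats_scaleC z X)"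
    unfolding supported_def mats_scaleC_def by (metis scaleC_zero_right)
  ultimately show ?thesis by (auto simp: fin_mats_def)
qed

lemma mats_adj_fin: "X \<in> fin_mats m \<Longrightarrow> mats_adj X \<in> fin_mats m"
proof -
  assume "X \<in> fin_mats m"
  then obtain B where "finite B" and B: "supported m B X" by (auto simp: fin_mats_def)
  have "supported m B (mats_adj X)"
    unfolding supported_def
  proof (intro allI impI)
    fix k b c assume "mats_adj X (k, b, c) \<noteq> 0"
    then have "X (k, c, b) \<noteq> 0" by (auto simp: mats_adj_def)
    then show "k \<in> {1..m} \<and> b \<in> B \<and> c \<in> B" using B unfolding supported_def by blast
  qed
  with \<open>finite B\<close> show ?thesis by (auto simp: fin_mats_def)
qed

lemma qf_mats_adj: "qf J v k (mats_adj X) = star (qf J v k X)"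
  unfolding qf_double_sum star_sum by (subst sum.swap) (simp add: mats_adj_def star_simps mult.assoc)

lemma qf_elem_mats:
  "qf J v k' (elem_mats k a p q) =
    (if k' = k then star (\<Sum>b\<in>J. q b *\<^sub>C v b) * a * (\<Sum>c\<in>J. p c *\<^sub>C v c) else 0)"
proof -
  have "star (v b) * ((cnj (q b) * p c) *\<^sub>C a) * v c = star (q b *\<^sub>C v b) * a * (p c *\<^sub>C v c)" for b c
    by (simp add: star_scaleC mult_scaleC_left mult_scaleC_right scaleC_scaleC mult.commute)
  then show ?thesis
    by (simp add: qf_double_sum elem_mats_def star_sum sum_distrib_right[of _ _ a] sum_product)
qed

lemma elem_mats_fin:
  assumes "k \<in> {1..m}" "finite {b. p b \<noteq> 0}" "finite {b. q b \<noteq> 0}"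
  shows "elem_mats k a p q \<in> fin_mats m"
proof -
  have "supported m ({b. p b \<noteq> 0} \<union> {b. q b \<noteq> 0}) (elem_mats k a p q)"
    using assms(1) by (auto simp: supported_def elem_mats_def split: if_splits)
  then show ?thesis using assms unfolding fin_mats_def by blast
qed

lemma elem_mats_add: "elem_mats k (a + a') p q = elem_mats k a p q + elem_mats k a' p q"
  by (auto simp: elem_mats_def fun_eq_iff scaleC_add_right)

lemma elem_mats_scale: "elem_mats k (z *\<^sub>C a) p q = mats_scaleC z (elem_mats k a p q)"
  by (auto simp: elem_mats_def mats_scaleC_def fun_eq_iff scaleC_scaleC mult.commute)

lemma elem_mats_add_left: "elem_mats k a (\<lambda>b. p b + p' b) q = elem_mats k a p q + elem_mats k a p' q"
  by (auto simp: elem_mats_def fun_eq_iff distrib_left scaleC_add_left)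

lemma elem_mats_scale_left: "elem_mats k a (\<lambda>b. z * p b) q = mats_scaleC z (elem_mats k a p q)"
  by (auto simp: elem_mats_def mats_scaleC_def fun_eq_iff scaleC_scaleC mult.left_commute)

lemma elem_mats_add_right: "elem_mats k a p (\<lambda>b. q b + q' b) = elem_mats k a p q + elem_mats k a p q'"
  by (auto simp: elem_mats_def fun_eq_iff distrib_right scaleC_add_left)

lemma elem_mats_scale_right: "elem_mats k a p (\<lambda>b. z * q b) = mats_scaleC (cnj z) (elem_mats k a p q)"
  by (auto simp: elem_mats_def mats_scaleC_def fun_eq_iff scaleC_scaleC mult.assoc)

lemma mats_adj_elem: "mats_adj (elem_mats k a p q) = elem_mats k (star a) q p"
  by (auto simp: elem_mats_def mats_adj_def fun_eq_iff star_scaleC mult.commute)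

lemma sum_fun_apply: "(\<Sum>i\<in>I. X i) p = (\<Sum>i\<in>I. X i p)" for X :: "'i \<Rightarrow> 'p \<Rightarrow> 'a::comm_monoid_add"
proof (induction I rule: infinite_finite_induct)
  case (insert i I)
  show ?case unfolding sum.insert[OF insert.hyps] plus_fun_apply insert.IH ..
qed simp_all

lemma sum_elem_mats:
  assumes "\<And>k. k \<in> {1..m} \<Longrightarrow> bounded_clinear (\<phi> k)"
  shows "(\<Sum>k\<in>{1..m}. elem_mats k (\<phi> k a) p q) = image_mats m \<phi> (\<lambda>b c. (cnj (q b) * p c) *\<^sub>C a)"
  by (auto simp: fun_eq_iff sum_fun_apply elem_mats_def image_mats_def bounded_clinear_simps(6)[OF assms])

locale positive_functional =
  fixes m :: nat and f :: "('b, 'a::unital_cstar_algebra) mats \<Rightarrow> real"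
  assumes f_add: "\<And>X Y. X \<in> fin_mats m \<Longrightarrow> Y \<in> fin_mats m \<Longrightarrow> f (X + Y) = f X + f Y"
    and f_scale: "\<And>r X. X \<in> fin_mats m \<Longrightarrow> f (r *\<^sub>R X) = r * f X"
    and f_nonneg: "\<And>X. X \<in> fin_mats m \<Longrightarrow> X \<in> mats_cone m \<Longrightarrow> f X \<ge> 0"
begin

lemmas fin_add = subspace_add[OF subspace_fin_mats[of m]]
lemmas fin_diff = subspace_diff[OF subspace_fin_mats[of m]]
lemmas fin_scale = subspace_scale[OF subspace_fin_mats[of m]]
lemmas fin_sum = subspace_sum[OF subspace_fin_mats[of m]]

text \<open>The complex linear functional with real part \<open>f\<close>.\<close>

definition fc :: "('b, 'a) mats \<Rightarrow> complex" where
  "fc X = Complex (f X) (- f (mats_scaleC \<i> X))"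

lemma Re_fc: "Re (fc X) = f X"
  by (simp add: fc_def)

lemma fc_add: "X \<in> fin_mats m \<Longrightarrow> Y \<in> fin_mats m \<Longrightarrow> fc (X + Y) = fc X + fc Y"
proof -
  assume XY: "X \<in> fin_mats m" "Y \<in> fin_mats m"
  have "mats_scaleC \<i> (X + Y) = mats_scaleC \<i> X + mats_scaleC \<i> Y"
    by (simp add: mats_scaleC_def fun_eq_iff scaleC_add_right)
  then show ?thesis using XY by (simp add: fc_def f_add mats_scaleC_fin complex_eq_iff)
qed

lemma f_scaleC: "X \<in> fin_mats m \<Longrightarrow> f (mats_scaleC z X) = Re z * f X + Im z * f (mats_scaleC \<i> X)"
proof -
  assume X: "X \<in> fin_mats m"
  have "mats_scaleC z X = Re z *\<^sub>R X + Im z *\<^sub>R mats_scaleC \<i> X"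
    unfolding fun_eq_iff
  proof
    fix p
    have "z = complex_of_real (Re z) + complex_of_real (Im z) * \<i>" by (simp add: complex_eq_iff)
    then have "z *\<^sub>C X p = complex_of_real (Re z) *\<^sub>C X p + complex_of_real (Im z) *\<^sub>C \<i> *\<^sub>C X p"
      by (metis scaleC_add_left scaleC_scaleC)
    then show "mats_scaleC z X p = (Re z *\<^sub>R X + Im z *\<^sub>R mats_scaleC \<i> X) p"
      by (simp add: mats_scaleC_def scaleR_fun_def scaleR_scaleC)
  qed
  then show ?thesis using X by (simp add: f_add f_scale fin_scale mats_scaleC_fin)
qed

lemma fc_scaleC: "X \<in> fin_mats m \<Longrightarrow> fc (mats_scaleC z X) = z * fc X"
proof -
  assume X: "X \<in> fin_mats m"
  have "mats_scaleC \<i> (mats_scaleC z X) = mats_scaleC (\<i> * z) X"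
    by (simp add: mats_scaleC_def scaleC_scaleC)
  then show ?thesis using X by (simp add: fc_def f_scaleC[of X z] f_scaleC[of X "\<i> * z"] complex_eq_iff)
qed

lemma fc_sum: "(\<And>i. i \<in> I \<Longrightarrow> X i \<in> fin_mats m) \<Longrightarrow> fc (\<Sum>i\<in>I. X i) = (\<Sum>i\<in>I. fc (X i))"
proof (induction I rule: infinite_finite_induct)
  case (insert i I)
  have "fc (X i + sum X I) = fc (X i) + fc (sum X I)"
    using insert.prems by (intro fc_add fin_sum) auto
  also have "fc (sum X I) = (\<Sum>i\<in>I. fc (X i))" by (rule insert.IH) (rule insert.prems, simp)
  finally show ?case unfolding sum.insert[OF insert.hyps] .
next
  case (infinite I)
  have "fc 0 = 0" using fc_scaleC[OF subspace_0[OF subspace_fin_mats], of 0] by (simp add: mats_scaleC_def zero_fun_def)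
  then show ?case unfolding sum.infinite[OF infinite.hyps] .
next
  case empty
  have "fc 0 = 0" using fc_scaleC[OF subspace_0[OF subspace_fin_mats], of 0] by (simp add: mats_scaleC_def zero_fun_def)
  then show ?case unfolding sum.empty .
qed

text \<open>The difference of a family and its adjoint is skew-Hermitian, so both it and its negative lie in
  the cone.\<close>

lemma f_adj: "X \<in> fin_mats m \<Longrightarrow> f (mats_adj X) = f X"
proof -
  assume X: "X \<in> fin_mats m"
  have Y: "mats_adj X \<in> fin_mats m" using X by (rule mats_adj_fin)
  have diff: "f (X - Y) = f X - f Y" if "X \<in> fin_mats m" "Y \<in> fin_mats m" for X Y
    using f_add[OF fin_diff[OF that] that(2)] by simp
  have "X - mats_adj X \<in> mats_cone m" "mats_adj X - X \<in> mats_cone m"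
    by (rule mats_coneI, unfold qf_diff qf_mats_adj, simp add: star_simps)+
  then have "f (X - mats_adj X) \<ge> 0" "f (mats_adj X - X) \<ge> 0"
    using X Y by (auto intro: f_nonneg fin_diff)
  then show ?thesis by (simp only: diff[OF X Y] diff[OF Y X])
qed

lemma fc_adj: "X \<in> fin_mats m \<Longrightarrow> fc (mats_adj X) = cnj (fc X)"
proof -
  assume X: "X \<in> fin_mats m"
  have "mats_scaleC \<i> (mats_adj X) = mats_adj (mats_scaleC (- \<i>) X)"
    by (auto simp: mats_scaleC_def mats_adj_def fun_eq_iff star_scaleC)
  then have "f (mats_scaleC \<i> (mats_adj X)) = f (mats_scaleC (- \<i>) X)"
    using X by (simp add: f_adj mats_scaleC_fin)
  also have "\<dots> = - f (mats_scaleC \<i> X)" using f_scaleC[OF X, of "- \<i>"] by simp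
  finally show ?thesis using X by (simp add: fc_def f_adj complex_eq_iff)
qed

text \<open>The positivity of the matrix with rows \<open>(1, a)\<close> and \<open>(a*, 1)\<close> for \<open>\<parallel>a\<parallel> \<le> 1\<close> gives the
  Cauchy--Schwarz estimate that makes the maps bounded.\<close>

lemma f_elem_bound:
  assumes k: "k \<in> {1..m}" and p: "finite {b. p b \<noteq> 0}" and q: "finite {b. q b \<noteq> 0}"
    and a: "norm a \<le> 1"
  shows "- (2 * f (elem_mats k a p q)) \<le> f (elem_mats k 1 p p) + f (elem_mats k 1 q q)"
proof -
  let ?X = "(elem_mats k 1 p p + elem_mats k 1 q q) + 2 *\<^sub>R elem_mats k a p q"
  note fin = elem_mats_fin[OF k p p, of 1] elem_mats_fin[OF k q q, of 1] elem_mats_fin[OF k p q, of a]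
  have "?X \<in> mats_cone m"
  proof (rule mats_coneI)
    fix k' and J :: "'b set" and v :: "'b \<Rightarrow> 'a"
    define P Q where "P = (\<Sum>c\<in>J. p c *\<^sub>C v c)" and "Q = (\<Sum>b\<in>J. q b *\<^sub>C v b)"
    show "cpos (qf J v k' ?X + star (qf J v k' ?X))"
    proof (cases "k' = k")
      case False
      then show ?thesis by (simp add: qf_add qf_scaleR qf_elem_mats)
    next
      case True
      have "norm a * norm a \<le> 1" using a by (simp add: mult_le_one)
      then have "cpos ((star (Q + a * P) * (Q + a * P)
          + (((norm a)\<^sup>2 *\<^sub>R (star P * P) - star (a * P) * (a * P)) + (1 - (norm a)\<^sup>2) *\<^sub>R (star P * P))))"
        by (intro cpos_add cpos_star_mult cpos_conj_norm cpos_scaleR) (simp add: power2_eq_square)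
      also have "(star (Q + a * P) * (Q + a * P)
          + (((norm a)\<^sup>2 *\<^sub>R (star P * P) - star (a * P) * (a * P)) + (1 - (norm a)\<^sup>2) *\<^sub>R (star P * P)))
        = star P * P + star Q * Q + star Q * a * P + star P * star a * Q"
        by (simp add: star_simps distrib_left distrib_right mult.assoc scaleR_diff_left)
      finally have "cpos (2 *\<^sub>R (star P * P + star Q * Q + star Q * a * P + star P * star a * Q))"
        by (rule cpos_scaleR) simp
      also have "2 *\<^sub>R (star P * P + star Q * Q + star Q * a * P + star P * star a * Q)
          = qf J v k' ?X + star (qf J v k' ?X)"
        unfolding qf_add qf_scaleR qf_elem_mats True P_def[symmetric] Q_def[symmetric]
        by (simp add: star_simps mult.assoc scaleR_2 ac_simps)
      finally show ?thesis .
    qed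
  qed
  moreover have "?X \<in> fin_mats m" by (intro fin_add fin_scale fin)
  ultimately have "0 \<le> f ?X" by (intro f_nonneg)
  also have "f ?X = f (elem_mats k 1 p p) + f (elem_mats k 1 q q) + 2 * f (elem_mats k a p q)"
    by (subst f_add, (intro fin_add fin_scale fin)+, subst f_add, (intro fin)+, subst f_scale, intro fin, simp)
  finally show ?thesis by simp
qed

lemma f_elem_nonneg:
  assumes "k \<in> {1..m}" "finite {b. p b \<noteq> 0}"
  shows "0 \<le> f (elem_mats k 1 p p)"
proof (intro f_nonneg elem_mats_fin assms mats_coneI)
  show "cpos (qf J v k' (elem_mats k 1 p p) + star (qf J v k' (elem_mats k 1 p p)))" for k' J and v :: "'b \<Rightarrow> 'a"
    by (simp add: qf_elem_mats star_simps cpos_add cpos_star_mult)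
qed

text \<open>Positive matrices give elements of the cone: in coordinates, the quadratic form becomes the
  form of the given matrix at another vector.\<close>

lemma f_elem_matrix_nonneg:
  assumes k: "k \<in> {1..m}" and I: "finite I" and p: "\<And>i. finite {b. p i b \<noteq> 0}" and X: "pos_form I X"
  shows "0 \<le> f (\<Sum>i\<in>I. \<Sum>j\<in>I. elem_mats k (X i j) (p j) (p i))"
proof (intro f_nonneg fin_sum elem_mats_fin k p mats_coneI)
  fix k' and J :: "'b set" and v :: "'b \<Rightarrow> 'a"
  define w where "w i = (\<Sum>b\<in>J. p i b *\<^sub>C v b)" for i
  let ?q = "qf J v k' (\<Sum>i\<in>I. \<Sum>j\<in>I. elem_mats k (X i j) (p j) (p i))"
  have "?q = (if k' = k then ip I w (app I X w) else 0)"
    by (simp add: qf_sum qf_elem_mats ip_app_double_sum w_def[symmetric])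
  moreover have "cpos (ip I w (app I X w))" using X by (simp add: pos_form_def)
  ultimately have "cpos ?q" by simp
  then show "cpos (?q + star ?q)" by (simp add: cpos_add cpos_star)
qed

end

lemma pairing_coordinates:
  fixes \<theta> :: "'a::unital_cstar_algebra \<Rightarrow> 'h::chilbert_space bop"
  assumes \<theta>: "bounded_clinear \<theta>" and x: "(\<Sum>b\<in>B. p b *\<^sub>C b) = x" and y: "(\<Sum>b\<in>B. q b *\<^sub>C b) = y"
  shows "pairing \<theta> B (\<lambda>b c. (cnj (q b) * p c) *\<^sub>C a) = cinner (bop_apply (\<theta> a) x) y"
proof -
  have sr: "cinner z (\<Sum>b\<in>B. g b) = (\<Sum>b\<in>B. cinner z (g b))" for z :: 'h and g
    by (subst cinner_commute) (simp add: cinner_sum_left cinner_commute[symmetric])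
  have "bop_apply (\<theta> a) x = (\<Sum>c\<in>B. p c *\<^sub>C bop_apply (\<theta> a) c)"
    unfolding x[symmetric] by (simp add: blinfun.sum_right bop_apply_scaleC)
  then have "cinner (bop_apply (\<theta> a) x) y = (\<Sum>b\<in>B. \<Sum>c\<in>B. cnj (q b) * (p c * cinner (bop_apply (\<theta> a) c) b))"
    unfolding y[symmetric] by (simp add: sr cinner_sum_left cinner_scaleC_left cinner_scaleC_right sum_distrib_left)
  then show ?thesis
    by (simp add: pairing_def bounded_clinear_simps(6)[OF \<theta>] bop_apply_simps cinner_scaleC_left mult.assoc)
qed

text \<open>The extended functional, evaluated at \<open>elem_mats k a\<close> of the coordinates of \<open>x\<close> and \<open>y\<close>, is the
  form \<open>\<langle>\<psi>\<^sub>k a x, y\<rangle>\<close>.  Its bound comes from \<open>a = 1\<close>, where each of the \<open>m\<close> nonnegative diagonal values is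
  at most their sum \<open>\<langle>\<theta> 1 x, x\<rangle>\<close>.\<close>

theorem decomposable_if_positive:
  fixes \<phi> :: "nat \<Rightarrow> 'a::unital_cstar_algebra \<Rightarrow> 'a" and \<theta> :: "'a \<Rightarrow> 'h::chilbert_space bop"
  assumes \<phi>: "\<And>k. k \<in> {1..m} \<Longrightarrow> bounded_star_map (\<phi> k)"
    and one: "\<And>k. k \<in> {1..m} \<Longrightarrow> \<phi> k 1 = 1"
    and \<theta>: "bounded_star_map \<theta>"
    and pos: "\<And>n X. X \<in> carrier_mat n n \<Longrightarrow> X \<in> Gamma_pos n m \<phi> \<Longrightarrow> map_mat \<theta> X \<in> mat_pos n"
  shows "finitely_decomposable m \<phi> \<theta>"
proof -
  have \<phi>_lin: "bounded_clinear (\<phi> k)" if "k \<in> {1..m}" for k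
    using \<phi>[OF that] by (simp add: bounded_star_map_def)
  have \<theta>_lin: "bounded_clinear \<theta>" using \<theta> by (simp add: bounded_star_map_def)
  let ?G = "functional_graph m \<phi> \<theta>" and ?E = "fin_mats m :: ('h, 'a) mats set"
  obtain f where f: "\<And>X Y. X \<in> ?E \<Longrightarrow> Y \<in> ?E \<Longrightarrow> f (X + Y) = f X + f Y"
      "\<And>r X. X \<in> ?E \<Longrightarrow> f (r *\<^sub>R X) = r * f X"
      "\<And>X r. X \<in> ?E \<Longrightarrow> (X, r) \<in> ?G \<Longrightarrow> f X = r"
      "\<And>X. X \<in> ?E \<Longrightarrow> X \<in> mats_cone m \<Longrightarrow> f X \<ge> 0"
  proof (rule riesz_extension)
    show "subspace ?G" by (rule subspace_functional_graph[OF \<phi>_lin \<theta>_lin])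
    show "subspace ?E" by (rule subspace_fin_mats)
    show "X + Y \<in> mats_cone m" if "X \<in> mats_cone m" "Y \<in> mats_cone m" for X Y :: "('h, 'a) mats"
      using that by (rule mats_cone_add)
    show "r *\<^sub>R X \<in> mats_cone m" if "r \<ge> 0" "X \<in> mats_cone m" for r and X :: "('h, 'a) mats"
      using that by (rule mats_cone_scale)
    show "r \<ge> 0" if "(X, r) \<in> ?G" "X \<in> mats_cone m" for X r
      by (rule functional_graph_nonneg[OF \<phi> \<theta> pos that])
    show "\<exists>W r. (W, r) \<in> ?G \<and> W - X \<in> mats_cone m" if "X \<in> ?E" for X
      by (rule functional_graph_cofinal[OF \<phi>_lin one that])
  qed (rule that)
  interpret positive_functional m f
    by unfold_locales (rule f(1), assumption+, rule f(2), assumption, rule f(4))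
  obtain rep :: "'h \<Rightarrow> 'h \<Rightarrow> complex" where rep: "\<And>x. finite {b. rep x b \<noteq> 0}"
      "\<And>x y b. rep (x + y) b = rep x b + rep y b" "\<And>c x b. rep (c *\<^sub>C x) b = c * rep x b"
      "\<And>x. (\<Sum>b | rep x b \<noteq> 0. rep x b *\<^sub>C b) = x"
    by (rule hamel_coordinates) (rule that)
  have rep_add: "rep (x + y) = (\<lambda>b. rep x b + rep y b)" and rep_scale: "rep (c *\<^sub>C x) = (\<lambda>b. c * rep x b)" for x y c
    by (simp_all add: fun_eq_iff rep)
  define s where "s k a x y = fc (elem_mats k a (rep x) (rep y))" for k a x y
  have fin: "elem_mats k a (rep x) (rep y) \<in> ?E" if "k \<in> {1..m}" for k a x y
    by (rule elem_mats_fin[OF that rep(1) rep(1)])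
  have s_add: "s k (a + b) x y = s k a x y + s k b x y" and s_scale: "s k (z *\<^sub>C a) x y = z * s k a x y"
    and s_add_left: "s k a (x + x') y = s k a x y + s k a x' y" and s_scale_left: "s k a (z *\<^sub>C x) y = z * s k a x y"
    and s_add_right: "s k a x (y + y') = s k a x y + s k a x y'" and s_scale_right: "s k a x (z *\<^sub>C y) = cnj z * s k a x y"
    and s_star: "s k (star a) x y = cnj (s k a y x)"
    if "k \<in> {1..m}" for k a b x x' y y' z
    unfolding s_def rep_add rep_scale elem_mats_add elem_mats_scale elem_mats_add_left elem_mats_scale_left
      elem_mats_add_right elem_mats_scale_right mats_adj_elem[symmetric]
    by (simp_all only: fc_add fc_scaleC fc_adj fin[OF that])
  \<comment> \<open>The sum of the forms is the form of \<open>\<theta>\<close>.\<close>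
  have s_sum: "(\<Sum>k\<in>{1..m}. s k (\<phi> k a) x y) = cinner (bop_apply (\<theta> a) x) y" for a x y
  proof -
    define B where "B = {b. rep x b \<noteq> 0} \<union> {b. rep y b \<noteq> 0}"
    have B: "finite B" by (simp add: B_def rep(1))
    have x: "(\<Sum>b\<in>B. rep x b *\<^sub>C b) = x"
      by (subst (2) rep(4)[of x, symmetric], rule sum.mono_neutral_right[OF B]) (auto simp: B_def)
    have y: "(\<Sum>b\<in>B. rep y b *\<^sub>C b) = y"
      by (subst (2) rep(4)[of y, symmetric], rule sum.mono_neutral_right[OF B]) (auto simp: B_def)
    define h where "h z b c = (cnj (rep y b) * rep x c) *\<^sub>C (z *\<^sub>C a)" for z b c
    have sum_eq: "(\<Sum>k\<in>{1..m}. elem_mats k (\<phi> k (z *\<^sub>C a)) (rep x) (rep y)) = image_mats m \<phi> (h z)" for z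
      unfolding h_def by (rule sum_elem_mats[OF \<phi>_lin])
    have inE: "image_mats m \<phi> (h z) \<in> ?E" for z
      unfolding sum_eq[symmetric] by (intro fin_sum fin)
    have f_eq: "f (image_mats m \<phi> (h z)) = Re (z * cinner (bop_apply (\<theta> a) x) y)" for z
    proof -
      have "vanishes_off B (h z)" by (auto simp: vanishes_off_def h_def B_def)
      then have "(image_mats m \<phi> (h z), Re (pairing \<theta> B (h z))) \<in> ?G"
        using B unfolding functional_graph_def by blast
      then have "f (image_mats m \<phi> (h z)) = Re (pairing \<theta> B (h z))" by (rule f(3)[OF inE])
      also have "pairing \<theta> B (h z) = cinner (bop_apply (\<theta> (z *\<^sub>C a)) x) y"
        unfolding h_def by (rule pairing_coordinates[OF \<theta>_lin x y])
      finally show ?thesis by (simp add: bounded_clinear_simps(6)[OF \<theta>_lin] bop_apply_simps cinner_scaleC_left)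
    qed
    have "mats_scaleC \<i> (image_mats m \<phi> (h 1)) = image_mats m \<phi> (h \<i>)"
      by (auto simp: mats_scaleC_def image_mats_def fun_eq_iff h_def scaleC_scaleC mult.commute
          bounded_clinear_simps(6)[OF \<phi>_lin])
    then have "fc (image_mats m \<phi> (h 1)) = cinner (bop_apply (\<theta> a) x) y"
      by (simp add: fc_def f_eq complex_eq_iff)
    moreover have "(\<Sum>k\<in>{1..m}. s k (\<phi> k a) x y) = fc (image_mats m \<phi> (h 1))"
      unfolding sum_eq[symmetric] s_def by (subst fc_sum) (simp_all add: fin scaleC_one)
    ultimately show ?thesis by simp
  qed
  define C where "C = norm (\<theta> 1)"
  have C: "C \<ge> 0" by (simp add: C_def)
  have diag_bound: "f (elem_mats k 1 (rep x) (rep x)) \<le> C * (norm x)\<^sup>2" if k: "k \<in> {1..m}" for k x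
  proof -
    have "f (elem_mats k 1 (rep x) (rep x)) \<le> (\<Sum>k\<in>{1..m}. f (elem_mats k 1 (rep x) (rep x)))"
      using k by (intro member_le_sum f_elem_nonneg rep(1)) auto
    also have "\<dots> = Re (\<Sum>k\<in>{1..m}. s k (\<phi> k 1) x x)"
      unfolding Re_sum by (intro sum.cong refl) (simp add: one s_def Re_fc)
    also have "\<dots> \<le> cmod (cinner (bop_apply (\<theta> 1) x) x)" unfolding s_sum by (rule complex_Re_le_cmod)
    also have "\<dots> \<le> norm (bop_apply (\<theta> 1) x) * norm x" by (rule cinner_Cauchy_Schwarz)
    also have "\<dots> \<le> (C * norm x) * norm x" unfolding C_def by (intro mult_right_mono norm_bop_apply) simp
    finally show ?thesis by (simp add: power2_eq_square mult.assoc)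
  qed
  have unit_bound: "cmod (s k a x y) \<le> C" if k: "k \<in> {1..m}" and n: "norm a \<le> 1" "norm x \<le> 1" "norm y \<le> 1" for k a x y
  proof -
    \<comment> \<open>Multiply \<open>a\<close> by a phase so that the value of the form becomes negative.\<close>
    define z where "z = (if s k a x y = 0 then 1 else - cnj (s k a x y) / complex_of_real (cmod (s k a x y)))"
    have z: "cmod z = 1" by (simp add: z_def norm_divide)
    have "z * s k a x y = - complex_of_real (cmod (s k a x y))"
    proof (cases "s k a x y = 0")
      case False
      have "cnj (s k a x y) * s k a x y = complex_of_real (cmod (s k a x y)) * complex_of_real (cmod (s k a x y))"
        by (metis complex_norm_square mult.commute power2_eq_square of_real_mult)
      then show ?thesis using False by (simp add: z_def)
    qed simp
    then have "2 * cmod (s k a x y) = - (2 * f (elem_mats k (z *\<^sub>C a) (rep x) (rep y)))"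
      using s_scale[OF k, of z a x y] by (simp add: s_def flip: Re_fc)
    also have "\<dots> \<le> f (elem_mats k 1 (rep x) (rep x)) + f (elem_mats k 1 (rep y) (rep y))"
      by (rule f_elem_bound[OF k rep(1) rep(1)]) (simp add: norm_scaleC z n)
    also have "\<dots> \<le> C * (norm x)\<^sup>2 + C * (norm y)\<^sup>2" by (intro add_mono diag_bound k)
    also have "\<dots> \<le> C * 1 + C * 1"
      using n C by (intro add_mono mult_left_mono) (auto simp: power_le_one)
    finally show ?thesis by simp
  qed
  have s_bound: "cmod (s k a x y) \<le> C * norm a * norm x * norm y" if k: "k \<in> {1..m}" for k a x y
  proof (cases "a = 0 \<or> x = 0 \<or> y = 0")
    case True
    then have "s k a x y = 0"
      using s_scale[OF k, of 0 a x y] s_scale_left[OF k, of a 0 x y] s_scale_right[OF k, of a x 0 y] by auto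
    then show ?thesis using C by simp
  next
    case False
    let ?n = "\<lambda>r. complex_of_real (inverse r)"
    have "cmod (s k (?n (norm a) *\<^sub>C a) (?n (norm x) *\<^sub>C x) (?n (norm y) *\<^sub>C y)) \<le> C"
      using False by (intro unit_bound k) (simp_all add: norm_scaleC norm_inverse)
    then show ?thesis
      using False by (simp add: s_scale[OF k] s_scale_left[OF k] s_scale_right[OF k] norm_mult norm_divide field_simps)
  qed
  have "\<exists>T. norm T \<le> C * norm a \<and> (\<forall>x y. cinner (bop_apply T x) y = s k a x y)" if k: "k \<in> {1..m}" for k a
    by (rule bop_of_sesquilinear)
      (simp_all add: s_add_left[OF k] s_scale_left[OF k] s_add_right[OF k] s_scale_right[OF k] s_bound[OF k] C)
  then have "\<exists>T. k \<in> {1..m} \<longrightarrow> norm T \<le> C * norm a \<and> (\<forall>x y. cinner (bop_apply T x) y = s k a x y)" for k a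
    by blast
  then obtain \<psi> where "\<And>k a. k \<in> {1..m} \<longrightarrow> norm (\<psi> k a) \<le> C * norm a \<and> (\<forall>x y. cinner (bop_apply (\<psi> k a) x) y = s k a x y)"
    by metis
  then have \<psi>_norm: "norm (\<psi> k a) \<le> C * norm a" and \<psi>: "cinner (bop_apply (\<psi> k a) x) y = s k a x y"
    if "k \<in> {1..m}" for k a x y using that by blast+
  \<comment> \<open>Linearity and self-adjointness are inherited from the forms.\<close>
  have "completely_positive (\<psi> k)" if k: "k \<in> {1..m}" for k
  proof -
    have \<psi>_scale: "\<psi> k (z *\<^sub>C a) = z *\<^sub>C \<psi> k a" for z a
      by (rule bop_eqI_cinner) (simp add: \<psi>[OF k] bop_apply_simps cinner_scaleC_left s_scale[OF k])
    have \<psi>_add: "\<psi> k (a + b) = \<psi> k a + \<psi> k b" for a b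
      by (rule bop_eqI_cinner) (simp add: \<psi>[OF k] bop_apply_simps cinner_add_left s_add[OF k])
    have \<psi>_star: "\<psi> k (star a) = star (\<psi> k a)" for a
    proof (rule bop_eqI_cinner)
      fix x y
      have "cinner (bop_apply (star (\<psi> k a)) x) y = cnj (cinner (bop_apply (\<psi> k a) y) x)"
        by (subst cinner_commute) (simp add: star_bop)
      then show "cinner (bop_apply (\<psi> k (star a)) x) y = cinner (bop_apply (star (\<psi> k a)) x) y"
        by (simp add: \<psi>[OF k] s_star[OF k])
    qed
    have "bounded_linear (\<psi> k)"
      by (rule bounded_linear_intro[where K = C]) (simp_all add: \<psi>_add scaleR_scaleC \<psi>_scale \<psi>_norm[OF k] mult.commute)
    moreover have "map_mat (\<psi> k) X \<in> mat_pos n" if X: "X \<in> mat_pos n" for n X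
    proof -
      have Xc: "X \<in> carrier_mat n n" and Xp: "pos_form {..<n} (\<lambda>i j. X $$ (i, j))"
        using X by (simp_all add: mat_pos_iff)
      have herm: "hermitian {..<n} (\<lambda>i j. \<psi> k (X $$ (i, j)))"
        using Xp by (auto simp: pos_form_def hermitian_def simp flip: \<psi>_star)
      have "0 \<le> Re (\<Sum>i\<in>{..<n}. \<Sum>j\<in>{..<n}. cinner (bop_apply (\<psi> k (X $$ (i, j))) (x j)) (x i))" for x
      proof -
        have "(\<Sum>i\<in>{..<n}. \<Sum>j\<in>{..<n}. cinner (bop_apply (\<psi> k (X $$ (i, j))) (x j)) (x i))
          = (\<Sum>i\<in>{..<n}. \<Sum>j\<in>{..<n}. fc (elem_mats k (X $$ (i, j)) (rep (x j)) (rep (x i))))"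
          by (simp add: \<psi>[OF k] s_def)
        also have "\<dots> = (\<Sum>i\<in>{..<n}. fc (\<Sum>j\<in>{..<n}. elem_mats k (X $$ (i, j)) (rep (x j)) (rep (x i))))"
          by (intro sum.cong refl fc_sum[symmetric] fin k)
        also have "\<dots> = fc (\<Sum>i\<in>{..<n}. \<Sum>j\<in>{..<n}. elem_mats k (X $$ (i, j)) (rep (x j)) (rep (x i)))"
          by (intro fc_sum[symmetric] fin_sum fin k)
        finally show ?thesis
          using f_elem_matrix_nonneg[OF k _ rep(1) Xp, of x] by (simp add: Re_fc)
      qed
      then have "pos_form {..<n} (\<lambda>i j. \<psi> k (X $$ (i, j)))" using herm by (simp add: pos_form_bop_iff)
      then have "pos_form {..<n} (\<lambda>i j. map_mat (\<psi> k) X $$ (i, j))"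
        by (subst pos_form_cong[where Y = "\<lambda>i j. \<psi> k (X $$ (i, j))"]) (use Xc in simp_all)
      then show ?thesis using Xc by (simp add: mat_pos_iff)
    qed
    ultimately show ?thesis
      by (simp add: completely_positive_def bounded_star_map_def bounded_clinear_def \<psi>_scale \<psi>_star)
  qed
  moreover have "\<theta> = (\<lambda>a. \<Sum>k = 1..m. \<psi> k (\<phi> k a))"
  proof
    fix a
    show "\<theta> a = (\<Sum>k = 1..m. \<psi> k (\<phi> k a))"
    proof (rule bop_eqI_cinner)
      fix x y
      have "cinner (bop_apply (\<Sum>k = 1..m. \<psi> k (\<phi> k a)) x) y = (\<Sum>k\<in>{1..m}. s k (\<phi> k a) x y)"
        unfolding bop_apply_sum cinner_sum_left by (intro sum.cong refl \<psi>)
      then show "cinner (bop_apply (\<theta> a) x) y = cinner (bop_apply (\<Sum>k = 1..m. \<psi> k (\<phi> k a)) x) y"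
        by (simp only: s_sum)
    qed
  qed
  ultimately show ?thesis unfolding finitely_decomposable_def by blast
qed

section \<open>The characterization\<close>

lemma positive_if_decomposable:
  assumes dec: "finitely_decomposable m \<phi> \<theta>" and X: "X \<in> Gamma_pos n m \<phi>"
  shows "map_mat \<theta> X \<in> mat_pos n"
proof -
  obtain \<psi> where \<psi>: "\<And>k. k \<in> {1..m} \<Longrightarrow> completely_positive (\<psi> k)" "\<theta> = (\<lambda>a. \<Sum>k = 1..m. \<psi> k (\<phi> k a))"
    using dec unfolding finitely_decomposable_def by blast
  have Xc: "X \<in> carrier_mat n n" using X by (simp add: Gamma_pos_def)
  have P: "pos_form {..<n} (\<lambda>i j. \<psi> k (\<phi> k (X $$ (i, j))))" if k: "k \<in> {1..m}" for k
  proof -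
    have "map_mat (\<phi> k) X \<in> mat_pos n" using X k by (simp add: Gamma_pos_def)
    then have "map_mat (\<psi> k) (map_mat (\<phi> k) X) \<in> mat_pos n"
      using \<psi>(1)[OF k] by (simp add: completely_positive_def)
    then have "pos_form {..<n} (\<lambda>i j. map_mat (\<psi> k) (map_mat (\<phi> k) X) $$ (i, j))" by (simp add: mat_pos_iff)
    then show ?thesis by (subst (asm) pos_form_cong[where Y = "\<lambda>i j. \<psi> k (\<phi> k (X $$ (i, j)))"]) (use Xc in simp_all)
  qed
  have "pos_form {..<n} (\<lambda>i j. \<theta> (X $$ (i, j)))"
    unfolding pos_form_def
  proof (intro conjI allI)
    show "hermitian {..<n} (\<lambda>i j. \<theta> (X $$ (i, j)))"
      unfolding \<psi>(2) hermitian_def star_sum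
      by (intro ballI sum.cong refl) (use P in \<open>auto simp: pos_form_def hermitian_def\<close>)
    fix v
    have "ip {..<n} v (app {..<n} (\<lambda>i j. \<theta> (X $$ (i, j))) v)
        = (\<Sum>k = 1..m. ip {..<n} v (app {..<n} (\<lambda>i j. \<psi> k (\<phi> k (X $$ (i, j)))) v))"
      unfolding ip_app_double_sum \<psi>(2) sum_distrib_left sum_distrib_right
      by (subst (2) sum.swap, subst sum.swap) (rule refl)
    also have "cpos \<dots>" by (rule cpos_sum) (use P in \<open>simp add: pos_form_def\<close>)
    finally show "cpos (ip {..<n} v (app {..<n} (\<lambda>i j. \<theta> (X $$ (i, j))) v))" .
  qed
  then have "pos_form {..<n} (\<lambda>i j. map_mat \<theta> X $$ (i, j))"
    by (subst pos_form_cong[where Y = "\<lambda>i j. \<theta> (X $$ (i, j))"]) (use Xc in simp_all)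
  then show ?thesis using Xc by (simp add: mat_pos_iff)
qed

lemma mat_pos_single:
  fixes g :: "'c \<Rightarrow> 'a::unital_cstar_algebra"
  shows "map_mat g (mat 1 1 (\<lambda>_. a)) \<in> mat_pos 1 \<longleftrightarrow> cpos (g a)"
proof -
  have "pos_form {..<1} (\<lambda>i j. map_mat g (mat 1 1 (\<lambda>_. a)) $$ (i, j)) \<longleftrightarrow> pos_form {..<1::nat} (\<lambda>i j. g a)"
    by (rule pos_form_cong) simp
  also have "\<dots> \<longleftrightarrow> cpos (g a)"
  proof
    assume "pos_form {..<1::nat} (\<lambda>i j. g a)"
    then have "cpos (ip {..<1::nat} (\<lambda>_. 1) (app {..<1} (\<lambda>i j. g a) (\<lambda>_. 1)))" by (simp add: pos_form_def)
    then show "cpos (g a)" by (simp add: ip_def app_def)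
  next
    assume "cpos (g a)"
    then show "pos_form {..<1::nat} (\<lambda>i j. g a)"
      using cpos_conj[of "g a"] by (simp add: pos_form_def hermitian_def cpos_star ip_def app_def mult.assoc)
  qed
  finally have "pos_form {..<1} (\<lambda>i j. map_mat g (mat 1 1 (\<lambda>_. a)) $$ (i, j)) \<longleftrightarrow> cpos (g a)" .
  moreover have "map_mat g (mat 1 1 (\<lambda>_. a)) \<in> carrier_mat 1 1" by simp
  ultimately show ?thesis unfolding mat_pos_iff by blast
qed

text \<open>Under every \<open>\<phi>\<^sub>k\<close>, a self-adjoint \<open>a\<close> becomes positive after adding a large multiple \<open>r\<close> of the unit,
  so \<open>\<theta> (r + a)\<close> is positive.  Two such multiples exhibit \<open>\<theta> a\<close> as a real combination of self-adjoint
  operators.\<close>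

lemma star_map_if_positive:
  fixes \<phi> :: "nat \<Rightarrow> 'a::unital_cstar_algebra \<Rightarrow> 'a" and \<theta> :: "'a \<Rightarrow> 'h::chilbert_space bop"
  assumes \<phi>: "\<And>k. k \<in> {1..m} \<Longrightarrow> bounded_star_map (\<phi> k)"
    and one: "\<And>k. k \<in> {1..m} \<Longrightarrow> \<phi> k 1 = 1"
    and \<theta>: "bounded_clinear \<theta>"
    and pos: "\<And>n X. X \<in> carrier_mat n n \<Longrightarrow> X \<in> Gamma_pos n m \<phi> \<Longrightarrow> map_mat \<theta> X \<in> mat_pos n"
  shows "bounded_star_map \<theta>"
proof -
  have sa: "star (\<theta> a) = \<theta> a" if a: "star a = a" for a
  proof -
    define R where "R = (\<Sum>k\<in>{1..m}. norm (\<phi> k a))"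
    have p: "cpos (\<theta> (r *\<^sub>R 1 + a))" if r: "r \<ge> R" for r
    proof -
      let ?X = "mat 1 1 (\<lambda>_. r *\<^sub>R 1 + a)"
      have "map_mat (\<phi> k) ?X \<in> mat_pos 1" if k: "k \<in> {1..m}" for k
      proof -
        have "bounded_clinear (\<phi> k)" and st: "star (\<phi> k a) = \<phi> k a"
          using \<phi>[OF k] a by (auto simp: bounded_star_map_def) metis
        have "norm (\<phi> k a) \<le> r"
          using r k member_le_sum[of k "{1..m}" "\<lambda>k. norm (\<phi> k a)"] by (simp add: R_def)
        then have "cpos (\<phi> k (r *\<^sub>R 1 + a))"
          using cpos_norm_plus[OF st] by (simp add: bounded_clinear_simps[OF \<open>bounded_clinear (\<phi> k)\<close>] one[OF k])
        then show ?thesis unfolding mat_pos_single .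
      qed
      then have "map_mat \<theta> ?X \<in> mat_pos 1" by (intro pos) (simp_all add: Gamma_pos_def)
      then show ?thesis unfolding mat_pos_single .
    qed
    have "\<theta> a = (R + 1) *\<^sub>R \<theta> (R *\<^sub>R 1 + a) - R *\<^sub>R \<theta> ((R + 1) *\<^sub>R 1 + a)"
      by (simp add: bounded_clinear_simps[OF \<theta>] scaleR_add_left scaleR_add_right distrib_left distrib_right)
    moreover have "star (\<theta> (r *\<^sub>R 1 + a)) = \<theta> (r *\<^sub>R 1 + a)" if "r \<ge> R" for r
      using p[OF that] by (rule cpos_star)
    ultimately show ?thesis by (metis star_diff star_scaleR less_add_one less_imp_le order_refl)
  qed
  have "\<theta> (star a) = star (\<theta> a)" for a
  proof -
    define x y where "x = (1/2) *\<^sub>C (a + star a)" and "y = (- \<i>/2) *\<^sub>C (a - star a)"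
    have "star x = x" by (simp add: x_def star_simps star_scaleC add.commute)
    moreover have "star y = y"
      by (simp add: y_def star_simps star_scaleC scaleC_diff_right scaleC_minus_left)
    moreover have a: "a = x + \<i> *\<^sub>C y"
    proof -
      have "x + \<i> *\<^sub>C y = (1/2) *\<^sub>C a + (1/2) *\<^sub>C a"
        by (simp add: x_def y_def scaleC_scaleC scaleC_add_right scaleC_diff_right)
      then show ?thesis by (simp add: scaleC_add_left[symmetric] scaleC_one)
    qed
    ultimately show ?thesis
      unfolding a by (simp add: star_add star_scaleC bounded_clinear_simps[OF \<theta>] sa)
  qed
  then show ?thesis using \<theta> by (simp add: bounded_star_map_def)
qed

theorem theorem3p2:
  fixes m :: nat
    and \<phi> :: "nat \<Rightarrow> 'a::unital_cstar_algebra \<Rightarrow> 'a"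
    and \<theta> :: "'a \<Rightarrow> 'h::chilbert_space bop"
  assumes "\<And>k. k \<in> {1..m} \<Longrightarrow> bounded_star_map (\<phi> k)"
    and "\<And>k. k \<in> {1..m} \<Longrightarrow> \<phi> k 1 = 1"
    and "bounded_clinear \<theta>"
  shows "finitely_decomposable m \<phi> \<theta> \<longleftrightarrow>
    (\<forall>n. \<forall>X \<in> carrier_mat n n. X \<in> Gamma_pos n m \<phi> \<longrightarrow> map_mat \<theta> X \<in> mat_pos n)"
proof
  assume "finitely_decomposable m \<phi> \<theta>"
  then show "\<forall>n. \<forall>X \<in> carrier_mat n n. X \<in> Gamma_pos n m \<phi> \<longrightarrow> map_mat \<theta> X \<in> mat_pos n"
    using positive_if_decomposable by blast
next
  assume "\<forall>n. \<forall>X \<in> carrier_mat n n. X \<in> Gamma_pos n m \<phi> \<longrightarrow> map_mat \<theta> X \<in> mat_pos n"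
  then have pos: "map_mat \<theta> X \<in> mat_pos n" if "X \<in> carrier_mat n n" "X \<in> Gamma_pos n m \<phi>" for n X
    using that by blast
  show "finitely_decomposable m \<phi> \<theta>"
    by (rule decomposable_if_positive[OF assms(1,2) star_map_if_positive[OF assms pos] pos])
qed

end
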